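(* For any directed graph $G$ on $n$ vertices and $m$ edges with positive real capacities, a designated source vertex $s$ and a designated sink vertex $t$, and any integer $k\in\{1,\dots,m\}$, there is an algorithm that computes the $k^{\text{th}}$ most vital edge of $G$ using $\mathcal{O}(n)$ maximum $(s,t)$-flow computations.
   Context: An $(s,t)$-cut is a set $C$ of vertices with $s\in C$, $t\notin C$; its capacity is the total capacity of edges leaving $C$; the $(s,t)$-mincut capacity is the minimum capacity of an $(s,t)$-cut. The vitality of an edge is the decrease of the $(s,t)$-mincut capacity when the edge is removed. The $k^{\text{th}}$ most vital edge is the edge in position $k$ when the edges are ordered by non-increasing vitality. *)

theory Defs
  imports Complex_Main "Graph_Theory.Digraph"
begin

section \<open>Networks, cuts and vitality\<close>

text \<open>
  A directed graph is a finite digraph without parallel arcs, i.e. the arcs are ordered pairs of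
  vertices; loops and antiparallel arcs are allowed.
\<close>

definition st_network ::
  "('v, 'e) pre_digraph \<Rightarrow> ('e \<Rightarrow> real) \<Rightarrow> 'v \<Rightarrow> 'v \<Rightarrow> bool" where
  "st_network G c s t \<longleftrightarrow> fin_digraph G \<and> nomulti_digraph G \<and>
     s \<in> verts G \<and> t \<in> verts G \<and> s \<noteq> t \<and> (\<forall>e\<in>arcs G. 0 < c e)"

definition st_cut :: "('v, 'e) pre_digraph \<Rightarrow> 'v \<Rightarrow> 'v \<Rightarrow> 'v set \<Rightarrow> bool" where
  "st_cut G s t C \<longleftrightarrow> C \<subseteq> verts G \<and> s \<in> C \<and> t \<notin> C"

definition cut_capacity :: "('v, 'e) pre_digraph \<Rightarrow> ('e \<Rightarrow> real) \<Rightarrow> 'v set \<Rightarrow> real" where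
  "cut_capacity G c C = (\<Sum>e\<in>{e \<in> arcs G. tail G e \<in> C \<and> head G e \<notin> C}. c e)"

definition mincut_capacity ::
  "('v, 'e) pre_digraph \<Rightarrow> ('e \<Rightarrow> real) \<Rightarrow> 'v \<Rightarrow> 'v \<Rightarrow> real" where
  "mincut_capacity G c s t = Min (cut_capacity G c ` {C. st_cut G s t C})"

definition vitality ::
  "('v, 'e) pre_digraph \<Rightarrow> ('e \<Rightarrow> real) \<Rightarrow> 'v \<Rightarrow> 'v \<Rightarrow> 'e \<Rightarrow> real" where
  "vitality G c s t e =
     mincut_capacity G c s t - mincut_capacity (pre_digraph.del_arc G e) c s t"

text \<open>Ties may be broken arbitrarily; positions count from 1.\<close>

definition kth_most_vital ::
  "('v, 'e) pre_digraph \<Rightarrow> ('e \<Rightarrow> real) \<Rightarrow> 'v \<Rightarrow> 'v \<Rightarrow> nat \<Rightarrow> 'e \<Rightarrow> bool" where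
  "kth_most_vital G c s t k e \<longleftrightarrow>
     (\<exists>es. distinct es \<and> set es = arcs G \<and>
           sorted_wrt (\<lambda>a b. vitality G c s t a \<ge> vitality G c s t b) es \<and>
           1 \<le> k \<and> k \<le> length es \<and> es ! (k - 1) = e)"


section \<open>Maximum flows\<close>

definition st_flow ::
  "('v, 'e) pre_digraph \<Rightarrow> ('e \<Rightarrow> real) \<Rightarrow> 'v \<Rightarrow> 'v \<Rightarrow> ('e \<Rightarrow> real) \<Rightarrow> bool" where
  "st_flow G c s t f \<longleftrightarrow>
     (\<forall>e\<in>arcs G. 0 \<le> f e \<and> f e \<le> c e) \<and>
     (\<forall>v\<in>verts G - {s, t}. sum f (in_arcs G v) = sum f (out_arcs G v))"

definition flow_value :: "('v, 'e) pre_digraph \<Rightarrow> 'v \<Rightarrow> ('e \<Rightarrow> real) \<Rightarrow> real" where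
  "flow_value G s f = sum f (out_arcs G s) - sum f (in_arcs G s)"

definition max_st_flow ::
  "('v, 'e) pre_digraph \<Rightarrow> ('e \<Rightarrow> real) \<Rightarrow> 'v \<Rightarrow> 'v \<Rightarrow> ('e \<Rightarrow> real) \<Rightarrow> bool" where
  "max_st_flow G c s t f \<longleftrightarrow> st_flow G c s t f \<and>
     (\<forall>g. st_flow G c s t g \<longrightarrow> flow_value G s g \<le> flow_value G s f)"

type_synonym flow_oracle =
  "(nat, nat) pre_digraph \<Rightarrow> (nat \<Rightarrow> real) \<Rightarrow> nat \<Rightarrow> nat \<Rightarrow> nat \<Rightarrow> real"

text \<open>A maximum flow procedure may return any of the maximum flows of a network.\<close>

definition max_flow_oracle :: "flow_oracle \<Rightarrow> bool" where
  "max_flow_oracle mf \<longleftrightarrow>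
     (\<forall>H c s t. st_network H c s t \<longrightarrow> max_st_flow H c s t (mf H c s t))"


section \<open>Algorithms\<close>

text \<open>
  Algorithms are programs of a random access machine with two memories, one of natural numbers and
  one of real numbers. Each memory consists of finitely many (per program) named arrays with two
  indices; the entry \<open>[i, 0]\<close> of an array serves as a one-dimensional array, and the entry
  \<open>[0, 0]\<close> as a scalar variable.

  Natural numbers can only be incremented, decremented and compared. Hence no natural number in the
  memory exceeds the input and the running time by more than a factor depending on the program, and
  charging one unit per step is realistic. Reals can be added, subtracted and compared; there is no
  rounding from reals to naturals.
\<close>

type_synonym vname = string

datatype nexp = NConst nat | NCell vname nexp nexp | NInc nexp | NDec nexp

datatype rexp = RConst int | RCell vname nexp nexp | RAdd rexp rexp | RSub rexp rexp

datatype bexp = NLess nexp nexp | RLess rexp rexp | BNot bexp | BAnd bexp bexp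

datatype com =
    Skip
  | NAssign vname nexp nexp nexp
  | RAssign vname nexp nexp rexp
  | Seq com com
  | Cond bexp com com
  | While bexp com
  | MaxFlow nexp nexp vname vname vname nexp nexp vname

record memory =
  nats :: "vname \<Rightarrow> nat \<Rightarrow> nat \<Rightarrow> nat"
  reals :: "vname \<Rightarrow> nat \<Rightarrow> nat \<Rightarrow> real"

fun nval :: "nexp \<Rightarrow> memory \<Rightarrow> nat" where
  "nval (NConst k) \<sigma> = k"
| "nval (NCell x a b) \<sigma> = nats \<sigma> x (nval a \<sigma>) (nval b \<sigma>)"
| "nval (NInc a) \<sigma> = nval a \<sigma> + 1"
| "nval (NDec a) \<sigma> = nval a \<sigma> - 1"

fun rval :: "rexp \<Rightarrow> memory \<Rightarrow> real" where
  "rval (RConst z) \<sigma> = of_int z"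
| "rval (RCell x a b) \<sigma> = reals \<sigma> x (nval a \<sigma>) (nval b \<sigma>)"
| "rval (RAdd p q) \<sigma> = rval p \<sigma> + rval q \<sigma>"
| "rval (RSub p q) \<sigma> = rval p \<sigma> - rval q \<sigma>"

fun bval :: "bexp \<Rightarrow> memory \<Rightarrow> bool" where
  "bval (NLess a b) \<sigma> \<longleftrightarrow> nval a \<sigma> < nval b \<sigma>"
| "bval (RLess p q) \<sigma> \<longleftrightarrow> rval p \<sigma> < rval q \<sigma>"
| "bval (BNot b) \<sigma> \<longleftrightarrow> \<not> bval b \<sigma>"
| "bval (BAnd b d) \<sigma> \<longleftrightarrow> bval b \<sigma> \<and> bval d \<sigma>"

definition nwrite :: "vname \<Rightarrow> nat \<Rightarrow> nat \<Rightarrow> nat \<Rightarrow> memory \<Rightarrow> memory" where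
  "nwrite x i j k \<sigma> = \<sigma>\<lparr>nats := (nats \<sigma>)(x := (nats \<sigma> x)(i := (nats \<sigma> x i)(j := k)))\<rparr>"

definition rwrite :: "vname \<Rightarrow> nat \<Rightarrow> nat \<Rightarrow> real \<Rightarrow> memory \<Rightarrow> memory" where
  "rwrite x i j r \<sigma> = \<sigma>\<lparr>reals := (reals \<sigma>)(x := (reals \<sigma> x)(i := (reals \<sigma> x i)(j := r)))\<rparr>"

text \<open>The graph with vertices \<open>0, \<dots>, p - 1\<close> and arcs \<open>0, \<dots>, q - 1\<close> stored in the arrays
  \<open>ta\<close> and \<open>he\<close>.\<close>

definition stored_graph :: "nat \<Rightarrow> nat \<Rightarrow> vname \<Rightarrow> vname \<Rightarrow> memory \<Rightarrow> (nat, nat) pre_digraph" where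
  "stored_graph p q ta he \<sigma> =
     \<lparr>verts = {..<p}, arcs = {..<q}, tail = (\<lambda>i. nats \<sigma> ta i 0), head = (\<lambda>i. nats \<sigma> he i 0)\<rparr>"

text \<open>
  \<open>exec mf P \<sigma> \<sigma>' T Q\<close>: program \<open>P\<close>, started in memory \<open>\<sigma>\<close>, halts in memory \<open>\<sigma>'\<close> after \<open>T\<close> steps,
  and \<open>Q\<close> lists the numbers of vertices and arcs of the networks passed to the maximum flow
  procedure \<open>mf\<close>. A maximum flow computation counts as one step here, so that its actual cost
  is accounted for by \<open>Q\<close> alone; writing its input and reading its output is charged to \<open>T\<close>. The
  program gets stuck when \<open>mf\<close> is called on something that is not a network.
\<close>

inductive exec ::
  "flow_oracle \<Rightarrow> com \<Rightarrow> memory \<Rightarrow> memory \<Rightarrow> nat \<Rightarrow> (nat \<times> nat) list \<Rightarrow> bool"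
  for mf :: flow_oracle where
  Skip: "exec mf Skip \<sigma> \<sigma> 1 []"
| NAssign: "exec mf (NAssign x a b e) \<sigma>
     (nwrite x (nval a \<sigma>) (nval b \<sigma>) (nval e \<sigma>) \<sigma>) 1 []"
| RAssign: "exec mf (RAssign x a b r) \<sigma>
     (rwrite x (nval a \<sigma>) (nval b \<sigma>) (rval r \<sigma>) \<sigma>) 1 []"
| Seq: "exec mf P \<sigma> \<sigma>' T Q \<Longrightarrow> exec mf P' \<sigma>' \<sigma>'' T' Q' \<Longrightarrow>
     exec mf (Seq P P') \<sigma> \<sigma>'' (T + T') (Q @ Q')"
| CondTrue: "bval b \<sigma> \<Longrightarrow> exec mf P \<sigma> \<sigma>' T Q \<Longrightarrow> exec mf (Cond b P P') \<sigma> \<sigma>' (T + 1) Q"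
| CondFalse: "\<not> bval b \<sigma> \<Longrightarrow> exec mf P' \<sigma> \<sigma>' T Q \<Longrightarrow> exec mf (Cond b P P') \<sigma> \<sigma>' (T + 1) Q"
| WhileFalse: "\<not> bval b \<sigma> \<Longrightarrow> exec mf (While b P) \<sigma> \<sigma> 1 []"
| WhileTrue: "bval b \<sigma> \<Longrightarrow> exec mf P \<sigma> \<sigma>' T Q \<Longrightarrow> exec mf (While b P) \<sigma>' \<sigma>'' T' Q' \<Longrightarrow>
     exec mf (While b P) \<sigma> \<sigma>'' (T + T' + 1) (Q @ Q')"
| MaxFlow: "p = nval a \<sigma> \<Longrightarrow> q = nval b \<sigma> \<Longrightarrow>
     H = stored_graph p q ta he \<sigma> \<Longrightarrow> c = (\<lambda>i. reals \<sigma> cp i 0) \<Longrightarrow>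
     st_network H c (nval s \<sigma>) (nval t \<sigma>) \<Longrightarrow>
     f = mf H c (nval s \<sigma>) (nval t \<sigma>) \<Longrightarrow>
     \<sigma>' = \<sigma>\<lparr>reals := (reals \<sigma>)(x := \<lambda>i j. if i < q \<and> j = 0 then f i else reals \<sigma> x i j)\<rparr> \<Longrightarrow>
     exec mf (MaxFlow a b ta he cp s t x) \<sigma> \<sigma>' 1 [(p, q)]"

text \<open>Hence an existential claim about the outcome of a run is a claim about the unique run.\<close>

lemma exec_deterministic:
  "exec mf P \<sigma> \<sigma>1 T1 Q1 \<Longrightarrow> exec mf P \<sigma> \<sigma>2 T2 Q2 \<Longrightarrow> \<sigma>1 = \<sigma>2 \<and> T1 = T2 \<and> Q1 = Q2"
proof (induction arbitrary: \<sigma>2 T2 Q2 rule: exec.induct)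
  case (Seq P \<sigma> \<sigma>' T Q P' \<sigma>'' T' Q')
  from Seq.prems show ?case by cases (use Seq.IH in blast)
next
  case (CondTrue b \<sigma> P \<sigma>' T Q P')
  from CondTrue.prems show ?case by cases (use CondTrue in blast)+
next
  case (CondFalse b \<sigma> P' \<sigma>' T Q P)
  from CondFalse.prems show ?case by cases (use CondFalse in blast)+
next
  case (WhileFalse b \<sigma> P)
  from WhileFalse.prems show ?case by cases (use WhileFalse in auto)
next
  case (WhileTrue b \<sigma> P \<sigma>' T Q \<sigma>'' T' Q')
  from WhileTrue.prems show ?case by cases (use WhileTrue in blast)+
qed (auto elim: exec.cases)

definition input ::
  "(nat, nat) pre_digraph \<Rightarrow> (nat \<Rightarrow> real) \<Rightarrow> nat \<Rightarrow> nat \<Rightarrow> nat \<Rightarrow> memory" where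
  "input G c s t k =
     \<lparr>nats = (\<lambda>x i j.
        if x = ''n'' \<and> i = 0 \<and> j = 0 then card (verts G)
        else if x = ''m'' \<and> i = 0 \<and> j = 0 then card (arcs G)
        else if x = ''s'' \<and> i = 0 \<and> j = 0 then s
        else if x = ''t'' \<and> i = 0 \<and> j = 0 then t
        else if x = ''k'' \<and> i = 0 \<and> j = 0 then k
        else if x = ''tail'' \<and> i \<in> arcs G \<and> j = 0 then tail G i
        else if x = ''head'' \<and> i \<in> arcs G \<and> j = 0 then head G i
        else 0),
      reals = (\<lambda>x i j. if x = ''cap'' \<and> i \<in> arcs G \<and> j = 0 then c i else 0)\<rparr>"

definition result :: "memory \<Rightarrow> nat" where
  "result \<sigma> = nats \<sigma> ''out'' 0 0"

text \<open>
  \<open>runs_with_flows mf P \<sigma> n m d \<sigma>'\<close>: on an input graph with \<open>n\<close> vertices and \<open>m\<close> arcs, the time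
  taken by \<open>P\<close> is that of \<open>\<O>(n)\<close> maximum flow computations, with implied constant \<open>d\<close>. Without the
  bound on the sizes of the networks, many flow problems could be packed into one. Without the bound
  on the remaining work (which is linear in the size of the graph for each of the \<open>\<O>(n)\<close> flow
  computations, hence dominated by them) the program could compute maximum flows by itself.
\<close>

definition runs_with_flows ::
  "flow_oracle \<Rightarrow> com \<Rightarrow> memory \<Rightarrow> nat \<Rightarrow> nat \<Rightarrow> nat \<Rightarrow> memory \<Rightarrow> bool" where
  "runs_with_flows mf P \<sigma> n m d \<sigma>' \<longleftrightarrow>
     (\<exists>T Q. exec mf P \<sigma> \<sigma>' T Q \<and>
        length Q \<le> d * n \<and>
        (\<forall>(p, q)\<in>set Q. p \<le> d * n \<and> q \<le> d * m) \<and>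
        T \<le> d * (n * (n + m)))"

end

theory Submission
  imports Defs
begin

text \<open>
  Let \<open>\<lambda>\<close> be the value of a maximum flow \<open>f\<close>. An arc \<open>e\<close> is vital iff it leaves a cut of capacity less than
  \<open>\<lambda> + c e\<close>, and its vitality is then \<open>\<lambda> + c e - cap C\<close> for a minimum such cut \<open>C\<close>. So it suffices to find
  \<open>\<O>(n)\<close> cuts among which there is such a \<open>C\<close> for every vital arc \<open>e\<close>.

  If no cut of capacity less than \<open>\<lambda> + c e\<close> is entered by \<open>e\<close>, then a minimum cut among those separating
  the ends of \<open>e\<close>, in either direction, is left by \<open>e\<close>. A Cheng-Hu ancestor tree provides such cuts for
  all pairs of vertices with \<open>2n\<close> flow computations.

  Otherwise \<open>e\<close> leaves a cut \<open>C\<close> and enters a cut \<open>D\<close>, both of residual capacity less than \<open>c e\<close>. The arc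
  \<open>e\<close> itself contributes \<open>c e - f e\<close> to the former and \<open>f e\<close> to the latter, so all other arcs crossing \<open>C\<close>
  have residual capacity below \<open>f e\<close>, and those crossing \<open>D\<close> below \<open>c e - f e\<close>. Hence \<open>e\<close> is the unique
  heaviest arc across \<open>C\<close> or \<open>D\<close> for the weight \<open>min (f e) (c e - f e)\<close>, and therefore belongs to every maximum spanning
  forest for this weight. One flow computation for each of the at most \<open>n - 1\<close> arcs of such a forest
  takes care of these.
\<close>

section \<open>Maximum flows and minimum cuts\<close>

text \<open>Every evaluated cut yields a lower bound on the vitality of each arc leaving it. The
  table \<open>vt\<close> may therefore be updated with any cut at all, and only the completeness of
  the family of cuts needs an argument.

  The usual construction of a Gomory-Hu tree rests on uncrossing symmetric submodular values. Here
  the cuts contain \<open>s\<close>, avoid \<open>t\<close> and are wanted in either orientation, so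
  an ancestor tree is used, which assumes nothing about the values. The two flows per seed are the
  two orientations of a pair.

  The budget of O(n + m) steps per flow shapes the programs: each cut is read off its flow by a
  linear search, hence the linked adjacency lists, and one pass updates all arcs leaving the cut. It
  does not matter which maximum flow is returned, since the vertices reachable in its residual graph
  form a minimum cut in any case.

  In the forest part the bottleneck arc is strictly heaviest, so ties in Prim's algorithm may be
  broken arbitrarily. The final selection extracts k times the largest of n row maxima, which costs
  O(nm).\<close>

definition leaving :: "('v, 'e) pre_digraph \<Rightarrow> 'v set \<Rightarrow> 'e set" where
  "leaving G C = {e \<in> arcs G. tail G e \<in> C \<and> head G e \<notin> C}"

definition entering :: "('v, 'e) pre_digraph \<Rightarrow> 'v set \<Rightarrow> 'e set" where
  "entering G C = {e \<in> arcs G. head G e \<in> C \<and> tail G e \<notin> C}"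

definition residual :: "('v, 'e) pre_digraph \<Rightarrow> ('e \<Rightarrow> real) \<Rightarrow> ('e \<Rightarrow> real) \<Rightarrow> ('v \<times> 'v) set" where
  "residual G c f = {(tail G e, head G e) | e. e \<in> arcs G \<and> f e < c e} \<union>
     {(head G e, tail G e) | e. e \<in> arcs G \<and> 0 < f e}"

lemma mincut_attained:
  assumes "finite {C. st_cut H s t C}" "{C. st_cut H s t C} \<noteq> {}"
  obtains C where "st_cut H s t C" "cut_capacity H c C = mincut_capacity H c s t"
proof -
  have "mincut_capacity H c s t \<in> cut_capacity H c ` {C. st_cut H s t C}"
    unfolding mincut_capacity_def using assms by (intro Min_in) auto
  then show ?thesis using that by auto
qed

lemma mincut_le:
  "finite {C. st_cut H s t C} \<Longrightarrow> st_cut H s t C \<Longrightarrow> mincut_capacity H c s t \<le> cut_capacity H c C"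
  unfolding mincut_capacity_def by (intro Min_le) auto

locale network =
  fixes G :: "('v, 'e) pre_digraph" and c :: "'e \<Rightarrow> real" and s t :: 'v
  assumes network: "st_network G c s t"
begin

lemma fin_digraph: "fin_digraph G"
  using network by (simp add: st_network_def)

sublocale fin_digraph G
  by (rule fin_digraph)

lemma st_verts [simp]: "s \<in> verts G" "t \<in> verts G" "s \<noteq> t" "t \<noteq> s"
  and cap_pos: "e \<in> arcs G \<Longrightarrow> 0 < c e"
  using network by (auto simp: st_network_def)

lemma nomulti:
  assumes "e \<in> arcs G" "e' \<in> arcs G" "tail G e = tail G e'" "head G e = head G e'"
  shows "e = e'"
proof -
  interpret nomulti_digraph G using network by (simp add: st_network_def)
  show ?thesis using no_multi_arcs[of e e'] assms by (simp add: arc_to_ends_def)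
qed

lemma finite_in_out [simp]: "finite (in_arcs G v)" "finite (out_arcs G v)"
  by (simp_all add: in_arcs_def out_arcs_def)

lemma finite_leaving [simp]: "finite (leaving G C)" "finite (entering G C)"
  by (simp_all add: leaving_def entering_def)

section \<open>Excess of an arc function and the flow across a cut\<close>

definition excess :: "('e \<Rightarrow> real) \<Rightarrow> 'v \<Rightarrow> real" where
  "excess f v = sum f (in_arcs G v) - sum f (out_arcs G v)"

text \<open>An arc with both ends in \<open>C\<close> is counted once with each sign and
  cancels.\<close>

lemma sum_excess:
  assumes "C \<subseteq> verts G"
  shows "(\<Sum>v\<in>C. excess f v) = sum f (entering G C) - sum f (leaving G C)"
proof -
  have fin: "finite C" using assms finite_verts finite_subset by blast
  have 1: "(\<Sum>v\<in>C. sum f (in_arcs G v)) = sum f {e \<in> arcs G. head G e \<in> C}"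
  proof -
    have "(\<Sum>v\<in>C. sum f (in_arcs G v)) = sum f (\<Union>v\<in>C. in_arcs G v)"
      by (rule sum.UNION_disjoint[symmetric]) (auto simp: fin)
    also have "(\<Union>v\<in>C. in_arcs G v) = {e \<in> arcs G. head G e \<in> C}" by auto
    finally show ?thesis .
  qed
  have 2: "(\<Sum>v\<in>C. sum f (out_arcs G v)) = sum f {e \<in> arcs G. tail G e \<in> C}"
  proof -
    have "(\<Sum>v\<in>C. sum f (out_arcs G v)) = sum f (\<Union>v\<in>C. out_arcs G v)"
      by (rule sum.UNION_disjoint[symmetric]) (auto simp: fin)
    also have "(\<Union>v\<in>C. out_arcs G v) = {e \<in> arcs G. tail G e \<in> C}" by auto
    finally show ?thesis .
  qed
  let ?B = "{e \<in> arcs G. head G e \<in> C \<and> tail G e \<in> C}"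
  have 3: "sum f {e \<in> arcs G. head G e \<in> C} = sum f ?B + sum f (entering G C)"
    by (subst sum.union_disjoint[symmetric])
      (auto simp: entering_def intro!: sum.cong)
  have 4: "sum f {e \<in> arcs G. tail G e \<in> C} = sum f ?B + sum f (leaving G C)"
    by (subst sum.union_disjoint[symmetric])
      (auto simp: leaving_def intro!: sum.cong)
  show ?thesis
    by (simp add: excess_def sum_subtractf 1 2 3 4)
qed

lemma st_flow_iff_excess:
  "st_flow G c s t f \<longleftrightarrow>
     (\<forall>e\<in>arcs G. 0 \<le> f e \<and> f e \<le> c e) \<and> (\<forall>v\<in>verts G - {s, t}. excess f v = 0)"
  by (auto simp: st_flow_def excess_def)

lemma flow_value_eq_excess: "flow_value G s f = - excess f s"
  by (simp add: flow_value_def excess_def)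

text \<open>By conservation \<open>s\<close> is the only vertex of \<open>C\<close> that can have
  nonzero excess, since \<open>t\<close> lies outside.\<close>

lemma flow_value_cut:
  assumes f: "st_flow G c s t f" and C: "st_cut G s t C"
  shows "flow_value G s f = sum f (leaving G C) - sum f (entering G C)"
proof -
  have sub: "C \<subseteq> verts G" "s \<in> C" "t \<notin> C" using C by (auto simp: st_cut_def)
  have "finite C" using sub finite_verts finite_subset by blast
  then have "(\<Sum>v\<in>C. excess f v) = excess f s + (\<Sum>v\<in>C - {s}. excess f v)"
    using sub by (simp add: sum.remove)
  also have "(\<Sum>v\<in>C - {s}. excess f v) = 0"
    using f sub by (intro sum.neutral) (auto simp: st_flow_iff_excess)
  finally show ?thesis using sum_excess[OF sub(1), of f] by (simp add: flow_value_eq_excess)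
qed

lemma cut_capacity_leaving: "cut_capacity G c C = sum c (leaving G C)"
  by (simp add: cut_capacity_def leaving_def)

text \<open>The right-hand side is the residual capacity of the cut. Through this identity a cut of
  small capacity bounds the residual capacities of all arcs that cross it.\<close>

lemma cut_capacity_diff:
  assumes f: "st_flow G c s t f" and C: "st_cut G s t C"
  shows "cut_capacity G c C - flow_value G s f =
    (\<Sum>e\<in>leaving G C. c e - f e) + sum f (entering G C)"
  by (simp add: flow_value_cut[OF assms] cut_capacity_leaving sum_subtractf)

lemma flow_value_le_cut:
  assumes f: "st_flow G c s t f" and C: "st_cut G s t C"
  shows "flow_value G s f \<le> cut_capacity G c C"
proof -
  have "0 \<le> (\<Sum>e\<in>leaving G C. c e - f e)" "0 \<le> sum f (entering G C)"
    using f by (auto intro!: sum_nonneg simp: st_flow_def leaving_def entering_def)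
  then show ?thesis using cut_capacity_diff[OF assms] by linarith
qed

section \<open>Augmentation and the max-flow min-cut theorem\<close>

definition feasible :: "('e \<Rightarrow> real) \<Rightarrow> bool" where
  "feasible f \<longleftrightarrow> (\<forall>e\<in>arcs G. 0 \<le> f e \<and> f e \<le> c e)"

lemma excess_add: "excess (\<lambda>e. f e + g e) v = excess f v + excess g v"
  by (simp add: excess_def sum.distrib)

lemma excess_scale: "excess (\<lambda>e. a * f e) v = a * excess f v"
  by (simp add: excess_def sum_distrib_left algebra_simps)

lemma excess_single:
  assumes "e \<in> arcs G"
  shows "excess (\<lambda>x. if x = e then d else 0) v =
    (if v = head G e then d else 0) - (if v = tail G e then d else 0)"
  using assms by (auto simp: excess_def sum.delta)

text \<open>
  Instead of augmenting along a simple path we keep the flow feasible by convexity: halving both the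
  flow pushed to \<open>v\<close> so far and the push along the next residual arc.
\<close>

lemma push_to_residual_reachable:
  assumes f: "feasible f" and reach: "(u, v) \<in> (residual G c f)\<^sup>*"
  shows "v \<noteq> u \<Longrightarrow> \<exists>h \<epsilon>. 0 < \<epsilon> \<and> feasible (\<lambda>e. f e + h e) \<and>
    (\<forall>w. excess h w = (if w = v then \<epsilon> else 0) - (if w = u then \<epsilon> else 0))"
  using reach
proof (induction rule: rtrancl_induct)
  case base
  then show ?case by simp
next
  case (step v w)
  from step.hyps(2) obtain k :: "'e \<Rightarrow> real" and \<delta> where k: "0 < \<delta>" "feasible (\<lambda>e. f e + k e)"
    "\<And>x. excess k x = (if x = w then \<delta> else 0) - (if x = v then \<delta> else 0)"
    unfolding residual_def
  proof (safe, goal_cases)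
    case (1 e)
    show ?thesis
      by (rule 1(1)[of "c e - f e" "\<lambda>x. if x = e then c e - f e else 0"])
        (use 1 f excess_single[of e "c e - f e"] in \<open>auto simp: feasible_def\<close>)
  next
    case (2 e)
    show ?thesis
      by (rule 2(1)[of "f e" "\<lambda>x. if x = e then - f e else 0"])
        (use 2 f excess_single[of e "- f e"] in \<open>auto simp: feasible_def\<close>)
  qed
  show ?case
  proof (cases "v = u")
    case True
    then show ?thesis using k by blast
  next
    case False
    then obtain h \<epsilon> where h: "0 < \<epsilon>" "feasible (\<lambda>e. f e + h e)"
      "\<And>x. excess h x = (if x = v then \<epsilon> else 0) - (if x = u then \<epsilon> else 0)"
      using step.IH by blast
    \<comment> \<open>The factors \<open>\<mu> / \<epsilon>\<close> and
      \<open>\<mu> / \<delta>\<close> scale both pushes to the same amount \<mu>, so that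
      \<open>v\<close> is balanced again. Each is at most 1/2, which leaves a nonnegative
      coefficient for \<open>f\<close> in the convex combination.\<close>
    define \<mu> where "\<mu> = min \<epsilon> \<delta> / 2"
    define a where "a = \<mu> / \<epsilon>"
    define b where "b = \<mu> / \<delta>"
    have ab: "0 < \<mu>" "0 \<le> a" "a \<le> 1/2" "0 \<le> b" "b \<le> 1/2" "a * \<epsilon> = \<mu>" "b * \<delta> = \<mu>"
      using h(1) k(1) by (auto simp: \<mu>_def a_def b_def field_simps)
    let ?g = "\<lambda>e. a * h e + b * k e"
    have "excess ?g x = (if x = w then \<mu> else 0) - (if x = u then \<mu> else 0)" for x
      unfolding excess_add excess_scale h(3) k(3) using ab by (auto simp: algebra_simps)
    moreover have "feasible (\<lambda>e. f e + ?g e)"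
      unfolding feasible_def
    proof
      fix e assume e: "e \<in> arcs G"
      have eq: "f e + ?g e = a * (f e + h e) + b * (f e + k e) + (1 - a - b) * f e"
        by (simp add: algebra_simps)
      have x: "0 \<le> f e" "f e \<le> c e" "0 \<le> f e + h e" "f e + h e \<le> c e" "0 \<le> f e + k e" "f e + k e \<le> c e"
        using e f h(2) k(2) by (auto simp: feasible_def)
      have "0 \<le> f e + ?g e" unfolding eq using x ab by simp
      moreover have "f e + ?g e \<le> a * c e + b * c e + (1 - a - b) * c e"
        unfolding eq using x ab by (intro add_mono mult_left_mono) auto
      ultimately show "0 \<le> f e + ?g e \<and> f e + ?g e \<le> c e" by (simp add: algebra_simps)
    qed
    ultimately show ?thesis using ab(1) by (intro exI[of _ ?g] exI[of _ \<mu>]) simp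
  qed
qed

lemma max_flow_no_residual_path:
  assumes "max_st_flow G c s t f"
  shows "(s, t) \<notin> (residual G c f)\<^sup>*"
proof
  assume "(s, t) \<in> (residual G c f)\<^sup>*"
  moreover have f: "st_flow G c s t f" using assms by (simp add: max_st_flow_def)
  ultimately obtain h \<epsilon> where h: "0 < \<epsilon>" "feasible (\<lambda>e. f e + h e)"
      "\<And>x. excess h x = (if x = t then \<epsilon> else 0) - (if x = s then \<epsilon> else 0)"
    using push_to_residual_reachable[of f s t] by (auto simp: feasible_def st_flow_def)
  have "st_flow G c s t (\<lambda>e. f e + h e)"
    using f h by (auto simp: st_flow_iff_excess feasible_def excess_add)
  moreover have "flow_value G s (\<lambda>e. f e + h e) = flow_value G s f + \<epsilon>"
    by (simp add: flow_value_eq_excess excess_add h)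
  ultimately show False using assms h(1) by (force simp: max_st_flow_def)
qed

text \<open>Closedness forces leaving arcs to be saturated and entering arcs to be empty, so the
  residual capacity of the cut vanishes. The lemma serves both the input graph and the networks with
  added terminals.\<close>

lemma residual_closed_cut_value:
  assumes f: "st_flow G c s t f" and C: "st_cut G s t C" and closed: "residual G c f `` C \<subseteq> C"
  shows "cut_capacity G c C = flow_value G s f"
proof -
  have "f e = c e" if "e \<in> leaving G C" for e
  proof -
    have "\<not> f e < c e" using that closed unfolding leaving_def residual_def by blast
    then show ?thesis using f that by (force simp: st_flow_def leaving_def)
  qed
  moreover have "f e = 0" if "e \<in> entering G C" for e
  proof -
    have "\<not> 0 < f e" using that closed unfolding entering_def residual_def by blast
    then show ?thesis using f that by (force simp: st_flow_def entering_def)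
  qed
  ultimately show ?thesis using cut_capacity_diff[OF f C] by simp
qed

lemma reachable_cut:
  assumes "max_st_flow G c s t f"
  shows "st_cut G s t ((residual G c f)\<^sup>* `` {s})"
proof -
  have "v \<in> verts G" if "(s, v) \<in> (residual G c f)\<^sup>*" for v
    using that by induction (auto simp: residual_def)
  then show ?thesis using max_flow_no_residual_path[OF assms] by (auto simp: st_cut_def)
qed

lemma finite_cuts: "finite {C. st_cut G s t C}"
  by (rule finite_subset[of _ "Pow (verts G)"]) (auto simp: st_cut_def)

lemma cut_exists: "{C. st_cut G s t C} \<noteq> {}"
  by (auto simp: st_cut_def intro!: exI[of _ "{s}"])

text \<open>Weak duality bounds all cuts from below; the set reachable from \<open>s\<close> in the
  residual graph is closed and attains the bound.\<close>

lemma max_flow_min_cut: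
  assumes "max_st_flow G c s t f"
  shows "mincut_capacity G c s t = flow_value G s f"
  unfolding mincut_capacity_def
proof (rule Min_eqI)
  have f: "st_flow G c s t f" using assms by (simp add: max_st_flow_def)
  show "finite (cut_capacity G c ` {C. st_cut G s t C})" using finite_cuts by simp
  show "flow_value G s f \<le> x" if "x \<in> cut_capacity G c ` {C. st_cut G s t C}" for x
    using that flow_value_le_cut[OF f] by auto
  have "cut_capacity G c ((residual G c f)\<^sup>* `` {s}) = flow_value G s f"
    by (rule residual_closed_cut_value[OF f reachable_cut[OF assms]]) (auto intro: rtrancl_into_rtrancl)
  then show "flow_value G s f \<in> cut_capacity G c ` {C. st_cut G s t C}"
    using reachable_cut[OF assms] by force
qed


section \<open>Vitality and cuts through an arc\<close>

lemma cut_capacity_del_arc: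
  assumes "e \<in> arcs G"
  shows "cut_capacity (pre_digraph.del_arc G e) c C =
    cut_capacity G c C - (if e \<in> leaving G C then c e else 0)"
proof -
  have "{x \<in> arcs (pre_digraph.del_arc G e). tail (pre_digraph.del_arc G e) x \<in> C \<and>
      head (pre_digraph.del_arc G e) x \<notin> C} = leaving G C - {e}"
    by (auto simp: leaving_def pre_digraph.del_arc_def)
  then have "cut_capacity (pre_digraph.del_arc G e) c C = sum c (leaving G C - {e})"
    by (simp add: cut_capacity_def)
  also have "\<dots> = sum c (leaving G C) - (if e \<in> leaving G C then c e else 0)"
    by (simp add: sum_diff1)
  finally show ?thesis by (simp add: cut_capacity_leaving)
qed

lemma st_cut_del_arc [simp]: "st_cut (pre_digraph.del_arc G e) = st_cut G"
  by (intro ext) (simp add: st_cut_def pre_digraph.del_arc_def)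

lemma vitality_nonneg:
  assumes e: "e \<in> arcs G"
  shows "0 \<le> vitality G c s t e"
proof -
  obtain C where C: "st_cut G s t C" "cut_capacity G c C = mincut_capacity G c s t"
    using mincut_attained[OF finite_cuts cut_exists] .
  have "mincut_capacity (pre_digraph.del_arc G e) c s t \<le> cut_capacity (pre_digraph.del_arc G e) c C"
    using finite_cuts C by (intro mincut_le) auto
  also have "\<dots> \<le> mincut_capacity G c s t"
    using C(2) cap_pos[OF e] by (simp add: cut_capacity_del_arc[OF e])
  finally show ?thesis by (simp add: vitality_def)
qed

text \<open>Removing \<open>e\<close> lowers the capacity of \<open>C\<close> by exactly
  \<open>c e\<close>, and \<open>C\<close> remains a cut. This is what makes every update of the
  table of vitalities admissible.\<close>

lemma vitality_ge:
  assumes "st_cut G s t C" "e \<in> leaving G C"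
  shows "mincut_capacity G c s t + c e - cut_capacity G c C \<le> vitality G c s t e"
proof -
  have e: "e \<in> arcs G" using assms by (simp add: leaving_def)
  have "mincut_capacity (pre_digraph.del_arc G e) c s t \<le> cut_capacity (pre_digraph.del_arc G e) c C"
    using finite_cuts assms by (intro mincut_le) auto
  then show ?thesis using assms by (simp add: cut_capacity_del_arc[OF e] vitality_def)
qed

text \<open>A minimum cut of the graph without \<open>e\<close> must be left by \<open>e\<close>:
  otherwise it would have the same capacity in \<open>G\<close> and \<open>e\<close> would not be
  vital.\<close>

lemma vital_cut:
  assumes e: "e \<in> arcs G" and vital: "0 < vitality G c s t e"
  obtains C where "st_cut G s t C" "e \<in> leaving G C"
    "vitality G c s t e = mincut_capacity G c s t + c e - cut_capacity G c C"
proof -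
  let ?H = "pre_digraph.del_arc G e"
  obtain C where C: "st_cut G s t C" "cut_capacity ?H c C = mincut_capacity ?H c s t"
    using mincut_attained[of ?H s t c] finite_cuts cut_exists by auto
  have "e \<in> leaving G C"
  proof (rule ccontr)
    assume "e \<notin> leaving G C"
    then have "mincut_capacity ?H c s t = cut_capacity G c C"
      using C cut_capacity_del_arc[OF e] by simp
    then show False using mincut_le[OF finite_cuts C(1), of c] vital by (simp add: vitality_def)
  qed
  moreover from this have "vitality G c s t e = mincut_capacity G c s t + c e - cut_capacity G c C"
    using C cut_capacity_del_arc[OF e] by (simp add: vitality_def)
  ultimately show ?thesis using that C(1) by blast
qed

text \<open>The residual capacity of the cut is a sum of nonnegative terms, among them those of
  \<open>e\<close> and \<open>g\<close>. The term of \<open>g\<close> is its slack or its flow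
  depending on direction, hence at least the minimum of the two.\<close>

lemma crossing_arc_residual:
  assumes f: "st_flow G c s t f" and C: "st_cut G s t C"
    and e: "e \<in> leaving G C \<union> entering G C" and g: "g \<in> leaving G C \<union> entering G C" and "e \<noteq> g"
  shows "(if e \<in> leaving G C then c e - f e else f e) + min (f g) (c g - f g)
    \<le> cut_capacity G c C - flow_value G s f"
proof -
  define r where "r x = (if x \<in> leaving G C then c x - f x else f x)" for x
  have disj: "leaving G C \<inter> entering G C = {}" by (auto simp: leaving_def entering_def)
  have sub: "leaving G C \<subseteq> arcs G" "entering G C \<subseteq> arcs G" by (auto simp: leaving_def entering_def)
  have r0: "0 \<le> r x" if "x \<in> arcs G" for x using f that by (auto simp: r_def st_flow_def)
  have "(\<Sum>x\<in>leaving G C. c x - f x) = sum r (leaving G C)" by (simp add: r_def)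
  moreover have "sum f (entering G C) = sum r (entering G C)"
    using disj by (intro sum.cong) (auto simp: r_def)
  ultimately have "cut_capacity G c C - flow_value G s f = sum r (leaving G C \<union> entering G C)"
    by (simp add: cut_capacity_diff[OF f C] sum.union_disjoint disj)
  moreover have "sum r {e, g} \<le> sum r (leaving G C \<union> entering G C)"
    using e g sub r0 by (intro sum_mono2) auto
  moreover have "min (f g) (c g - f g) \<le> r g" by (auto simp: r_def)
  ultimately show ?thesis using \<open>e \<noteq> g\<close> by (simp add: r_def)
qed

text \<open>The cut \<open>C\<close> left by \<open>e\<close> bounds the weights of all other
  crossing arcs by \<open>f e\<close>, the cut \<open>D\<close> entered by \<open>e\<close> bounds
  them by \<open>c e - f e\<close>. The smaller of these two numbers is the weight of
  \<open>e\<close> itself, and it decides which of the cuts is the witness.\<close>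

lemma loose_vital_arc_bottleneck:
  assumes max: "max_st_flow G c s t f" and e: "e \<in> arcs G" and vital: "0 < vitality G c s t e"
    and D: "st_cut G s t D" "e \<in> entering G D" "cut_capacity G c D < mincut_capacity G c s t + c e"
  obtains X where "(tail G e \<in> X) \<noteq> (head G e \<in> X)"
    "\<And>g. g \<in> arcs G \<Longrightarrow> (tail G g \<in> X) \<noteq> (head G g \<in> X) \<Longrightarrow> g \<noteq> e \<Longrightarrow>
       min (f g) (c g - f g) < min (f e) (c e - f e)"
proof -
  have f: "st_flow G c s t f" using max by (simp add: max_st_flow_def)
  note mc = max_flow_min_cut[OF max]
  obtain C where C: "st_cut G s t C" "e \<in> leaving G C"
    "vitality G c s t e = mincut_capacity G c s t + c e - cut_capacity G c C"
    using vital_cut[OF e vital] .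
  have 1: "min (f g) (c g - f g) < f e" if "g \<in> leaving G C \<union> entering G C" "g \<noteq> e" for g
    using crossing_arc_residual[OF f C(1), of e g] that C vital mc by auto
  have 2: "min (f g) (c g - f g) < c e - f e" if "g \<in> leaving G D \<union> entering G D" "g \<noteq> e" for g
    using crossing_arc_residual[OF f D(1), of e g] that D mc
    by (auto simp: leaving_def entering_def)
  show ?thesis
  proof (cases "f e \<le> c e - f e")
    case True
    show ?thesis
    proof (rule that)
      show "(tail G e \<in> C) \<noteq> (head G e \<in> C)" using C by (auto simp: leaving_def)
      show "min (f g) (c g - f g) < min (f e) (c e - f e)"
        if "g \<in> arcs G" "(tail G g \<in> C) \<noteq> (head G g \<in> C)" "g \<noteq> e" for g
        using 1[of g] that True by (auto simp: leaving_def entering_def)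
    qed
  next
    case False
    show ?thesis
    proof (rule that)
      show "(tail G e \<in> D) \<noteq> (head G e \<in> D)" using D by (auto simp: entering_def)
      show "min (f g) (c g - f g) < min (f e) (c e - f e)"
        if "g \<in> arcs G" "(tail G g \<in> D) \<noteq> (head G g \<in> D)" "g \<noteq> e" for g
        using 2[of g] that False by (auto simp: leaving_def entering_def)
    qed
  qed
qed

end

section \<open>Reasoning about programs\<close>

abbreviation N0 :: "vname \<Rightarrow> nexp" where "N0 x \<equiv> NCell x (NConst 0) (NConst 0)"
abbreviation N1 :: "vname \<Rightarrow> nexp \<Rightarrow> nexp" where "N1 x a \<equiv> NCell x a (NConst 0)"
abbreviation R0 :: "vname \<Rightarrow> rexp" where "R0 x \<equiv> RCell x (NConst 0) (NConst 0)"
abbreviation R1 :: "vname \<Rightarrow> nexp \<Rightarrow> rexp" where "R1 x a \<equiv> RCell x a (NConst 0)"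
abbreviation NSet :: "vname \<Rightarrow> nexp \<Rightarrow> com" where "NSet x \<equiv> NAssign x (NConst 0) (NConst 0)"
abbreviation NSet1 :: "vname \<Rightarrow> nexp \<Rightarrow> nexp \<Rightarrow> com" where "NSet1 x a \<equiv> NAssign x a (NConst 0)"
abbreviation RSet :: "vname \<Rightarrow> rexp \<Rightarrow> com" where "RSet x \<equiv> RAssign x (NConst 0) (NConst 0)"
abbreviation RSet1 :: "vname \<Rightarrow> nexp \<Rightarrow> rexp \<Rightarrow> com" where "RSet1 x a \<equiv> RAssign x a (NConst 0)"
abbreviation semi :: "com \<Rightarrow> com \<Rightarrow> com" (infixr ";;" 60) where "P ;; P' \<equiv> Seq P P'"
abbreviation If_then :: "bexp \<Rightarrow> com \<Rightarrow> com" where "If_then b P \<equiv> Cond b P Skip"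

abbreviation nat0 :: "memory \<Rightarrow> vname \<Rightarrow> nat" where "nat0 \<sigma> x \<equiv> nats \<sigma> x 0 0"
abbreviation nat1 :: "memory \<Rightarrow> vname \<Rightarrow> nat \<Rightarrow> nat" where "nat1 \<sigma> x i \<equiv> nats \<sigma> x i 0"
abbreviation real0 :: "memory \<Rightarrow> vname \<Rightarrow> real" where "real0 \<sigma> x \<equiv> reals \<sigma> x 0 0"
abbreviation real1 :: "memory \<Rightarrow> vname \<Rightarrow> nat \<Rightarrow> real" where "real1 \<sigma> x i \<equiv> reals \<sigma> x i 0"

definition NEq :: "nexp \<Rightarrow> nexp \<Rightarrow> bexp" where
  "NEq a b = BAnd (BNot (NLess a b)) (BNot (NLess b a))"

definition BOr :: "bexp \<Rightarrow> bexp \<Rightarrow> bexp" where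
  "BOr a b = BNot (BAnd (BNot a) (BNot b))"

lemma bval_NEq [simp]: "bval (NEq a b) \<sigma> \<longleftrightarrow> nval a \<sigma> = nval b \<sigma>"
  by (auto simp: NEq_def)

lemma bval_BOr [simp]: "bval (BOr a b) \<sigma> \<longleftrightarrow> bval a \<sigma> \<or> bval b \<sigma>"
  by (simp add: BOr_def)

lemma nats_nwrite [simp]:
  "y \<noteq> x \<Longrightarrow> nats (nwrite x i j k \<sigma>) y = nats \<sigma> y"
  "nats (nwrite x i j k \<sigma>) x a b = (if a = i \<and> b = j then k else nats \<sigma> x a b)"
  and reals_nwrite [simp]: "reals (nwrite x i j k \<sigma>) = reals \<sigma>"
  by (simp_all add: nwrite_def)

lemma reals_rwrite [simp]:
  "y \<noteq> x \<Longrightarrow> reals (rwrite x i j r \<sigma>) y = reals \<sigma> y"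
  "reals (rwrite x i j r \<sigma>) x a b = (if a = i \<and> b = j then r else reals \<sigma> x a b)"
  and nats_rwrite [simp]: "nats (rwrite x i j r \<sigma>) = nats \<sigma>"
  by (simp_all add: rwrite_def)

section \<open>Frame conditions and loop-free code\<close>

fun nat_writes :: "com \<Rightarrow> vname set" where
  "nat_writes (NAssign x a b e) = {x}"
| "nat_writes (Seq P P') = nat_writes P \<union> nat_writes P'"
| "nat_writes (Cond b P P') = nat_writes P \<union> nat_writes P'"
| "nat_writes (While b P) = nat_writes P"
| "nat_writes _ = {}"

fun real_writes :: "com \<Rightarrow> vname set" where
  "real_writes (RAssign x a b e) = {x}"
| "real_writes (Seq P P') = real_writes P \<union> real_writes P'"
| "real_writes (Cond b P P') = real_writes P \<union> real_writes P'"
| "real_writes (While b P) = real_writes P"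
| "real_writes (MaxFlow a b ta he cp s t x) = {x}"
| "real_writes _ = {}"

lemma exec_frame:
  assumes "exec mf P \<sigma> \<sigma>' T Q"
  shows "x \<notin> nat_writes P \<Longrightarrow> nats \<sigma>' x = nats \<sigma> x"
    and "y \<notin> real_writes P \<Longrightarrow> reals \<sigma>' y = reals \<sigma> y"
  using assms by (induction rule: exec.induct) auto

fun straight_line :: "com \<Rightarrow> bool" where
  "straight_line (Seq P P') \<longleftrightarrow> straight_line P \<and> straight_line P'"
| "straight_line (Cond b P P') \<longleftrightarrow> straight_line P \<and> straight_line P'"
| "straight_line (While b P) \<longleftrightarrow> False"
| "straight_line (MaxFlow a b ta he cp s t x) \<longleftrightarrow> False"
| "straight_line _ \<longleftrightarrow> True"

text \<open>Execution of loop-free code as a function, so that the simplifier can compute it. The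
  catch-all clause is a mere default for loops and flow calls, which \<open>straight_line\<close>
  rules out.\<close>

fun effect :: "com \<Rightarrow> memory \<Rightarrow> memory" where
  "effect (NAssign x a b e) \<sigma> = nwrite x (nval a \<sigma>) (nval b \<sigma>) (nval e \<sigma>) \<sigma>"
| "effect (RAssign x a b r) \<sigma> = rwrite x (nval a \<sigma>) (nval b \<sigma>) (rval r \<sigma>) \<sigma>"
| "effect (Seq P P') \<sigma> = effect P' (effect P \<sigma>)"
| "effect (Cond b P P') \<sigma> = (if bval b \<sigma> then effect P \<sigma> else effect P' \<sigma>)"
| "effect _ \<sigma> = \<sigma>"

fun cost :: "com \<Rightarrow> nat" where
  "cost (Seq P P') = cost P + cost P'"
| "cost (Cond b P P') = max (cost P) (cost P') + 1"
| "cost _ = 1"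

text \<open>The bound is a memory cell that is read again in every round, so the loop rules require
  that the body leaves it alone.\<close>

definition For :: "vname \<Rightarrow> vname \<Rightarrow> com \<Rightarrow> com" where
  "For i b P = NSet i (NConst 0) ;; While (NLess (N0 i) (N0 b)) (P ;; NSet i (NInc (N0 i)))"

lemma writes_For [simp]:
  "nat_writes (For i b P) = insert i (nat_writes P)"
  "real_writes (For i b P) = real_writes P"
  by (auto simp: For_def)

text \<open>Only the syntactic sets of written arrays enter, which makes the relation transitive.
  Loop rules can thus hand it to every iteration, and invariants need not mention arrays that the
  loop only reads.\<close>

definition frame :: "com \<Rightarrow> memory \<Rightarrow> memory \<Rightarrow> bool" where
  "frame P \<sigma> \<sigma>' \<longleftrightarrow> (\<forall>x. x \<notin> nat_writes P \<longrightarrow> nats \<sigma>' x = nats \<sigma> x) \<and>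
     (\<forall>x. x \<notin> real_writes P \<longrightarrow> reals \<sigma>' x = reals \<sigma> x)"

lemma frame_trans: "frame P \<sigma> \<sigma>' \<Longrightarrow> frame P \<sigma>' \<sigma>'' \<Longrightarrow> frame P \<sigma> \<sigma>''"
  by (simp add: frame_def)

lemma frame_refl [simp]: "frame P \<sigma> \<sigma>"
  by (simp add: frame_def)

section \<open>Executions with bounds on steps and flow computations\<close>

locale flow_machine =
  fixes mf :: flow_oracle and n m :: nat
begin

text \<open>Here \<open>\<tau>\<close> bounds the steps and \<open>l\<close> the flow computations; the factor 7 leaves room for the
  auxiliary vertices and arcs of the networks built by the program.\<close>

definition runs :: "com \<Rightarrow> memory \<Rightarrow> nat \<Rightarrow> nat \<Rightarrow> memory \<Rightarrow> bool" where
  "runs P \<sigma> \<tau> l \<sigma>' \<longleftrightarrow> (\<exists>T Q. exec mf P \<sigma> \<sigma>' T Q \<and> T \<le> \<tau> \<and> length Q \<le> l \<and>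
     (\<forall>(p, q)\<in>set Q. p \<le> 7 * n \<and> q \<le> 7 * m))"

lemma runs_frame:
  assumes "runs P \<sigma> \<tau> l \<sigma>'"
  shows "frame P \<sigma> \<sigma>'"
  using assms exec_frame unfolding runs_def frame_def by metis

lemma runs_mono: "runs P \<sigma> \<tau> l \<sigma>' \<Longrightarrow> \<tau> \<le> \<tau>' \<Longrightarrow> l \<le> l' \<Longrightarrow> runs P \<sigma> \<tau>' l' \<sigma>'"
  unfolding runs_def by (metis le_trans)

lemma runs_Seq:
  assumes "runs P \<sigma> \<tau> l \<sigma>'" "runs P' \<sigma>' \<tau>' l' \<sigma>''"
  shows "runs (P ;; P') \<sigma> (\<tau> + \<tau>') (l + l') \<sigma>''"
proof -
  obtain T Q T' Q' where "exec mf P \<sigma> \<sigma>' T Q" "T \<le> \<tau>" "length Q \<le> l"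
    "\<forall>(p, q)\<in>set Q. p \<le> 7 * n \<and> q \<le> 7 * m"
    and "exec mf P' \<sigma>' \<sigma>'' T' Q'" "T' \<le> \<tau>'" "length Q' \<le> l'"
    "\<forall>(p, q)\<in>set Q'. p \<le> 7 * n \<and> q \<le> 7 * m"
    using assms unfolding runs_def by blast
  then show ?thesis unfolding runs_def
    by (intro exI[of _ "T + T'"] exI[of _ "Q @ Q'"]) (auto intro: exec.Seq)
qed

lemma runs_effect:
  assumes "straight_line P"
  shows "runs P \<sigma> (cost P) 0 (effect P \<sigma>)"
proof -
  have "\<exists>T. exec mf P \<sigma> (effect P \<sigma>) T [] \<and> T \<le> cost P"
    using assms
  proof (induction P arbitrary: \<sigma>)
    case (Seq P P')
    then obtain T T' where "exec mf P \<sigma> (effect P \<sigma>) T []" "T \<le> cost P"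
      "exec mf P' (effect P \<sigma>) (effect P' (effect P \<sigma>)) T' []" "T' \<le> cost P'"
      by (metis straight_line.simps(1))
    then show ?case using exec.Seq[of mf P \<sigma> "effect P \<sigma>" T "[]" P' _ T' "[]"]
      by (intro exI[of _ "T + T'"]) auto
  next
    case (Cond b P P')
    then show ?case
      by (cases "bval b \<sigma>") (fastforce intro: exec.CondTrue exec.CondFalse)+
  qed (auto intro: exec.intros)
  then show ?thesis unfolding runs_def by force
qed

lemma runs_Skip: "runs Skip \<sigma> 1 0 \<sigma>"
  using runs_effect[of Skip \<sigma>] by simp

lemma runs_Cond:
  assumes "bval b \<sigma> \<Longrightarrow> runs P \<sigma> \<tau> l \<sigma>'" "\<not> bval b \<sigma> \<Longrightarrow> runs P' \<sigma> \<tau> l \<sigma>'"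
  shows "runs (Cond b P P') \<sigma> (\<tau> + 1) l \<sigma>'"
proof (cases "bval b \<sigma>")
  case True
  then obtain T Q where "exec mf P \<sigma> \<sigma>' T Q" "T \<le> \<tau>" "length Q \<le> l"
    "\<forall>(p, q)\<in>set Q. p \<le> 7 * n \<and> q \<le> 7 * m"
    using assms unfolding runs_def by blast
  then show ?thesis unfolding runs_def using True exec.CondTrue[of b \<sigma> mf P \<sigma>' T Q P']
    by (intro exI[of _ "T + 1"] exI[of _ Q]) auto
next
  case False
  then obtain T Q where "exec mf P' \<sigma> \<sigma>' T Q" "T \<le> \<tau>" "length Q \<le> l"
    "\<forall>(p, q)\<in>set Q. p \<le> 7 * n \<and> q \<le> 7 * m"
    using assms unfolding runs_def by blast
  then show ?thesis unfolding runs_def using False exec.CondFalse[of b \<sigma> mf P' \<sigma>' T Q P]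
    by (intro exI[of _ "T + 1"] exI[of _ Q]) auto
qed

lemma runs_WhileFalse: "\<not> bval b \<sigma> \<Longrightarrow> runs (While b P) \<sigma> 1 0 \<sigma>"
  unfolding runs_def using exec.WhileFalse[of b \<sigma> mf P] by fastforce

lemma runs_WhileTrue:
  assumes "bval b \<sigma>" "runs P \<sigma> \<tau> l \<sigma>'" "runs (While b P) \<sigma>' \<tau>' l' \<sigma>''"
  shows "runs (While b P) \<sigma> (\<tau> + \<tau>' + 1) (l + l') \<sigma>''"
proof -
  obtain T Q T' Q' where "exec mf P \<sigma> \<sigma>' T Q" "T \<le> \<tau>" "length Q \<le> l"
    "\<forall>(p, q)\<in>set Q. p \<le> 7 * n \<and> q \<le> 7 * m"
    and "exec mf (While b P) \<sigma>' \<sigma>'' T' Q'" "T' \<le> \<tau>'" "length Q' \<le> l'"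
    "\<forall>(p, q)\<in>set Q'. p \<le> 7 * n \<and> q \<le> 7 * m"
    using assms(2,3) unfolding runs_def by blast
  then show ?thesis unfolding runs_def
    using assms(1) exec.WhileTrue[of b \<sigma> mf P \<sigma>' T Q \<sigma>'' T' Q']
    by (intro exI[of _ "T + T' + 1"] exI[of _ "Q @ Q'"]) auto
qed

text \<open>The step condition is required only in memories that agree with the initial one outside
  the arrays written by the body. Each of the at most \<open>\<mu> \<sigma>\<close> rounds costs the
  body and one test; the last summand is the failing test.\<close>

lemma runs_While_measure:
  fixes \<mu> :: "memory \<Rightarrow> nat"
  assumes "straight_line P" and "Inv \<sigma>"
    and step: "\<And>\<sigma>'. Inv \<sigma>' \<Longrightarrow> bval b \<sigma>' \<Longrightarrow> frame P \<sigma> \<sigma>' \<Longrightarrow>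
      Inv (effect P \<sigma>') \<and> \<mu> (effect P \<sigma>') < \<mu> \<sigma>'"
  shows "\<exists>\<sigma>'. runs (While b P) \<sigma> (\<mu> \<sigma> * (cost P + 1) + 1) 0 \<sigma>' \<and> Inv \<sigma>' \<and> \<not> bval b \<sigma>'"
proof -
  have "\<exists>\<sigma>'. runs (While b P) \<rho> (\<mu> \<rho> * (cost P + 1) + 1) 0 \<sigma>' \<and> Inv \<sigma>' \<and> \<not> bval b \<sigma>'"
    if "Inv \<rho>" "frame P \<sigma> \<rho>" for \<rho>
    using that
  proof (induction "\<mu> \<rho>" arbitrary: \<rho> rule: less_induct)
    case less
    show ?case
    proof (cases "bval b \<rho>")
      case True
      let ?\<rho> = "effect P \<rho>"
      have s: "Inv ?\<rho>" "\<mu> ?\<rho> < \<mu> \<rho>" using step less True by auto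
      have r: "runs P \<rho> (cost P) 0 ?\<rho>" by (rule runs_effect[OF assms(1)])
      have "frame P \<sigma> ?\<rho>" using less(3) runs_frame[OF r] frame_trans by blast
      then obtain \<sigma>' where \<sigma>': "runs (While b P) ?\<rho> (\<mu> ?\<rho> * (cost P + 1) + 1) 0 \<sigma>'" "Inv \<sigma>'"
        "\<not> bval b \<sigma>'"
        using less.hyps[OF s(2,1)] by blast
      have "(\<mu> ?\<rho> + 1) * (cost P + 1) \<le> \<mu> \<rho> * (cost P + 1)"
        using s(2) by (intro mult_right_mono) auto
      then have "runs (While b P) \<rho> (\<mu> \<rho> * (cost P + 1) + 1) 0 \<sigma>'"
        using runs_mono[OF runs_WhileTrue[OF True r \<sigma>'(1)]] by simp
      then show ?thesis using \<sigma>' by blast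
    next
      case False
      then show ?thesis using less(2) runs_mono[OF runs_WhileFalse[OF False, of P]] by force
    qed
  qed
  then show ?thesis using assms(2) by simp
qed

text \<open>The invariant is stated for the memory in which the counter already has its new value.
  Per round the body is charged with one increment and one test; the final 2 pays for the initial
  assignment and the failing test.\<close>

lemma runs_For:
  assumes "nat0 \<sigma> b = N" and "b \<noteq> i" "b \<notin> nat_writes P" "i \<notin> nat_writes P"
    and "Inv 0 (nwrite i 0 0 0 \<sigma>)"
    and step: "\<And>k \<sigma>'. k < N \<Longrightarrow> Inv k \<sigma>' \<Longrightarrow> nat0 \<sigma>' i = k \<Longrightarrow> frame (For i b P) \<sigma> \<sigma>' \<Longrightarrow>
      \<exists>\<sigma>''. runs P \<sigma>' \<tau> l \<sigma>'' \<and> Inv (Suc k) (nwrite i 0 0 (Suc k) \<sigma>'')"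
  shows "\<exists>\<sigma>'. runs (For i b P) \<sigma> (N * (\<tau> + 2) + 2) (N * l) \<sigma>' \<and> Inv N \<sigma>'"
proof -
  let ?W = "While (NLess (N0 i) (N0 b)) (P ;; NSet i (NInc (N0 i)))"
  have W: "\<exists>\<sigma>'. runs ?W \<rho> (j * (\<tau> + 2) + 1) (j * l) \<sigma>' \<and> Inv N \<sigma>'"
    if "j + k = N" "Inv k \<rho>" "nat0 \<rho> i = k" "frame (For i b P) \<sigma> \<rho>" for j k \<rho>
    using that
  proof (induction j arbitrary: k \<rho>)
    case 0
    have "nat0 \<rho> b = N" using 0 assms(1-3) by (simp add: frame_def)
    then have "runs ?W \<rho> 1 0 \<rho>" using 0 by (intro runs_WhileFalse) simp
    then show ?case using 0 by auto
  next
    case (Suc j)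
    have b: "nat0 \<rho> b = N" using Suc assms(1-3) by (simp add: frame_def)
    obtain \<rho>' where \<rho>': "runs P \<rho> \<tau> l \<rho>'" "Inv (Suc k) (nwrite i 0 0 (Suc k) \<rho>')"
      using step[of k \<rho>] Suc.prems by auto
    let ?\<rho> = "nwrite i 0 0 (Suc k) \<rho>'"
    have fr: "frame (For i b P) \<rho> ?\<rho>" using runs_frame[OF \<rho>'(1)] by (auto simp: frame_def)
    have "nat0 \<rho>' i = k" using runs_frame[OF \<rho>'(1)] assms(4) Suc.prems by (simp add: frame_def)
    then have "runs (NSet i (NInc (N0 i))) \<rho>' 1 0 ?\<rho>"
      using runs_effect[of "NSet i (NInc (N0 i))" \<rho>'] by simp
    then have body: "runs (P ;; NSet i (NInc (N0 i))) \<rho> (\<tau> + 1) l ?\<rho>"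
      using runs_Seq[OF \<rho>'(1)] by fastforce
    obtain \<sigma>' where \<sigma>': "runs ?W ?\<rho> (j * (\<tau> + 2) + 1) (j * l) \<sigma>'" "Inv N \<sigma>'"
      using Suc.IH[of "Suc k" ?\<rho>] Suc.prems \<rho>' frame_trans[OF Suc.prems(4) fr] by auto
    have "runs ?W \<rho> (Suc j * (\<tau> + 2) + 1) (Suc j * l) \<sigma>'"
      by (rule runs_mono[OF runs_WhileTrue[OF _ body \<sigma>'(1)]]) (use b Suc.prems in auto)
    then show ?case using \<sigma>' by blast
  qed
  let ?\<rho> = "nwrite i 0 0 0 \<sigma>"
  have "frame (For i b P) \<sigma> ?\<rho>" by (simp add: frame_def)
  then obtain \<sigma>' where "runs ?W ?\<rho> (N * (\<tau> + 2) + 1) (N * l) \<sigma>'" "Inv N \<sigma>'"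
    using W[of N 0 ?\<rho>] assms by auto
  moreover have "runs (NSet i (NConst 0)) \<sigma> 1 0 ?\<rho>"
    using runs_effect[of "NSet i (NConst 0)" \<sigma>] by simp
  ultimately have "runs (For i b P) \<sigma> (N * (\<tau> + 2) + 2) (N * l) \<sigma>'"
    unfolding For_def using runs_Seq by fastforce
  then show ?thesis using \<open>Inv N \<sigma>'\<close> by blast
qed

lemma runs_For_straight:
  assumes "nat0 \<sigma> b = N" and "b \<noteq> i" "b \<notin> nat_writes P" "i \<notin> nat_writes P" "straight_line P"
    and "Inv 0 (nwrite i 0 0 0 \<sigma>)"
    and step: "\<And>k \<sigma>'. k < N \<Longrightarrow> Inv k \<sigma>' \<Longrightarrow> nat0 \<sigma>' i = k \<Longrightarrow> frame (For i b P) \<sigma> \<sigma>' \<Longrightarrow>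
      Inv (Suc k) (nwrite i 0 0 (Suc k) (effect P \<sigma>'))"
  shows "\<exists>\<sigma>'. runs (For i b P) \<sigma> (N * (cost P + 2) + 2) 0 \<sigma>' \<and> Inv N \<sigma>'"
proof -
  have "\<exists>\<sigma>'. runs (For i b P) \<sigma> (N * (cost P + 2) + 2) (N * 0) \<sigma>' \<and> Inv N \<sigma>'"
    by (rule runs_For) (use assms runs_effect in blast)+
  then show ?thesis by simp
qed

end

section \<open>Graph search\<close>

text \<open>Pointers are shifted by one: \<open>0\<close> ends a list and \<open>Suc j\<close> stands for arc \<open>j\<close>.\<close>

definition linked :: "nat \<Rightarrow> nat \<Rightarrow> (nat \<Rightarrow> nat) \<Rightarrow> (nat \<Rightarrow> nat) \<Rightarrow> (nat \<Rightarrow> nat) \<Rightarrow> bool" where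
  "linked p q ta first nxt \<longleftrightarrow>
     (\<forall>v<p. first v \<le> q \<and> (0 < first v \<longrightarrow> ta (first v - 1) = v) \<and> (\<forall>j<q. first v \<le> j \<longrightarrow> ta j \<noteq> v)) \<and>
     (\<forall>j<q. nxt j \<le> j \<and> (0 < nxt j \<longrightarrow> ta (nxt j - 1) = ta j) \<and> (\<forall>i<j. nxt j \<le> i \<longrightarrow> ta i \<noteq> ta j))"

text \<open>Lists run through the arcs of a vertex by decreasing index. The new arc has the largest
  index so far, so prepending it preserves the order, and the order makes every list finite.\<close>

lemma linked_add:
  assumes "linked p q ta first nxt" "u < p"
  shows "linked p (Suc q) (ta(q := u)) (first(u := Suc q)) (nxt(q := first u))"
proof -
  note L = assms(1)[unfolded linked_def]
  have 1: "(first(u := Suc q)) v \<le> Suc q \<and>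
      (0 < (first(u := Suc q)) v \<longrightarrow> (ta(q := u)) ((first(u := Suc q)) v - 1) = v) \<and>
      (\<forall>j<Suc q. (first(u := Suc q)) v \<le> j \<longrightarrow> (ta(q := u)) j \<noteq> v)" if "v < p" for v
  proof (cases "v = u")
    case False
    have "first v \<le> q" "0 < first v \<longrightarrow> ta (first v - 1) = v" "\<forall>j<q. first v \<le> j \<longrightarrow> ta j \<noteq> v"
      using L that by blast+
    then show ?thesis using False by (auto simp: less_Suc_eq)
  qed auto
  have 2: "(nxt(q := first u)) j \<le> j \<and>
      (0 < (nxt(q := first u)) j \<longrightarrow> (ta(q := u)) ((nxt(q := first u)) j - 1) = (ta(q := u)) j) \<and>
      (\<forall>i<j. (nxt(q := first u)) j \<le> i \<longrightarrow> (ta(q := u)) i \<noteq> (ta(q := u)) j)" if "j < Suc q" for j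
  proof (cases "j = q")
    case True
    have "first u \<le> q" "0 < first u \<longrightarrow> ta (first u - 1) = u" "\<forall>j<q. first u \<le> j \<longrightarrow> ta j \<noteq> u"
      using L assms(2) by blast+
    then show ?thesis using True by auto
  next
    case False
    then have "nxt j \<le> j" "0 < nxt j \<longrightarrow> ta (nxt j - 1) = ta j" "\<forall>i<j. nxt j \<le> i \<longrightarrow> ta i \<noteq> ta j" "j < q"
      using L that by auto
    then show ?thesis by auto
  qed
  show ?thesis unfolding linked_def using 1 2 by blast
qed

text \<open>Arcs still to be scanned when \<open>qh\<close> vertices have been taken from the queue and the list of the
  last one of them has been processed down to the pointer \<open>pt\<close>.\<close>

definition pending :: "nat \<Rightarrow> (nat \<Rightarrow> nat) \<Rightarrow> (nat \<Rightarrow> nat) \<Rightarrow> nat \<Rightarrow> nat \<Rightarrow> nat set" where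
  "pending q ta que qh pt =
     {j. j < q \<and> (ta j \<notin> que ` {..<qh} \<or> 0 < qh \<and> ta j = que (qh - 1) \<and> j < pt)}"

lemma finite_pending [simp]: "finite (pending q ta que qh pt)"
  by (simp add: pending_def)

lemma card_pending_le: "card (pending q ta que qh pt) \<le> q"
proof -
  have "pending q ta que qh pt \<subseteq> {..<q}" by (auto simp: pending_def)
  then show ?thesis using card_mono[of "{..<q}"] by fastforce
qed

text \<open>The first \<open>qt\<close> entries of the queue are the visited vertices, the first
  \<open>qh\<close> of them have been dequeued. The last clause is closedness of the visited set up
  to the arcs still pending; it becomes true closedness when the queue is exhausted.\<close>

definition search_inv :: "nat \<Rightarrow> nat \<Rightarrow> (nat \<Rightarrow> nat) \<Rightarrow> (nat \<Rightarrow> nat) \<Rightarrow> nat \<Rightarrow>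
    (nat \<Rightarrow> nat) \<Rightarrow> (nat \<Rightarrow> nat) \<Rightarrow> nat \<Rightarrow> nat \<Rightarrow> nat \<Rightarrow> bool" where
  "search_inv p q ta he u vis que qh qt pt \<longleftrightarrow>
     qh \<le> qt \<and> inj_on que {..<qt} \<and> que ` {..<qt} = {v. v < p \<and> vis v \<noteq> 0} \<and> u < p \<and> vis u \<noteq> 0 \<and>
     (\<forall>v<p. vis v \<noteq> 0 \<longrightarrow> (u, v) \<in> {(ta j, he j) | j. j < q}\<^sup>*) \<and>
     pt \<le> q \<and> (0 < pt \<longrightarrow> 0 < qh \<and> ta (pt - 1) = que (qh - 1)) \<and>
     (\<forall>j<q. j \<notin> pending q ta que qh pt \<longrightarrow> vis (he j) \<noteq> 0)"

lemma search_inv_init: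
  assumes "u < p" "\<forall>v<p. vis v \<noteq> 0 \<longleftrightarrow> v = u" "que 0 = u"
  shows "search_inv p q ta he u vis que 0 1 0"
  using assms by (auto simp: search_inv_def pending_def lessThan_Suc)

lemma search_invD:
  assumes "search_inv p q ta he u vis que qh qt pt"
  shows "qh \<le> qt" "inj_on que {..<qt}" "que ` {..<qt} = {v. v < p \<and> vis v \<noteq> 0}" "u < p" "vis u \<noteq> 0"
    "\<And>v. v < p \<Longrightarrow> vis v \<noteq> 0 \<Longrightarrow> (u, v) \<in> {(ta j, he j) | j. j < q}\<^sup>*"
    "pt \<le> q" "0 < pt \<Longrightarrow> 0 < qh" "0 < pt \<Longrightarrow> ta (pt - 1) = que (qh - 1)"
    "\<And>j. j < q \<Longrightarrow> j \<notin> pending q ta que qh pt \<Longrightarrow> vis (he j) \<noteq> 0"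
  using assms unfolding search_inv_def by blast+

text \<open>By the order of the lists, the arcs with the tail of \<open>j\<close> below the pointer
  \<open>nxt j\<close> are exactly those below \<open>j\<close>. So scanning \<open>j\<close>
  removes just \<open>j\<close> from the pending arcs; a vertex appended at position
  \<open>qt\<close> does not disturb the dequeued prefix.\<close>

lemma search_scan:
  assumes inv: "search_inv p q ta he u vis que qh qt (Suc j)"
    and linked: "linked p q ta first nxt" and he: "\<forall>i<q. he i < p"
  shows "search_inv p q ta he u
      (if vis (he j) = 0 then vis(he j := 1) else vis) (if vis (he j) = 0 then que(qt := he j) else que)
      qh (if vis (he j) = 0 then Suc qt else qt) (nxt j)" (is "search_inv p q ta he u ?vis ?que qh ?qt _")
    and "card (pending q ta (if vis (he j) = 0 then que(qt := he j) else que) qh (nxt j))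
      < card (pending q ta que qh (Suc j))"
proof -
  note I = search_invD[OF inv]
  have j: "j < q" "0 < qh" "ta j = que (qh - 1)" using I(7,8,9) by auto
  note L = linked[unfolded linked_def, THEN conjunct2, rule_format, OF j(1)]
  have nxt: "nxt j \<le> j" "0 < nxt j \<Longrightarrow> ta (nxt j - 1) = ta j" "\<And>i. ta i = ta j \<Longrightarrow> i < nxt j \<longleftrightarrow> i < j"
  proof -
    show le: "nxt j \<le> j" using L by blast
    show "0 < nxt j \<Longrightarrow> ta (nxt j - 1) = ta j" using L by blast
    fix i assume i: "ta i = ta j"
    have "\<not> (i < j \<and> nxt j \<le> i)" using L i by blast
    then show "i < nxt j \<longleftrightarrow> i < j" using le by linarith
  qed
  have queq: "?que i = que i" if "i < qt" for i using that by simp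
  have img: "?que ` {..<qh} = que ` {..<qh}" using queq I(1) by (intro image_cong) simp_all
  have last: "?que (qh - 1) = que (qh - 1)" using queq j(2) I(1) by simp
  have mem: "ta j \<in> que ` {..<qh}" using j by simp
  have "i \<in> pending q ta que qh (nxt j) \<longleftrightarrow> i \<in> pending q ta que qh (Suc j) - {j}" for i
  proof (cases "ta i = ta j")
    case True
    then have "ta i \<in> que ` {..<qh}" "ta i = que (qh - 1)" using mem j(3) by simp_all
    moreover have "i < nxt j \<longleftrightarrow> i < Suc j \<and> i \<noteq> j" using nxt(3)[OF True] by linarith
    ultimately show ?thesis using j(2) unfolding pending_def by blast
  next
    case False
    then have "ta i \<noteq> que (qh - 1)" "i \<noteq> j" using j(3) by auto
    then show ?thesis unfolding pending_def by blast
  qed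
  then have pend: "pending q ta ?que qh (nxt j) = pending q ta que qh (Suc j) - {j}"
    unfolding pending_def img last by blast
  have "j \<in> pending q ta que qh (Suc j)" using j by (simp add: pending_def)
  then show "card (pending q ta ?que qh (nxt j)) < card (pending q ta que qh (Suc j))"
    unfolding pend by (intro psubset_card_mono) auto
  have "ta j \<in> que ` {..<qt}" using j I(1) by simp
  then have "(u, ta j) \<in> {(ta j, he j) | j. j < q}\<^sup>*" unfolding I(3) using I(6) by blast
  moreover have "(ta j, he j) \<in> {(ta j, he j) | j. j < q}" using j(1) by blast
  ultimately have reach: "(u, he j) \<in> {(ta j, he j) | j. j < q}\<^sup>*" by (rule rtrancl_into_rtrancl)
  have hej: "he j < p" using he j(1) by blast
  show "search_inv p q ta he u ?vis ?que qh ?qt (nxt j)"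
    unfolding search_inv_def pend last
  proof (intro conjI)
    show "qh \<le> ?qt" using I(1) by simp
    show "inj_on ?que {..<?qt}"
    proof (cases "vis (he j) = 0")
      case True
      then have "he j \<notin> que ` {..<qt}" unfolding I(3) by simp
      moreover have "inj_on (que(qt := he j)) {..<qt}" using I(2) by (simp add: inj_on_def)
      moreover have "(que(qt := he j)) ` {..<qt} = que ` {..<qt}" by (intro image_cong) simp_all
      ultimately show ?thesis using True by (simp add: lessThan_Suc)
    qed (use I(2) in simp)
    show "?que ` {..<?qt} = {v. v < p \<and> ?vis v \<noteq> 0}"
    proof (cases "vis (he j) = 0")
      case True
      have "(que(qt := he j)) ` {..<Suc qt} = insert (he j) (que ` {..<qt})"
        unfolding lessThan_Suc image_insert by (intro arg_cong2[of _ _ _ _ insert] image_cong) simp_all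
      then show ?thesis unfolding I(3) using True hej by (auto split: if_splits)
    qed (use I(3) in simp)
    show "u < p" "?vis u \<noteq> 0" "nxt j \<le> q" using I(4,5) nxt(1) j(1) by simp_all
    show "\<forall>v<p. ?vis v \<noteq> 0 \<longrightarrow> (u, v) \<in> {(ta j, he j) | j. j < q}\<^sup>*"
    proof (intro allI impI)
      fix v assume "v < p" "?vis v \<noteq> 0"
      then have "v = he j \<or> vis v \<noteq> 0" by (simp split: if_splits)
      then show "(u, v) \<in> {(ta j, he j) | j. j < q}\<^sup>*" using I(6) \<open>v < p\<close> reach by blast
    qed
    show "0 < nxt j \<longrightarrow> 0 < qh \<and> ta (nxt j - 1) = que (qh - 1)" using nxt(2) j(2,3) by simp
    show "\<forall>i<q. i \<notin> pending q ta que qh (Suc j) - {j} \<longrightarrow> ?vis (he i) \<noteq> 0" using I(10) by auto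
  qed
qed

text \<open>The arcs of the dequeued vertex were pending because their tail was not in the prefix,
  and are now pending because they lie below the scan pointer. Progress shows in \<open>qh\<close>
  instead, which stays below \<open>p\<close> because the queue has no repetitions.\<close>

lemma search_pop:
  assumes inv: "search_inv p q ta he u vis que qh qt 0" and "qh < qt"
    and linked: "linked p q ta first nxt"
  shows "search_inv p q ta he u vis que (Suc qh) qt (first (que qh))"
    and "pending q ta que (Suc qh) (first (que qh)) = pending q ta que qh 0" and "qh < p"
proof -
  note I = search_invD[OF inv]
  have sub: "que ` {..<qt} \<subseteq> {..<p}" unfolding I(3) by auto
  then have "qt \<le> p" using card_inj_on_le[OF I(2), of "{..<p}"] by simp
  then show "qh < p" using assms(2) by simp
  have v: "que qh < p" using sub assms(2) by auto
  have new: "que qh \<notin> que ` {..<qh}"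
    using inj_on_image_mem_iff[OF I(2), of qh "{..<qh}"] assms(2) by auto
  note L = linked[unfolded linked_def, THEN conjunct1, rule_format, OF v]
  have all: "j < first (que qh)" if "j < q" "ta j = que qh" for j
  proof (rule ccontr)
    assume "\<not> j < first (que qh)"
    then have "first (que qh) \<le> j" by simp
    then show False using L that by blast
  qed
  have "j \<in> pending q ta que (Suc qh) (first (que qh)) \<longleftrightarrow> j \<in> pending q ta que qh 0" for j
  proof (cases "ta j = que qh")
    case True
    then show ?thesis using all[of j] new by (auto simp: pending_def)
  next
    case False
    then show ?thesis by (simp add: pending_def lessThan_Suc)
  qed
  then show pend: "pending q ta que (Suc qh) (first (que qh)) = pending q ta que qh 0" by blast
  show "search_inv p q ta he u vis que (Suc qh) qt (first (que qh))"
    unfolding search_inv_def pend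
  proof (intro conjI)
    show "0 < first (que qh) \<longrightarrow> 0 < Suc qh \<and> ta (first (que qh) - 1) = que (Suc qh - 1)" using L by simp
    show "first (que qh) \<le> q" using L by simp
  qed (use I assms(2) in simp_all)
qed

text \<open>With an empty list and an exhausted queue only arcs with unvisited tail are pending, so
  the visited set is closed under arcs.\<close>

lemma search_done:
  assumes inv: "search_inv p q ta he u vis que qh qt 0" and "\<not> qh < qt"
    and wf: "\<forall>i<q. ta i < p \<and> he i < p"
  shows "{v. v < p \<and> vis v \<noteq> 0} = {(ta j, he j) | j. j < q}\<^sup>* `` {u}"
proof -
  note I = search_invD[OF inv]
  have img: "que ` {..<qh} = {v. v < p \<and> vis v \<noteq> 0}" using I(1,3) assms(2) by simp
  have closed: "vis (he j) \<noteq> 0" if "j < q" "vis (ta j) \<noteq> 0" for j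
    using I(10)[of j] that wf unfolding pending_def img by simp
  have "v < p \<and> vis v \<noteq> 0" if "(u, v) \<in> {(ta j, he j) | j. j < q}\<^sup>*" for v
    using that
  proof induction
    case base
    then show ?case using I(4,5) by simp
  next
    case (step v w)
    then show ?case using closed wf by blast
  qed
  then show ?thesis using I(6) by blast
qed

section \<open>The residual search as a program\<close>

definition link_arc :: "vname \<Rightarrow> vname \<Rightarrow> com" where
  "link_arc a b =
     NSet1 ''rt'' (N0 ''rq'') (N1 a (N0 ''i'')) ;;
     NSet1 ''rh'' (N0 ''rq'') (N1 b (N0 ''i'')) ;;
     NSet1 ''nxt'' (N0 ''rq'') (N1 ''first'' (N1 a (N0 ''i''))) ;;
     NSet ''rq'' (NInc (N0 ''rq'')) ;;
     NSet1 ''first'' (N1 a (N0 ''i'')) (N0 ''rq'')"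

definition clear_vertex :: com where
  "clear_vertex =
     NSet1 ''first'' (N0 ''v'') (NConst 0) ;; NSet1 ''vis'' (N0 ''v'') (NConst 0)"

definition link_residual_arc :: com where
  "link_residual_arc =
     If_then (RLess (R1 ''fl'' (N0 ''i'')) (R1 ''hc'' (N0 ''i''))) (link_arc ''ht'' ''hh'') ;;
     If_then (RLess (RConst 0) (R1 ''fl'' (N0 ''i''))) (link_arc ''hh'' ''ht'')"

definition build_residual :: com where
  "build_residual =
     For ''v'' ''p'' clear_vertex ;;
     NSet ''rq'' (NConst 0) ;;
     For ''i'' ''q'' link_residual_arc"

definition explore_step :: com where
  "explore_step =
     Cond (NLess (NConst 0) (N0 ''pt''))
       (NSet ''w'' (N1 ''rh'' (NDec (N0 ''pt''))) ;;
        NSet ''pt'' (N1 ''nxt'' (NDec (N0 ''pt''))) ;;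
        If_then (NEq (N1 ''vis'' (N0 ''w'')) (NConst 0))
          (NSet1 ''vis'' (N0 ''w'') (NConst 1) ;;
           NSet1 ''que'' (N0 ''qt'') (N0 ''w'') ;;
           NSet ''qt'' (NInc (N0 ''qt''))))
       (NSet ''pt'' (N1 ''first'' (N1 ''que'' (N0 ''qh''))) ;;
        NSet ''qh'' (NInc (N0 ''qh'')))"

definition explore_init :: com where
  "explore_init =
     NSet1 ''vis'' (N0 ''src'') (NConst 1) ;;
     NSet1 ''que'' (NConst 0) (N0 ''src'') ;;
     NSet ''qh'' (NConst 0) ;;
     NSet ''qt'' (NConst 1) ;;
     NSet ''pt'' (NConst 0)"

definition explore :: com where
  "explore = explore_init ;;
     While (BOr (NLess (NConst 0) (N0 ''pt'')) (NLess (N0 ''qh'') (N0 ''qt''))) explore_step"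

definition search :: com where
  "search = build_residual ;; explore"

lemma writes_search [simp]:
  "nat_writes search = {''v'', ''i'', ''w'', ''first'', ''vis'', ''rq'', ''rt'', ''rh'', ''nxt'', ''que'', ''qh'', ''qt'', ''pt''}"
  "real_writes search = {}"
  by (auto simp: search_def build_residual_def clear_vertex_def link_residual_arc_def link_arc_def explore_def explore_init_def explore_step_def)

lemma effect_link_arc:
  fixes a b \<sigma>
  assumes "{a, b} \<inter> {''rt'', ''rh'', ''nxt'', ''rq'', ''first''} = {}"
  defines "\<sigma>' \<equiv> effect (link_arc a b) \<sigma>" and "u \<equiv> nat1 \<sigma> a (nat0 \<sigma> ''i'')"
  shows "nat1 \<sigma>' ''rt'' = (nat1 \<sigma> ''rt'')(nat0 \<sigma> ''rq'' := u)"
    "nat1 \<sigma>' ''rh'' = (nat1 \<sigma> ''rh'')(nat0 \<sigma> ''rq'' := nat1 \<sigma> b (nat0 \<sigma> ''i''))"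
    "nat1 \<sigma>' ''nxt'' = (nat1 \<sigma> ''nxt'')(nat0 \<sigma> ''rq'' := nat1 \<sigma> ''first'' u)"
    "nat1 \<sigma>' ''first'' = (nat1 \<sigma> ''first'')(u := Suc (nat0 \<sigma> ''rq''))"
    "nat0 \<sigma>' ''rq'' = Suc (nat0 \<sigma> ''rq'')"
    "x \<notin> {''rt'', ''rh'', ''nxt'', ''rq'', ''first''} \<Longrightarrow> nats \<sigma>' x = nats \<sigma> x"
    "reals \<sigma>' = reals \<sigma>"
  using assms by (auto simp: link_arc_def fun_eq_iff)

definition stored_arcs :: "memory \<Rightarrow> (nat \<times> nat) set" where
  "stored_arcs \<sigma> = {(nat1 \<sigma> ''rt'' j, nat1 \<sigma> ''rh'' j) | j. j < nat0 \<sigma> ''rq''}"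

definition adjacency :: "nat \<Rightarrow> memory \<Rightarrow> bool" where
  "adjacency p \<sigma> \<longleftrightarrow> linked p (nat0 \<sigma> ''rq'') (nat1 \<sigma> ''rt'') (nat1 \<sigma> ''first'') (nat1 \<sigma> ''nxt'')"

lemma link_arc_adjacency:
  fixes a b \<sigma>
  assumes names: "{a, b} \<inter> {''rt'', ''rh'', ''nxt'', ''rq'', ''first''} = {}"
    and "nat1 \<sigma> a (nat0 \<sigma> ''i'') < p" and "adjacency p \<sigma>"
  shows "adjacency p (effect (link_arc a b) \<sigma>)"
    "stored_arcs (effect (link_arc a b) \<sigma>) =
      insert (nat1 \<sigma> a (nat0 \<sigma> ''i''), nat1 \<sigma> b (nat0 \<sigma> ''i'')) (stored_arcs \<sigma>)"
proof -
  note e = effect_link_arc[OF names]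
  show "adjacency p (effect (link_arc a b) \<sigma>)"
    unfolding adjacency_def e by (rule linked_add) (use assms in \<open>auto simp: adjacency_def\<close>)
  have "(nat1 (effect (link_arc a b) \<sigma>) ''rt'' j, nat1 (effect (link_arc a b) \<sigma>) ''rh'' j) =
      (if j = nat0 \<sigma> ''rq'' then (nat1 \<sigma> a (nat0 \<sigma> ''i''), nat1 \<sigma> b (nat0 \<sigma> ''i''))
       else (nat1 \<sigma> ''rt'' j, nat1 \<sigma> ''rh'' j))" for j
    using fun_cong[OF e(1)[of \<sigma>], of j] fun_cong[OF e(2)[of \<sigma>], of j] by simp
  then show "stored_arcs (effect (link_arc a b) \<sigma>) =
      insert (nat1 \<sigma> a (nat0 \<sigma> ''i''), nat1 \<sigma> b (nat0 \<sigma> ''i'')) (stored_arcs \<sigma>)"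
    unfolding stored_arcs_def e(5) by (auto simp: less_Suc_eq; metis less_irrefl)
qed

section \<open>Correctness and linear running time of the residual search\<close>

context flow_machine
begin

lemma runs_build_residual:
  fixes \<sigma> p q
  defines "R \<equiv> residual (stored_graph p q ''ht'' ''hh'' \<sigma>) (real1 \<sigma> ''hc'') (real1 \<sigma> ''fl'')"
  assumes pq: "nat0 \<sigma> ''p'' = p" "nat0 \<sigma> ''q'' = q"
    and wf: "\<forall>i<q. nat1 \<sigma> ''ht'' i < p \<and> nat1 \<sigma> ''hh'' i < p"
  shows "\<exists>\<sigma>'. runs build_residual \<sigma> (20 * (p + q) + 20) 0 \<sigma>' \<and> adjacency p \<sigma>' \<and>
    stored_arcs \<sigma>' = R \<and> nat0 \<sigma>' ''rq'' \<le> 2 * q \<and> (\<forall>v<p. nat1 \<sigma>' ''vis'' v = 0)"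
proof -
  have prog: "build_residual = For ''v'' ''p'' clear_vertex ;; NSet ''rq'' (NConst 0) ;; For ''i'' ''q'' link_residual_arc"
    by (simp add: build_residual_def clear_vertex_def link_residual_arc_def)
  have "\<exists>\<sigma>'. runs (For ''v'' ''p'' clear_vertex) \<sigma> (p * (cost clear_vertex + 2) + 2) 0 \<sigma>' \<and>
      (\<forall>v<p. nat1 \<sigma>' ''first'' v = 0 \<and> nat1 \<sigma>' ''vis'' v = 0)"
    by (rule runs_For_straight) (auto simp: clear_vertex_def pq less_Suc_eq)
  then obtain \<sigma>1 where \<sigma>1: "runs (For ''v'' ''p'' clear_vertex) \<sigma> (p * (cost clear_vertex + 2) + 2) 0 \<sigma>1"
    "\<forall>v<p. nat1 \<sigma>1 ''first'' v = 0 \<and> nat1 \<sigma>1 ''vis'' v = 0" by blast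
  note f1 = runs_frame[OF \<sigma>1(1)]
  let ?\<sigma>2 = "nwrite ''rq'' 0 0 0 \<sigma>1"
  have \<sigma>2: "runs (NSet ''rq'' (NConst 0)) \<sigma>1 1 0 ?\<sigma>2"
    using runs_effect[of "NSet ''rq'' (NConst 0)" \<sigma>1] by simp
  define Rk where "Rk k = {(nat1 \<sigma> ''ht'' i, nat1 \<sigma> ''hh'' i) | i. i < k \<and> real1 \<sigma> ''fl'' i < real1 \<sigma> ''hc'' i} \<union>
    {(nat1 \<sigma> ''hh'' i, nat1 \<sigma> ''ht'' i) | i. i < k \<and> 0 < real1 \<sigma> ''fl'' i}" for k
  \<comment> \<open>Each arc contributes at most one residual arc per direction; the bound
    \<open>2 * k\<close> keeps the exploration linear.\<close>
  define Inv where "Inv k \<sigma>' \<longleftrightarrow> adjacency p \<sigma>' \<and> stored_arcs \<sigma>' = Rk k \<and> nat0 \<sigma>' ''rq'' \<le> 2 * k" for k \<sigma>'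
  have Inv_i: "Inv k (nwrite ''i'' 0 0 j \<sigma>') = Inv k \<sigma>'" for k j \<sigma>'
    by (simp add: Inv_def adjacency_def stored_arcs_def)
  have "\<exists>\<sigma>'. runs (For ''i'' ''q'' link_residual_arc) ?\<sigma>2 (q * (cost link_residual_arc + 2) + 2) 0 \<sigma>' \<and> Inv q \<sigma>'"
  proof (rule runs_For_straight, goal_cases)
    case 1
    show ?case using f1 pq by (simp add: frame_def clear_vertex_def)
  next
    case 6
    show ?case unfolding Inv_i
      using \<sigma>1(2) by (auto simp: Inv_def Rk_def adjacency_def stored_arcs_def linked_def)
  next
    case (7 k \<rho>)
    have eq: "nats \<rho> ''ht'' = nats \<sigma> ''ht''" "nats \<rho> ''hh'' = nats \<sigma> ''hh''"
      "reals \<rho> ''fl'' = reals \<sigma> ''fl''" "reals \<rho> ''hc'' = reals \<sigma> ''hc''"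
      using 7(4) f1 by (simp_all add: frame_def clear_vertex_def link_residual_arc_def link_arc_def)
    define P1 where "P1 = If_then (RLess (R1 ''fl'' (N0 ''i'')) (R1 ''hc'' (N0 ''i''))) (link_arc ''ht'' ''hh'')"
    define P2 where "P2 = If_then (RLess (RConst 0) (R1 ''fl'' (N0 ''i''))) (link_arc ''hh'' ''ht'')"
    let ?\<rho> = "effect P1 \<rho>"
    have k: "nat1 \<sigma> ''ht'' k < p" "nat1 \<sigma> ''hh'' k < p" using wf 7(1) by auto
    have i: "nat0 \<rho> ''i'' = k" using 7 by simp
    have p1: "adjacency p ?\<rho>" "stored_arcs ?\<rho> = Rk k \<union>
        (if real1 \<sigma> ''fl'' k < real1 \<sigma> ''hc'' k then {(nat1 \<sigma> ''ht'' k, nat1 \<sigma> ''hh'' k)} else {})"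
      "nat0 ?\<rho> ''rq'' \<le> 2 * k + 1"
      "nats ?\<rho> ''ht'' = nats \<sigma> ''ht''" "nats ?\<rho> ''hh'' = nats \<sigma> ''hh''" "nat0 ?\<rho> ''i'' = k"
      "reals ?\<rho> = reals \<rho>"
      using 7(2) k i eq by (auto simp: P1_def Inv_def link_arc_adjacency effect_link_arc)
    have "adjacency p (effect P2 ?\<rho>)" "stored_arcs (effect P2 ?\<rho>) = stored_arcs ?\<rho> \<union>
        (if 0 < real1 \<sigma> ''fl'' k then {(nat1 \<sigma> ''hh'' k, nat1 \<sigma> ''ht'' k)} else {})"
      "nat0 (effect P2 ?\<rho>) ''rq'' \<le> 2 * k + 2"
      using p1 k i eq by (auto simp: P2_def link_arc_adjacency effect_link_arc)
    moreover have "effect link_residual_arc \<rho> = effect P2 ?\<rho>" by (simp add: link_residual_arc_def P1_def P2_def)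
    moreover have "Rk (Suc k) = stored_arcs ?\<rho> \<union>
        (if 0 < real1 \<sigma> ''fl'' k then {(nat1 \<sigma> ''hh'' k, nat1 \<sigma> ''ht'' k)} else {})"
      unfolding p1 Rk_def by (auto simp: less_Suc_eq)
    ultimately show ?case unfolding Inv_i by (simp add: Inv_def)
  qed (auto simp: link_residual_arc_def link_arc_def)
  then obtain \<sigma>3 where \<sigma>3: "runs (For ''i'' ''q'' link_residual_arc) ?\<sigma>2 (q * (cost link_residual_arc + 2) + 2) 0 \<sigma>3" "Inv q \<sigma>3"
    by blast
  have "nats \<sigma>3 ''vis'' = nats \<sigma>1 ''vis''"
    using runs_frame[OF \<sigma>3(1)] by (simp add: frame_def link_residual_arc_def link_arc_def)
  moreover have "Rk q = R" by (auto simp: R_def Rk_def residual_def stored_graph_def)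
  moreover have "runs build_residual \<sigma> (20 * (p + q) + 20) 0 \<sigma>3"
    unfolding prog using runs_Seq[OF \<sigma>1(1) runs_Seq[OF \<sigma>2 \<sigma>3(1)]]
    by (rule runs_mono) (simp_all add: clear_vertex_def link_residual_arc_def link_arc_def)
  ultimately show ?thesis using \<sigma>1(2) \<sigma>3(2) by (auto simp: Inv_def)
qed

lemma runs_explore:
  assumes adj: "adjacency p \<sigma>" and wf: "stored_arcs \<sigma> \<subseteq> {..<p} \<times> {..<p}"
    and vis: "\<forall>v<p. nat1 \<sigma> ''vis'' v = 0" and u: "nat0 \<sigma> ''src'' = u" "u < p"
  shows "\<exists>\<sigma>'. runs explore \<sigma> (10 * (p + nat0 \<sigma> ''rq'') + 20) 0 \<sigma>' \<and>
    {v. v < p \<and> nat1 \<sigma>' ''vis'' v \<noteq> 0} = (stored_arcs \<sigma>)\<^sup>* `` {u}"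
proof -
  let ?b = "BOr (NLess (NConst 0) (N0 ''pt'')) (NLess (N0 ''qh'') (N0 ''qt''))"
  define q ta he where "q = nat0 \<sigma> ''rq''" and "ta = nat1 \<sigma> ''rt''" and "he = nat1 \<sigma> ''rh''"
  define first nxt where "first = nat1 \<sigma> ''first''" and "nxt = nat1 \<sigma> ''nxt''"
  have linked: "linked p q ta first nxt"
    using adj by (simp add: adjacency_def q_def ta_def first_def nxt_def)
  have he: "\<forall>i<q. ta i < p \<and> he i < p" using wf by (auto simp: stored_arcs_def q_def ta_def he_def)
  define Inv where "Inv \<sigma>' \<longleftrightarrow> search_inv p q ta he u (nat1 \<sigma>' ''vis'') (nat1 \<sigma>' ''que'')
    (nat0 \<sigma>' ''qh'') (nat0 \<sigma>' ''qt'') (nat0 \<sigma>' ''pt'')" for \<sigma>'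
  \<comment> \<open>A step either dequeues a vertex, which lowers the first summand and keeps the
    pending arcs, or scans an arc, which lowers the second.\<close>
  define \<mu> where "\<mu> \<sigma>' = (p - nat0 \<sigma>' ''qh'') +
    card (pending q ta (nat1 \<sigma>' ''que'') (nat0 \<sigma>' ''qh'') (nat0 \<sigma>' ''pt''))" for \<sigma>'
  let ?\<sigma> = "effect explore_init \<sigma>"
  have r0: "runs explore_init \<sigma> (cost explore_init) 0 ?\<sigma>" by (rule runs_effect) (simp add: explore_init_def)
  have init: "Inv ?\<sigma>"
    unfolding Inv_def using search_inv_init[of u p "nat1 ?\<sigma> ''vis''" "nat1 ?\<sigma> ''que''" q ta he] u vis
    by (simp add: explore_init_def)
  have fr: "frame explore_init \<sigma> ?\<sigma>" by (rule runs_frame[OF r0])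
  have "\<exists>\<sigma>'. runs (While ?b explore_step) ?\<sigma> (\<mu> ?\<sigma> * (cost explore_step + 1) + 1) 0 \<sigma>' \<and> Inv \<sigma>' \<and> \<not> bval ?b \<sigma>'"
  proof (rule runs_While_measure, goal_cases)
    case (3 \<rho>)
    have fr: "nat1 \<rho> ''rh'' = he" "nat1 \<rho> ''first'' = first" "nat1 \<rho> ''nxt'' = nxt"
      using 3(3) fr by (simp_all add: frame_def explore_init_def explore_step_def he_def first_def nxt_def)
    note fr' = fun_cong[OF fr(1)] fun_cong[OF fr(2)] fun_cong[OF fr(3)]
    note I = 3(1)[unfolded Inv_def]
    show ?case
    proof (cases "nat0 \<rho> ''pt''")
      case (Suc j)
      note I = I[unfolded Suc]
      let ?\<rho> = "effect explore_step \<rho>"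
      have upd: "nat1 ?\<rho> ''vis'' = (if nat1 \<rho> ''vis'' (he j) = 0 then (nat1 \<rho> ''vis'')(he j := 1) else nat1 \<rho> ''vis'')"
        "nat1 ?\<rho> ''que'' = (if nat1 \<rho> ''vis'' (he j) = 0 then (nat1 \<rho> ''que'')(nat0 \<rho> ''qt'' := he j) else nat1 \<rho> ''que'')"
        "nat0 ?\<rho> ''qt'' = (if nat1 \<rho> ''vis'' (he j) = 0 then Suc (nat0 \<rho> ''qt'') else nat0 \<rho> ''qt'')"
        "nat0 ?\<rho> ''pt'' = nxt j" "nat0 ?\<rho> ''qh'' = nat0 \<rho> ''qh''"
        using Suc fr' by (auto simp: explore_step_def fun_eq_iff)
      show ?thesis
        unfolding Inv_def \<mu>_def upd Suc
        using search_scan[OF I linked] he by simp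
    next
      case 0
      note I = I[unfolded 0]
      let ?\<rho> = "effect explore_step \<rho>"
      have lt: "nat0 \<rho> ''qh'' < nat0 \<rho> ''qt''" using 3(2) 0 by simp
      have upd: "nat1 ?\<rho> ''vis'' = nat1 \<rho> ''vis''" "nat1 ?\<rho> ''que'' = nat1 \<rho> ''que''"
        "nat0 ?\<rho> ''qt'' = nat0 \<rho> ''qt''"
        "nat0 ?\<rho> ''pt'' = first (nat1 \<rho> ''que'' (nat0 \<rho> ''qh''))" "nat0 ?\<rho> ''qh'' = Suc (nat0 \<rho> ''qh'')"
        using 0 fr' by (auto simp: explore_step_def fun_eq_iff)
      show ?thesis
        unfolding Inv_def \<mu>_def upd 0
        using search_pop[OF I lt linked] by simp
    qed
  qed (use init in \<open>auto simp: explore_step_def\<close>)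
  then obtain \<sigma>' where \<sigma>': "runs (While ?b explore_step) ?\<sigma> (\<mu> ?\<sigma> * (cost explore_step + 1) + 1) 0 \<sigma>'"
    "Inv \<sigma>'" "\<not> bval ?b \<sigma>'" by blast
  have "\<mu> ?\<sigma> \<le> p + q"
    unfolding \<mu>_def using card_pending_le diff_le_self by (rule add_mono[rotated])
  moreover have "cost explore_step + 1 \<le> 10" by (simp add: explore_step_def)
  ultimately have "\<mu> ?\<sigma> * (cost explore_step + 1) \<le> (p + q) * 10" by (rule mult_le_mono)
  then have "runs explore \<sigma> (10 * (p + q) + 20) 0 \<sigma>'"
    unfolding explore_def using runs_mono[OF runs_Seq[OF r0 \<sigma>'(1)]] by (simp add: explore_init_def)
  moreover have "{v. v < p \<and> nat1 \<sigma>' ''vis'' v \<noteq> 0} = (stored_arcs \<sigma>)\<^sup>* `` {u}"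
    using search_done[of p q ta he u "nat1 \<sigma>' ''vis''" "nat1 \<sigma>' ''que''"] \<sigma>'(2,3) he
    by (simp add: Inv_def stored_arcs_def q_def ta_def he_def)
  ultimately show ?thesis unfolding q_def by blast
qed

lemma runs_search:
  fixes \<sigma> p q
  defines "R \<equiv> residual (stored_graph p q ''ht'' ''hh'' \<sigma>) (real1 \<sigma> ''hc'') (real1 \<sigma> ''fl'')"
  assumes pq: "nat0 \<sigma> ''p'' = p" "nat0 \<sigma> ''q'' = q" and u: "nat0 \<sigma> ''src'' = u" "u < p"
    and wf: "\<forall>i<q. nat1 \<sigma> ''ht'' i < p \<and> nat1 \<sigma> ''hh'' i < p"
  shows "\<exists>\<sigma>'. runs search \<sigma> (40 * (p + q) + 40) 0 \<sigma>' \<and> {v. v < p \<and> nat1 \<sigma>' ''vis'' v \<noteq> 0} = R\<^sup>* `` {u}"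
proof -
  obtain \<sigma>1 where \<sigma>1: "runs build_residual \<sigma> (20 * (p + q) + 20) 0 \<sigma>1" "adjacency p \<sigma>1"
    "stored_arcs \<sigma>1 = R" "nat0 \<sigma>1 ''rq'' \<le> 2 * q" "\<forall>v<p. nat1 \<sigma>1 ''vis'' v = 0"
    using runs_build_residual[OF pq wf] unfolding R_def by blast
  have src: "nat0 \<sigma>1 ''src'' = u"
    using runs_frame[OF \<sigma>1(1)] u by (simp add: frame_def build_residual_def clear_vertex_def link_residual_arc_def link_arc_def)
  have "R \<subseteq> {..<p} \<times> {..<p}" using wf by (auto simp: R_def residual_def stored_graph_def)
  then obtain \<sigma>2 where \<sigma>2: "runs explore \<sigma>1 (10 * (p + nat0 \<sigma>1 ''rq'') + 20) 0 \<sigma>2"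
    "{v. v < p \<and> nat1 \<sigma>2 ''vis'' v \<noteq> 0} = R\<^sup>* `` {u}"
    using runs_explore[of p \<sigma>1 u] \<sigma>1 src u by auto
  \<comment> \<open>The residual graph has at most \<open>2 * q\<close> arcs, so the exploration
    takes at most \<open>10 * (p + 2 * q) + 20\<close> steps.\<close>
  have "runs search \<sigma> (40 * (p + q) + 40) 0 \<sigma>2"
    unfolding search_def by (rule runs_mono[OF runs_Seq[OF \<sigma>1(1) \<sigma>2(1)]]) (use \<sigma>1(4) in auto)
  then show ?thesis using \<sigma>2(2) by blast
qed

end

section \<open>Minimum cuts between prescribed terminals\<close>

lemma nval_NInc_funpow [simp]: "nval ((NInc ^^ j) x) \<sigma> = nval x \<sigma> + j"
  by (induction j) auto

definition terminal_arcs :: "nat \<Rightarrow> nat \<Rightarrow> nat \<Rightarrow> nat \<Rightarrow> nat \<Rightarrow> (nat \<times> nat) list" where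
  "terminal_arcs n s t a b =
     [(n, s), (n, n + 2), (n + 2, a), (b, n + 3), (n + 3, n + 1), (t, n + 1)]"

text \<open>
  The source \<open>n\<close> is joined to \<open>s\<close> and \<open>a\<close>, and \<open>b\<close> and \<open>t\<close> are joined to the sink \<open>n + 1\<close>, by arcs of large
  capacity. The arcs for \<open>a\<close> and \<open>b\<close> are subdivided since they would otherwise be parallel to another
  arc if \<open>a = s\<close> or \<open>b = t\<close>.
\<close>

definition terminal_network :: "(nat, nat) pre_digraph \<Rightarrow> (nat \<Rightarrow> real) \<Rightarrow> nat \<Rightarrow> nat \<Rightarrow> nat \<Rightarrow> nat \<Rightarrow>
    nat \<Rightarrow> nat \<Rightarrow> (nat, nat) pre_digraph \<Rightarrow> (nat \<Rightarrow> real) \<Rightarrow> bool" where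
  "terminal_network G c n m s t a b H hc \<longleftrightarrow> verts H = {..<n + 4} \<and> arcs H = {..<m + 6} \<and>
     (\<forall>i<m. tail H i = tail G i \<and> head H i = head G i \<and> hc i = c i) \<and>
     (\<forall>j<6. (tail H (m + j), head H (m + j)) = terminal_arcs n s t a b ! j \<and>
        sum c (arcs G) < hc (m + j))"

locale nat_network = network G c s t
  for G :: "(nat, nat) pre_digraph" and c :: "nat \<Rightarrow> real" and s t :: nat +
  fixes n m :: nat
  assumes verts_eq: "verts G = {..<n}" and arcs_eq: "arcs G = {..<m}"
begin

lemma st_less: "s < n" "t < n"
  using st_verts verts_eq by auto

lemma ends_less: "i < m \<Longrightarrow> tail G i < n" "i < m \<Longrightarrow> head G i < n"
  using tail_in_verts head_in_verts verts_eq arcs_eq by auto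

end

text \<open>The conditions \<open>a \<noteq> t\<close> and \<open>b \<noteq> s\<close>, together
  with \<open>a \<noteq> b\<close>, say that a cut with \<open>a\<close> inside and \<open>b\<close>
  outside exists, namely \<open>{s, a}\<close>.\<close>

locale terminals = nat_network +
  fixes a b :: nat and H :: "(nat, nat) pre_digraph" and hc :: "nat \<Rightarrow> real"
  assumes terminal_network: "terminal_network G c n m s t a b H hc"
    and ab: "a < n" "b < n" "a \<noteq> b" "a \<noteq> t" "b \<noteq> s"
begin

lemma H_simps [simp]:
  "verts H = {..<n + 4}" "arcs H = {..<m + 6}"
  "i < m \<Longrightarrow> tail H i = tail G i" "i < m \<Longrightarrow> head H i = head G i" "i < m \<Longrightarrow> hc i = c i"
  using terminal_network by (auto simp: terminal_network_def)

lemma H_terminal_arcs: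
  assumes "j < 6"
  shows "(tail H (m + j), head H (m + j)) = terminal_arcs n s t a b ! j" "sum c (arcs G) < hc (m + j)"
  using terminal_network assms by (auto simp: terminal_network_def)

lemma arc_cases:
  assumes "i \<in> arcs H"
  obtains "i < m" | j where "i = m + j" "j < 6"
proof (cases "i < m")
  case False
  then have "i = m + (i - m)" "i - m < 6" using assms by auto
  then show ?thesis using that(2) by blast
qed (use that(1) in blast)

text \<open>Every added arc has an auxiliary vertex as an end, hence is not parallel to an arc of
  \<open>G\<close>.\<close>

lemma terminal_arcs_nth:
  assumes "j < 6"
  shows "terminal_arcs n s t a b ! j \<in> {..<n + 4} \<times> {..<n + 4} - {..<n} \<times> {..<n}"
proof -
  have "terminal_arcs n s t a b ! j \<in> set (terminal_arcs n s t a b)"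
    using assms by (intro nth_mem) (simp add: terminal_arcs_def)
  moreover have "set (terminal_arcs n s t a b) \<subseteq> {..<n + 4} \<times> {..<n + 4} - {..<n} \<times> {..<n}"
  proof -
    have "s < n + 4" "t < n + 4" "a < n + 4" "b < n + 4" using st_less ab(1,2) by linarith+
    then show ?thesis by (simp add: terminal_arcs_def)
  qed
  ultimately show ?thesis by (rule rev_subsetD)
qed

lemma distinct_terminal_arcs: "distinct (terminal_arcs n s t a b)"
proof -
  have neq: "s \<noteq> n + 2" "b \<noteq> n" "b \<noteq> n + 2" "t \<noteq> n" "t \<noteq> n + 2" "t \<noteq> n + 3"
    using st_less ab(1,2) by linarith+
  show ?thesis
    using neq [[linarith_neq_limit = 0]] by (simp add: terminal_arcs_def)
qed

lemma ends_H:
  "i < m \<Longrightarrow> (tail H i, head H i) \<in> {..<n} \<times> {..<n}"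
  "j < 6 \<Longrightarrow> (tail H (m + j), head H (m + j)) \<in> {..<n + 4} \<times> {..<n + 4} - {..<n} \<times> {..<n}"
  using ends_less terminal_arcs_nth H_terminal_arcs(1) by simp_all

lemma network_H: "st_network H hc n (n + 1)"
proof -
  have ends: "(tail H i, head H i) \<in> {..<n + 4} \<times> {..<n + 4}" if "i \<in> arcs H" for i
    using that by (cases rule: arc_cases) (use ends_H in fastforce)+
  interpret H: fin_digraph H by unfold_locales (use ends in auto)
  have "e = e'" if "e \<in> arcs H" "e' \<in> arcs H" "(tail H e, head H e) = (tail H e', head H e')" for e e'
    using that(1)
  proof (cases rule: arc_cases)
    case e: 1
    show ?thesis using that(2)
    proof (cases rule: arc_cases)
      case 1
      then show ?thesis using nomulti[of e e'] e that(3) arcs_eq by simp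
    next
      case (2 j)
      then show ?thesis using ends_H(1)[OF e] ends_H(2)[OF 2(2)] that(3) by (metis DiffD2)
    qed
  next
    case e: (2 i)
    show ?thesis using that(2)
    proof (cases rule: arc_cases)
      case 1
      then show ?thesis using ends_H(1)[OF 1] ends_H(2)[OF e(2)] e(1) that(3) by (metis DiffD2)
    next
      case (2 j)
      have "terminal_arcs n s t a b ! i = terminal_arcs n s t a b ! j"
        using H_terminal_arcs(1)[OF 2(2)] H_terminal_arcs(1)[OF e(2)] 2(1) e(1) that(3) by metis
      then have "i = j"
        using distinct_terminal_arcs e(2) 2(2) by (simp add: nth_eq_iff_index_eq terminal_arcs_def)
      then show ?thesis using e 2 by simp
    qed
  qed
  then have "nomulti_digraph H" by unfold_locales (auto simp: arc_to_ends_def)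
  moreover have "0 < hc i" if "i \<in> arcs H" for i
    using that
  proof (cases rule: arc_cases)
    case 1
    then show ?thesis using cap_pos[of i] arcs_eq by simp
  next
    case (2 j)
    have "0 \<le> sum c (arcs G)" using cap_pos by (intro sum_nonneg) (auto intro: less_imp_le)
    then show ?thesis using H_terminal_arcs(2)[OF 2(2)] 2 by simp
  qed
  ultimately show ?thesis unfolding st_network_def using H.fin_digraph_axioms by simp
qed

sublocale H: network H hc n "n + 1"
  by unfold_locales (rule network_H)

lemma terminal_arcs_all:
  "(\<forall>j<6. P (tail H (m + j)) (head H (m + j))) \<longleftrightarrow> (\<forall>(x, y)\<in>set (terminal_arcs n s t a b). P x y)"
proof -
  have len: "length (terminal_arcs n s t a b) = 6" by (simp add: terminal_arcs_def)
  show ?thesis unfolding all_set_conv_all_nth len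
    by (intro all_cong) (metis H_terminal_arcs(1) case_prod_conv)
qed

lemma cut_capacity_H:
  assumes "\<And>j. j < 6 \<Longrightarrow> m + j \<notin> leaving H C"
  shows "cut_capacity H hc C = cut_capacity G c (C \<inter> {..<n})"
proof -
  have "leaving H C = leaving G (C \<inter> {..<n})"
  proof (intro set_eqI iffI)
    fix i assume i: "i \<in> leaving H C"
    then have "i \<in> arcs H" by (simp add: leaving_def)
    then show "i \<in> leaving G (C \<inter> {..<n})"
      by (cases rule: arc_cases) (use assms i in \<open>auto simp: leaving_def arcs_eq ends_less\<close>)
  qed (auto simp: leaving_def arcs_eq ends_less)
  then show ?thesis
    unfolding H.cut_capacity_leaving cut_capacity_leaving
    by (simp, intro sum.cong) (auto simp: leaving_def arcs_eq)
qed

text \<open>Feasible cuts of \<open>G\<close> extend to cuts of \<open>H\<close> with the same capacity; hence a minimum cut of \<open>H\<close> avoids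
  the arcs of large capacity and restricts to a minimum feasible cut of \<open>G\<close>.\<close>

lemma terminal_mincut:
  assumes max: "max_st_flow H hc n (n + 1) f"
  defines "K \<equiv> ((residual H hc f)\<^sup>* `` {n}) \<inter> {..<n}"
  shows "st_cut G s t K" "a \<in> K" "b \<notin> K"
    "\<And>D. st_cut G s t D \<Longrightarrow> a \<in> D \<Longrightarrow> b \<notin> D \<Longrightarrow> cut_capacity G c K \<le> cut_capacity G c D"
proof -
  define C where "C = (residual H hc f)\<^sup>* `` {n}"
  have f: "st_flow H hc n (n + 1) f" using max by (simp add: max_st_flow_def)
  have C: "st_cut H n (n + 1) C" unfolding C_def by (rule H.reachable_cut[OF max])
  have val: "cut_capacity H hc C = flow_value H n f"
    by (rule H.residual_closed_cut_value[OF f C]) (auto simp: C_def intro: rtrancl_into_rtrancl)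
  have le: "cut_capacity H hc C \<le> cut_capacity G c D"
    if D: "st_cut G s t D" "a \<in> D" "b \<notin> D" for D
  proof -
    \<comment> \<open>The source \<open>n\<close> and the subdivision vertex \<open>n + 2\<close>
      join the side of \<open>s\<close> and \<open>a\<close>, while \<open>n + 3\<close> and the
      sink \<open>n + 1\<close> stay on the side of \<open>b\<close> and \<open>t\<close>. Then no
      arc of large capacity leaves the extended cut.\<close>
    let ?D = "D \<union> {n, n + 2}"
    have sub: "D \<subseteq> {..<n}" "s \<in> D" "t \<notin> D" using D by (auto simp: st_cut_def verts_eq)
    have "\<forall>j<6. \<not> (tail H (m + j) \<in> ?D \<and> head H (m + j) \<notin> ?D)"
      unfolding terminal_arcs_all[of "\<lambda>x y. \<not> (x \<in> ?D \<and> y \<notin> ?D)"]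
      using D sub st_less ab(2) by (auto simp: terminal_arcs_def)
    then have "cut_capacity H hc ?D = cut_capacity G c (?D \<inter> {..<n})"
      by (intro cut_capacity_H) (simp add: leaving_def)
    also have "?D \<inter> {..<n} = D" using sub by auto
    finally have "cut_capacity H hc ?D = cut_capacity G c D" .
    moreover have "st_cut H n (n + 1) ?D"
      using sub by (auto simp: st_cut_def)
    ultimately show ?thesis using H.flow_value_le_cut[OF f, of ?D] val by simp
  qed
  \<comment> \<open>The feasible cut \<open>{s, a}\<close> costs at most the total capacity of
    \<open>G\<close>, which is less than the capacity of a single added arc.\<close>
  have "cut_capacity H hc C \<le> cut_capacity G c {s, a}"
    by (rule le) (use st_less st_verts(3) ab in \<open>auto simp: st_cut_def verts_eq\<close>)
  also have "\<dots> \<le> sum c (arcs G)"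
    unfolding cut_capacity_leaving using cap_pos
    by (intro sum_mono2) (auto simp: leaving_def intro: less_imp_le)
  finally have small: "cut_capacity H hc C \<le> sum c (arcs G)" .
  have not_leaving: "m + j \<notin> leaving H C" if "j < 6" for j
  proof
    assume "m + j \<in> leaving H C"
    then have "sum hc {m + j} \<le> cut_capacity H hc C"
      unfolding H.cut_capacity_leaving using H.cap_pos
      by (intro sum_mono2) (auto simp: leaving_def intro: less_imp_le)
    then show False using small H_terminal_arcs(2)[OF that] by simp
  qed
  have "\<forall>j<6. tail H (m + j) \<in> C \<longrightarrow> head H (m + j) \<in> C"
    using not_leaving by (simp add: leaving_def)
  then have "n \<in> C \<longrightarrow> s \<in> C" "n \<in> C \<longrightarrow> n + 2 \<in> C" "n + 2 \<in> C \<longrightarrow> a \<in> C"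
    "b \<in> C \<longrightarrow> n + 3 \<in> C" "n + 3 \<in> C \<longrightarrow> n + 1 \<in> C" "t \<in> C \<longrightarrow> n + 1 \<in> C"
    unfolding terminal_arcs_all[of "\<lambda>x y. x \<in> C \<longrightarrow> y \<in> C"] by (simp_all add: terminal_arcs_def)
  then have mem: "s \<in> C" "a \<in> C" "b \<notin> C" "t \<notin> C" using C by (auto simp: st_cut_def)
  then show "st_cut G s t K" "a \<in> K" "b \<notin> K"
    using st_less ab(1,2) by (auto simp: K_def C_def st_cut_def verts_eq)
  show "cut_capacity G c K \<le> cut_capacity G c D" if "st_cut G s t D" "a \<in> D" "b \<notin> D" for D
    using le[OF that] cut_capacity_H[OF not_leaving] by (simp add: K_def C_def)
qed

end

section \<open>Programs that compute and evaluate a cut\<close>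

definition add_terminal_arc :: "nat \<Rightarrow> nexp \<Rightarrow> nexp \<Rightarrow> com" where
  "add_terminal_arc j x y =
     NSet1 ''ht'' ((NInc ^^ j) (N0 ''m'')) x ;;
     NSet1 ''hh'' ((NInc ^^ j) (N0 ''m'')) y ;;
     RSet1 ''hc'' ((NInc ^^ j) (N0 ''m'')) (R0 ''big'')"

definition copy_arc :: com where
  "copy_arc =
     NSet1 ''ht'' (N0 ''i'') (N1 ''tail'' (N0 ''i'')) ;;
     NSet1 ''hh'' (N0 ''i'') (N1 ''head'' (N0 ''i'')) ;;
     RSet1 ''hc'' (N0 ''i'') (R1 ''cap'' (N0 ''i''))"

definition copy_network :: com where
  "copy_network = For ''i'' ''m'' copy_arc"

definition attach_terminals :: com where
  "attach_terminals =
     (let S = N0 ''n''; T = NInc S; S' = NInc T; T' = NInc S' in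
      NSet ''p'' (NInc T') ;;
      NSet ''q'' ((NInc ^^ 6) (N0 ''m'')) ;;
      NSet ''src'' S ;;
      NSet ''snk'' T ;;
      add_terminal_arc 0 S (N0 ''s'') ;;
      add_terminal_arc 1 S S' ;;
      add_terminal_arc 2 S' (N0 ''a'') ;;
      add_terminal_arc 3 (N0 ''b'') T' ;;
      add_terminal_arc 4 T' T ;;
      add_terminal_arc 5 (N0 ''t'') T)"

definition leaves :: bexp where
  "leaves = BAnd (NLess (NConst 0) (N1 ''vis'' (N1 ''tail'' (N0 ''i''))))
     (BNot (NLess (NConst 0) (N1 ''vis'' (N1 ''head'' (N0 ''i'')))))"

text \<open>The lower bound of \<open>vitality_ge\<close> for arc \<open>i\<close> and the cut
  currently marked.\<close>

definition gain :: rexp where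
  "gain = RSub (RAdd (R0 ''lam'') (R1 ''cap'' (N0 ''i''))) (R0 ''cw'')"

definition add_capacity :: com where
  "add_capacity =
     If_then leaves (RSet ''cw'' (RAdd (R0 ''cw'') (R1 ''cap'' (N0 ''i''))))"

definition improve_vitality :: com where
  "improve_vitality =
     If_then (BAnd leaves (RLess (R1 ''vt'' (N0 ''i'')) gain)) (RSet1 ''vt'' (N0 ''i'') gain)"

definition evaluate_cut :: com where
  "evaluate_cut =
     RSet ''cw'' (RConst 0) ;;
     For ''i'' ''m'' add_capacity ;;
     For ''i'' ''m'' improve_vitality"

definition find_cut :: com where
  "find_cut = copy_network ;; attach_terminals ;;
     MaxFlow (N0 ''p'') (N0 ''q'') ''ht'' ''hh'' ''hc'' (N0 ''src'') (N0 ''snk'') ''fl'' ;;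
     search ;; evaluate_cut"

lemma writes_find_cut [simp]:
  "nat_writes find_cut = {''i'', ''v'', ''w'', ''ht'', ''hh'', ''p'', ''q'', ''src'', ''snk'', ''first'', ''vis'',
     ''rq'', ''rt'', ''rh'', ''nxt'', ''que'', ''qh'', ''qt'', ''pt''}"
  "real_writes find_cut = {''hc'', ''fl'', ''cw'', ''vt''}"
  by (auto simp: find_cut_def copy_network_def copy_arc_def attach_terminals_def Let_def add_terminal_arc_def
      evaluate_cut_def add_capacity_def improve_vitality_def)

text \<open>Distinct terminals give two vertices, and with \<open>0 < m\<close> this yields
  \<open>n + 4 \<le> 7 * n\<close> and \<open>m + 6 \<le> 7 * m\<close>: the enlarged networks
  respect the size bound in \<open>runs\<close>. The factor 7 is what a graph with a single arc
  needs.\<close>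

locale vitality_program = flow_machine mf n m + nat_network G c s t n m
  for mf n m G c s t +
  assumes mf: "max_flow_oracle mf" and m_pos: "0 < m"
begin

lemma n_ge_2: "2 \<le> n"
  using st_less st_verts(3) by linarith

definition input_stored :: "memory \<Rightarrow> bool" where
  "input_stored \<sigma> \<longleftrightarrow> nat0 \<sigma> ''n'' = n \<and> nat0 \<sigma> ''m'' = m \<and> nat0 \<sigma> ''s'' = s \<and> nat0 \<sigma> ''t'' = t \<and>
     (\<forall>i<m. nat1 \<sigma> ''tail'' i = tail G i \<and> nat1 \<sigma> ''head'' i = head G i \<and> real1 \<sigma> ''cap'' i = c i)"

text \<open>The number \<open>big\<close> plays two parts: it is the capacity of the arcs at the
  added terminals, and the initial "infinite" value in the search for a minimum cut.\<close>

definition ready :: "memory \<Rightarrow> bool" where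
  "ready \<sigma> \<longleftrightarrow> input_stored \<sigma> \<and> real0 \<sigma> ''lam'' = mincut_capacity G c s t \<and>
     sum c (arcs G) < real0 \<sigma> ''big''"

lemma input_stored_frame:
  assumes "frame P \<sigma> \<sigma>'" "input_stored \<sigma>"
    "nat_writes P \<inter> {''n'', ''m'', ''s'', ''t'', ''tail'', ''head''} = {}" "''cap'' \<notin> real_writes P"
  shows "input_stored \<sigma>'"
  using assms by (simp add: input_stored_def frame_def)

lemma ready_frame:
  assumes "frame P \<sigma> \<sigma>'" "ready \<sigma>"
    "nat_writes P \<inter> {''n'', ''m'', ''s'', ''t'', ''tail'', ''head''} = {}"
    "real_writes P \<inter> {''cap'', ''lam'', ''big''} = {}"
  shows "ready \<sigma>'"
  using assms input_stored_frame[OF assms(1)] by (simp add: ready_def frame_def)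

lemma runs_copy_network:
  assumes "input_stored \<sigma>"
  shows "\<exists>\<sigma>'. runs copy_network \<sigma> (5 * m + 2) 0 \<sigma>' \<and>
    (\<forall>i<m. nat1 \<sigma>' ''ht'' i = tail G i \<and> nat1 \<sigma>' ''hh'' i = head G i \<and> real1 \<sigma>' ''hc'' i = c i)"
proof -
  have "\<exists>\<sigma>'. runs (For ''i'' ''m'' copy_arc) \<sigma> (m * (cost copy_arc + 2) + 2) 0 \<sigma>' \<and>
    (\<forall>i<m. nat1 \<sigma>' ''ht'' i = tail G i \<and> nat1 \<sigma>' ''hh'' i = head G i \<and> real1 \<sigma>' ''hc'' i = c i)"
  proof (rule runs_For_straight, goal_cases)
    case (7 k \<rho>)
    have "nats \<rho> ''tail'' = nats \<sigma> ''tail''" "nats \<rho> ''head'' = nats \<sigma> ''head''" "reals \<rho> ''cap'' = reals \<sigma> ''cap''"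
      using 7(4) by (simp_all add: frame_def copy_arc_def)
    then show ?case using 7 assms by (auto simp: copy_arc_def input_stored_def less_Suc_eq)
  qed (use assms in \<open>auto simp: copy_arc_def input_stored_def\<close>)
  moreover have "m * (cost copy_arc + 2) + 2 = 5 * m + 2" by (simp add: copy_arc_def)
  ultimately show ?thesis unfolding copy_network_def by metis
qed

lemma less_6_iff: "(j::nat) < 6 \<longleftrightarrow> j \<in> {0, 1, 2, 3, 4, 5}"
  by auto

lemma runs_attach_terminals:
  assumes "ready \<sigma>" and ab: "nat0 \<sigma> ''a'' = a" "nat0 \<sigma> ''b'' = b"
    and copied: "\<forall>i<m. nat1 \<sigma> ''ht'' i = tail G i \<and> nat1 \<sigma> ''hh'' i = head G i \<and> real1 \<sigma> ''hc'' i = c i"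
  shows "\<exists>\<sigma>'. runs attach_terminals \<sigma> 22 0 \<sigma>' \<and>
    terminal_network G c n m s t a b (stored_graph (n + 4) (m + 6) ''ht'' ''hh'' \<sigma>') (real1 \<sigma>' ''hc'') \<and>
    nat0 \<sigma>' ''p'' = n + 4 \<and> nat0 \<sigma>' ''q'' = m + 6 \<and> nat0 \<sigma>' ''src'' = n \<and> nat0 \<sigma>' ''snk'' = n + 1"
proof -
  let ?\<sigma> = "effect attach_terminals \<sigma>"
  have inp: "nat0 \<sigma> ''n'' = n" "nat0 \<sigma> ''m'' = m" "nat0 \<sigma> ''s'' = s" "nat0 \<sigma> ''t'' = t"
    "sum c (arcs G) < real0 \<sigma> ''big''"
    using assms(1) by (auto simp: ready_def input_stored_def)
  have r: "runs attach_terminals \<sigma> 22 0 ?\<sigma>"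
    by (rule runs_mono[OF runs_effect]) (simp_all add: attach_terminals_def Let_def add_terminal_arc_def)
  have old: "\<forall>i<m. nat1 ?\<sigma> ''ht'' i = tail G i \<and> nat1 ?\<sigma> ''hh'' i = head G i \<and> real1 ?\<sigma> ''hc'' i = c i"
    using copied inp by (simp add: attach_terminals_def Let_def add_terminal_arc_def)
  have scalars: "nat0 ?\<sigma> ''p'' = n + 4" "nat0 ?\<sigma> ''q'' = m + 6" "nat0 ?\<sigma> ''src'' = n" "nat0 ?\<sigma> ''snk'' = n + 1"
    using inp by (simp_all add: attach_terminals_def Let_def add_terminal_arc_def)
  have new: "(nat1 ?\<sigma> ''ht'' (m + j), nat1 ?\<sigma> ''hh'' (m + j)) = terminal_arcs n s t a b ! j \<and>
      real1 ?\<sigma> ''hc'' (m + j) = real0 \<sigma> ''big''" if "j < 6" for j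
    using that[unfolded less_6_iff] inp ab
    by (elim insertE emptyE)
      (simp_all add: attach_terminals_def Let_def add_terminal_arc_def terminal_arcs_def)
  have "terminal_network G c n m s t a b (stored_graph (n + 4) (m + 6) ''ht'' ''hh'' ?\<sigma>) (real1 ?\<sigma> ''hc'')"
    unfolding terminal_network_def stored_graph_def using old new inp(5) by simp
  then show ?thesis using r scalars by blast
qed

lemma runs_evaluate_cut:
  assumes "ready \<sigma>" and K: "K = {v. v < n \<and> nat1 \<sigma> ''vis'' v \<noteq> 0}"
  shows "\<exists>\<sigma>'. runs evaluate_cut \<sigma> (12 * m + 10) 0 \<sigma>' \<and>
    real0 \<sigma>' ''cw'' = cut_capacity G c K \<and>
    (\<forall>e<m. real1 \<sigma>' ''vt'' e = (if e \<in> leaving G K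
       then max (real1 \<sigma> ''vt'' e) (mincut_capacity G c s t + c e - cut_capacity G c K)
       else real1 \<sigma> ''vt'' e))"
proof -
  let ?\<sigma>0 = "rwrite ''cw'' 0 0 0 \<sigma>"
  have r0: "runs (RSet ''cw'' (RConst 0)) \<sigma> 1 0 ?\<sigma>0"
    using runs_effect[of "RSet ''cw'' (RConst 0)" \<sigma>] by simp
  have leaves: "bval leaves \<rho> \<longleftrightarrow> nat0 \<rho> ''i'' \<in> leaving G K"
    if "nat0 \<rho> ''i'' < m" "nats \<rho> ''vis'' = nats \<sigma> ''vis''" "input_stored \<rho>" for \<rho>
    using that by (simp add: leaves_def leaving_def arcs_eq input_stored_def K ends_less)
  have inp: "input_stored \<sigma>" "real0 \<sigma> ''lam'' = mincut_capacity G c s t" using assms by (auto simp: ready_def)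
  have "\<exists>\<sigma>'. runs (For ''i'' ''m'' add_capacity) ?\<sigma>0 (m * (cost add_capacity + 2) + 2) 0 \<sigma>' \<and>
     real0 \<sigma>' ''cw'' = sum c {e. e < m \<and> e \<in> leaving G K}"
  proof (rule runs_For_straight, goal_cases)
    case (7 k \<rho>)
    have \<rho>: "input_stored \<rho>" "nats \<rho> ''vis'' = nats \<sigma> ''vis''"
      using input_stored_frame[OF 7(4)] 7(4) inp(1)
      by (simp_all add: add_capacity_def frame_def input_stored_def)
    have "{e. e < Suc k \<and> e \<in> leaving G K} =
        (if k \<in> leaving G K then insert k {e. e < k \<and> e \<in> leaving G K} else {e. e < k \<and> e \<in> leaving G K})"
      by (auto simp: less_Suc_eq)
    then show ?case using 7 \<rho> leaves[of \<rho>] by (simp add: add_capacity_def input_stored_def add.commute)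
  qed (use inp in \<open>auto simp: add_capacity_def input_stored_def\<close>)
  then obtain \<sigma>1 where \<sigma>1: "runs (For ''i'' ''m'' add_capacity) ?\<sigma>0 (m * (cost add_capacity + 2) + 2) 0 \<sigma>1"
     "real0 \<sigma>1 ''cw'' = sum c {e. e < m \<and> e \<in> leaving G K}" by blast
  have "{e. e < m \<and> e \<in> leaving G K} = leaving G K" by (auto simp: leaving_def arcs_eq)
  then have cw: "real0 \<sigma>1 ''cw'' = cut_capacity G c K" using \<sigma>1(2) by (simp add: cut_capacity_leaving)
  have f1: "nats \<sigma>1 ''vis'' = nats \<sigma> ''vis''" "reals \<sigma>1 ''vt'' = reals \<sigma> ''vt''"
    "real0 \<sigma>1 ''lam'' = mincut_capacity G c s t" "input_stored \<sigma>1"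
    using runs_frame[OF \<sigma>1(1)] inp input_stored_frame[OF runs_frame[OF \<sigma>1(1)]]
    by (simp_all add: frame_def add_capacity_def input_stored_def)
  define val where "val e = (if e \<in> leaving G K
       then max (real1 \<sigma> ''vt'' e) (mincut_capacity G c s t + c e - cut_capacity G c K)
       else real1 \<sigma> ''vt'' e)" for e
  have "\<exists>\<sigma>'. runs (For ''i'' ''m'' improve_vitality) \<sigma>1 (m * (cost improve_vitality + 2) + 2) 0 \<sigma>' \<and>
     (\<forall>e. real1 \<sigma>' ''vt'' e = (if e < m then val e else real1 \<sigma> ''vt'' e))"
  proof (rule runs_For_straight, goal_cases)
    case (7 k \<rho>)
    have \<rho>: "input_stored \<rho>" "nats \<rho> ''vis'' = nats \<sigma> ''vis''" "real0 \<rho> ''cw'' = cut_capacity G c K"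
      "real0 \<rho> ''lam'' = mincut_capacity G c s t"
      using input_stored_frame[OF 7(4)] 7(4) f1 cw by (simp_all add: improve_vitality_def frame_def)
    have "real1 \<rho> ''cap'' k = c k" using \<rho>(1) 7(1) by (simp add: input_stored_def)
    then show ?case using 7 \<rho> leaves[of \<rho>] by (auto simp: improve_vitality_def gain_def val_def max_def less_Suc_eq)
  qed (use f1 in \<open>auto simp: improve_vitality_def input_stored_def\<close>)
  then obtain \<sigma>2 where \<sigma>2: "runs (For ''i'' ''m'' improve_vitality) \<sigma>1 (m * (cost improve_vitality + 2) + 2) 0 \<sigma>2"
     "\<forall>e<m. real1 \<sigma>2 ''vt'' e = val e" by auto
  have "real0 \<sigma>2 ''cw'' = cut_capacity G c K"
    using runs_frame[OF \<sigma>2(1)] cw by (simp add: frame_def improve_vitality_def)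
  moreover have "runs evaluate_cut \<sigma> (12 * m + 10) 0 \<sigma>2"
    unfolding evaluate_cut_def
    by (rule runs_mono[OF runs_Seq[OF r0 runs_Seq[OF \<sigma>1(1) \<sigma>2(1)]]]) (simp_all add: add_capacity_def improve_vitality_def)
  ultimately show ?thesis
    using \<sigma>2(2) unfolding val_def by (intro exI[of _ \<sigma>2] conjI)
qed

text \<open>Only the maximality of the returned flow is exported, so nothing later can depend on
  which maximum flow the procedure chooses.\<close>

lemma runs_MaxFlow:
  assumes net: "st_network (stored_graph p q ta he \<sigma>) (real1 \<sigma> cp) (nval x \<sigma>) (nval y \<sigma>)"
    and "p = nval P \<sigma>" "q = nval Q \<sigma>" "p \<le> 7 * n" "q \<le> 7 * m"
  shows "\<exists>\<sigma>'. runs (MaxFlow P Q ta he cp x y fl) \<sigma> 1 1 \<sigma>' \<and>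
    (\<exists>f. max_st_flow (stored_graph p q ta he \<sigma>) (real1 \<sigma> cp) (nval x \<sigma>) (nval y \<sigma>) f \<and>
      (\<forall>i<q. real1 \<sigma>' fl i = f i))"
proof -
  let ?H = "stored_graph p q ta he \<sigma>" and ?c = "real1 \<sigma> cp"
  let ?f = "mf ?H ?c (nval x \<sigma>) (nval y \<sigma>)"
  let ?\<sigma> = "\<sigma>\<lparr>reals := (reals \<sigma>)(fl := \<lambda>i j. if i < q \<and> j = 0 then ?f i else reals \<sigma> fl i j)\<rparr>"
  have "exec mf (MaxFlow P Q ta he cp x y fl) \<sigma> ?\<sigma> 1 [(p, q)]"
    by (rule exec.MaxFlow[OF assms(2,3) refl refl net refl refl])
  then have "runs (MaxFlow P Q ta he cp x y fl) \<sigma> 1 1 ?\<sigma>"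
    unfolding runs_def using assms(4,5) by (intro exI[of _ 1] exI[of _ "[(p, q)]"]) simp
  moreover have "max_st_flow ?H ?c (nval x \<sigma>) (nval y \<sigma>) ?f"
    using mf net by (simp add: max_flow_oracle_def)
  moreover have "\<forall>i<q. real1 ?\<sigma> fl i = ?f i" by simp
  ultimately show ?thesis by (intro exI[of _ ?\<sigma>] conjI exI[of _ ?f])
qed

lemma residual_cong:
  assumes "\<And>i. i \<in> arcs H \<Longrightarrow> f i = f' i"
  shows "residual H hc f = residual H hc f'"
  using assms by (simp add: residual_def cong: conj_cong)

text \<open>The common building block of the tree and of the forest: one flow, one linear search,
  one pass over the arcs. The pass improves the entries of all arcs leaving the cut. The additive
  costs are absorbed into \<open>1000 * (n + m)\<close> by \<open>n \<ge> 2\<close> and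
  \<open>m \<ge> 1\<close>.\<close>

lemma runs_find_cut:
  assumes "ready \<sigma>" and "nat0 \<sigma> ''a'' = a" "nat0 \<sigma> ''b'' = b"
    and ab: "a < n" "b < n" "a \<noteq> b" "a \<noteq> t" "b \<noteq> s"
  shows "\<exists>\<sigma>' K. runs find_cut \<sigma> (1000 * (n + m)) 1 \<sigma>' \<and> st_cut G s t K \<and> a \<in> K \<and> b \<notin> K \<and>
    (\<forall>D. st_cut G s t D \<longrightarrow> a \<in> D \<longrightarrow> b \<notin> D \<longrightarrow> cut_capacity G c K \<le> cut_capacity G c D) \<and>
    K = {v. v < n \<and> nat1 \<sigma>' ''vis'' v \<noteq> 0} \<and> real0 \<sigma>' ''cw'' = cut_capacity G c K \<and>
    (\<forall>e<m. real1 \<sigma>' ''vt'' e = (if e \<in> leaving G K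
       then max (real1 \<sigma> ''vt'' e) (mincut_capacity G c s t + c e - cut_capacity G c K)
       else real1 \<sigma> ''vt'' e))"
proof -
  obtain \<sigma>1 where \<sigma>1: "runs copy_network \<sigma> (5 * m + 2) 0 \<sigma>1"
    "\<forall>i<m. nat1 \<sigma>1 ''ht'' i = tail G i \<and> nat1 \<sigma>1 ''hh'' i = head G i \<and> real1 \<sigma>1 ''hc'' i = c i"
    using runs_copy_network assms(1) by (auto simp: ready_def)
  have f1: "ready \<sigma>1" "nat0 \<sigma>1 ''a'' = a" "nat0 \<sigma>1 ''b'' = b" "reals \<sigma>1 ''vt'' = reals \<sigma> ''vt''"
    using runs_frame[OF \<sigma>1(1)] ready_frame[OF runs_frame[OF \<sigma>1(1)]] assms
    by (simp_all add: frame_def copy_network_def copy_arc_def)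
  obtain \<sigma>2 where \<sigma>2: "runs attach_terminals \<sigma>1 22 0 \<sigma>2"
    "terminal_network G c n m s t a b (stored_graph (n + 4) (m + 6) ''ht'' ''hh'' \<sigma>2) (real1 \<sigma>2 ''hc'')"
    "nat0 \<sigma>2 ''p'' = n + 4" "nat0 \<sigma>2 ''q'' = m + 6" "nat0 \<sigma>2 ''src'' = n" "nat0 \<sigma>2 ''snk'' = n + 1"
    using runs_attach_terminals[OF f1(1,2,3) \<sigma>1(2)] by blast
  have f2: "ready \<sigma>2" "reals \<sigma>2 ''vt'' = reals \<sigma> ''vt''"
    using runs_frame[OF \<sigma>2(1)] ready_frame[OF runs_frame[OF \<sigma>2(1)]] f1
    by (simp_all add: frame_def attach_terminals_def Let_def add_terminal_arc_def)
  let ?H = "stored_graph (n + 4) (m + 6) ''ht'' ''hh'' \<sigma>2" and ?hc = "real1 \<sigma>2 ''hc''"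
  interpret T: terminals G c s t n m a b ?H ?hc
    by unfold_locales (use \<sigma>2(2) ab in auto)
  let ?MF = "MaxFlow (N0 ''p'') (N0 ''q'') ''ht'' ''hh'' ''hc'' (N0 ''src'') (N0 ''snk'') ''fl''"
  have net: "st_network ?H ?hc (nval (N0 ''src'') \<sigma>2) (nval (N0 ''snk'') \<sigma>2)"
    unfolding nval.simps \<sigma>2(5,6) by (rule T.network_H)
  have pq: "n + 4 = nval (N0 ''p'') \<sigma>2" "m + 6 = nval (N0 ''q'') \<sigma>2" "n + 4 \<le> 7 * n" "m + 6 \<le> 7 * m"
    using \<sigma>2(3,4) n_ge_2 m_pos by simp_all
  obtain \<sigma>3 f where \<sigma>3: "runs ?MF \<sigma>2 1 1 \<sigma>3" and f: "max_st_flow ?H ?hc n (n + 1) f"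
    and fl: "\<forall>i<m + 6. real1 \<sigma>3 ''fl'' i = f i"
    using runs_MaxFlow[OF net pq, of "''fl''"] unfolding nval.simps \<sigma>2(5,6) by blast
  have f3: "ready \<sigma>3" "reals \<sigma>3 ''vt'' = reals \<sigma> ''vt''" "nats \<sigma>3 = nats \<sigma>2" "reals \<sigma>3 ''hc'' = reals \<sigma>2 ''hc''"
    using runs_frame[OF \<sigma>3] ready_frame[OF runs_frame[OF \<sigma>3]] f2 by (auto simp: frame_def fun_eq_iff)
  have H3: "stored_graph (n + 4) (m + 6) ''ht'' ''hh'' \<sigma>3 = ?H" by (simp add: stored_graph_def f3)
  \<comment> \<open>The memory agrees with \<open>f\<close> only on the arcs of the network, and
    these alone determine the residual graph.\<close>
  have res: "residual ?H ?hc (real1 \<sigma>3 ''fl'') = residual ?H ?hc f"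
    by (rule residual_cong) (use fl in simp)
  have wf: "\<forall>i<m + 6. nat1 \<sigma>3 ''ht'' i < n + 4 \<and> nat1 \<sigma>3 ''hh'' i < n + 4"
    using T.H.tail_in_verts T.H.head_in_verts f3(3) by (simp add: stored_graph_def)
  obtain \<sigma>4 where \<sigma>4: "runs search \<sigma>3 (40 * (n + 4 + (m + 6)) + 40) 0 \<sigma>4"
    "{v. v < n + 4 \<and> nat1 \<sigma>4 ''vis'' v \<noteq> 0} = (residual ?H ?hc f)\<^sup>* `` {n}"
    using runs_search[of \<sigma>3 "n + 4" "m + 6" n] wf unfolding H3 f3(3,4) res \<sigma>2(3-5) by auto
  define K where "K = {v. v < n \<and> nat1 \<sigma>4 ''vis'' v \<noteq> 0}"
  have "K = ((residual ?H ?hc f)\<^sup>* `` {n}) \<inter> {..<n}" unfolding \<sigma>4(2)[symmetric] by (auto simp: K_def)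
  then have K: "st_cut G s t K" "a \<in> K" "b \<notin> K"
    "\<forall>D. st_cut G s t D \<longrightarrow> a \<in> D \<longrightarrow> b \<notin> D \<longrightarrow> cut_capacity G c K \<le> cut_capacity G c D"
    using T.terminal_mincut[OF f] by auto
  have f4: "ready \<sigma>4" "reals \<sigma>4 ''vt'' = reals \<sigma> ''vt''"
    using runs_frame[OF \<sigma>4(1)] ready_frame[OF runs_frame[OF \<sigma>4(1)]] f3
    by (simp_all add: frame_def)
  obtain \<sigma>5 where \<sigma>5: "runs evaluate_cut \<sigma>4 (12 * m + 10) 0 \<sigma>5" "real0 \<sigma>5 ''cw'' = cut_capacity G c K"
    "\<forall>e<m. real1 \<sigma>5 ''vt'' e = (if e \<in> leaving G K
       then max (real1 \<sigma> ''vt'' e) (mincut_capacity G c s t + c e - cut_capacity G c K)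
       else real1 \<sigma> ''vt'' e)"
    using runs_evaluate_cut[OF f4(1) K_def] unfolding f4(2) by blast
  have "K = {v. v < n \<and> nat1 \<sigma>5 ''vis'' v \<noteq> 0}"
    using runs_frame[OF \<sigma>5(1)] by (simp add: frame_def evaluate_cut_def add_capacity_def improve_vitality_def K_def)
  moreover have "runs find_cut \<sigma> (1000 * (n + m)) 1 \<sigma>5"
    unfolding find_cut_def
    by (rule runs_mono[OF runs_Seq[OF \<sigma>1(1) runs_Seq[OF \<sigma>2(1) runs_Seq[OF \<sigma>3 runs_Seq[OF \<sigma>4(1) \<sigma>5(1)]]]]])
      (use n_ge_2 m_pos in auto)
  ultimately show ?thesis
    using K \<sigma>5(2,3) by (intro exI[of _ \<sigma>5] exI[of _ K] conjI)
qed

end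

section \<open>Ancestor trees of minimum cuts\<close>

text \<open>
  The construction of Cheng and Hu for an arbitrary family \<open>\<D>\<close> of cuts with values \<open>cap\<close>. The seeds
  are \<open>{..<x}\<close>, every vertex \<open>z\<close> is in the leaf of the seed \<open>leaf z\<close>, and the cut \<open>K (N a b)\<close> at the
  lowest common ancestor of the leaves of \<open>a\<close> and \<open>b\<close> is a minimum cut separating them. The last clause
  says that the values increase from the root to the leaves.
\<close>

definition separates :: "'a set \<Rightarrow> 'a \<Rightarrow> 'a \<Rightarrow> bool" where
  "separates D a b \<longleftrightarrow> (a \<in> D) \<noteq> (b \<in> D)"

definition cut_tree :: "nat set set \<Rightarrow> (nat set \<Rightarrow> real) \<Rightarrow> nat \<Rightarrow> nat \<Rightarrow> (nat \<Rightarrow> nat) \<Rightarrow> (nat \<Rightarrow> nat \<Rightarrow> nat) \<Rightarrow>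
    (nat \<Rightarrow> nat set) \<Rightarrow> bool" where
  "cut_tree \<D> cap n x leaf N K \<longleftrightarrow>
     (\<forall>z<n. leaf z < x) \<and> (\<forall>a<x. leaf a = a) \<and> (\<forall>j. 0 < j \<longrightarrow> j < x \<longrightarrow> K j \<in> \<D>) \<and>
     (\<forall>a<x. \<forall>b<x. a \<noteq> b \<longrightarrow> N a b = N b a \<and> 0 < N a b \<and> N a b < x) \<and>
     (\<forall>a<x. \<forall>b<x. a \<noteq> b \<longrightarrow> (\<forall>D\<in>\<D>. separates D a b \<longrightarrow> cap (K (N a b)) \<le> cap D)) \<and>
     (\<forall>z<n. \<forall>z'<n. leaf z \<noteq> leaf z' \<longrightarrow> separates (K (N (leaf z) (leaf z'))) z z') \<and>
     (\<forall>a<x. \<forall>b<x. \<forall>d<x. a \<noteq> b \<longrightarrow> a \<noteq> d \<longrightarrow> b \<noteq> d \<longrightarrow>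
        cap (K (N a b)) < cap (K (N a d)) \<longrightarrow> N a b = N d b)"

lemma cut_treeD:
  assumes "cut_tree \<D> cap n x leaf N K"
  shows "z < n \<Longrightarrow> leaf z < x" "a < x \<Longrightarrow> leaf a = a" "0 < j \<Longrightarrow> j < x \<Longrightarrow> K j \<in> \<D>"
    "a < x \<Longrightarrow> b < x \<Longrightarrow> a \<noteq> b \<Longrightarrow> N a b = N b a"
    "a < x \<Longrightarrow> b < x \<Longrightarrow> a \<noteq> b \<Longrightarrow> 0 < N a b"
    "a < x \<Longrightarrow> b < x \<Longrightarrow> a \<noteq> b \<Longrightarrow> N a b < x"
    "a < x \<Longrightarrow> b < x \<Longrightarrow> a \<noteq> b \<Longrightarrow> D \<in> \<D> \<Longrightarrow> separates D a b \<Longrightarrow> cap (K (N a b)) \<le> cap D"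
    "z < n \<Longrightarrow> z' < n \<Longrightarrow> leaf z \<noteq> leaf z' \<Longrightarrow> separates (K (N (leaf z) (leaf z'))) z z'"
    "a < x \<Longrightarrow> b < x \<Longrightarrow> d < x \<Longrightarrow> a \<noteq> b \<Longrightarrow> a \<noteq> d \<Longrightarrow> b \<noteq> d \<Longrightarrow>
        cap (K (N a b)) < cap (K (N a d)) \<Longrightarrow> N a b = N d b"
proof -
  note c = assms[unfolded cut_tree_def]
  show "z < n \<Longrightarrow> leaf z < x" using c[THEN conjunct1] by blast
  show "a < x \<Longrightarrow> leaf a = a" using c[THEN conjunct2, THEN conjunct1] by blast
  show "0 < j \<Longrightarrow> j < x \<Longrightarrow> K j \<in> \<D>" using c[THEN conjunct2, THEN conjunct2, THEN conjunct1] by blast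
  show "a < x \<Longrightarrow> b < x \<Longrightarrow> a \<noteq> b \<Longrightarrow> N a b = N b a"
    "a < x \<Longrightarrow> b < x \<Longrightarrow> a \<noteq> b \<Longrightarrow> 0 < N a b"
    "a < x \<Longrightarrow> b < x \<Longrightarrow> a \<noteq> b \<Longrightarrow> N a b < x"
    using c[THEN conjunct2, THEN conjunct2, THEN conjunct2, THEN conjunct1] by blast+
  show "a < x \<Longrightarrow> b < x \<Longrightarrow> a \<noteq> b \<Longrightarrow> D \<in> \<D> \<Longrightarrow> separates D a b \<Longrightarrow> cap (K (N a b)) \<le> cap D"
    using c[THEN conjunct2, THEN conjunct2, THEN conjunct2, THEN conjunct2, THEN conjunct1] by blast
  show "z < n \<Longrightarrow> z' < n \<Longrightarrow> leaf z \<noteq> leaf z' \<Longrightarrow> separates (K (N (leaf z) (leaf z'))) z z'"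
    using c[THEN conjunct2, THEN conjunct2, THEN conjunct2, THEN conjunct2, THEN conjunct2, THEN conjunct1] by blast
  show "a < x \<Longrightarrow> b < x \<Longrightarrow> d < x \<Longrightarrow> a \<noteq> b \<Longrightarrow> a \<noteq> d \<Longrightarrow> b \<noteq> d \<Longrightarrow>
      cap (K (N a b)) < cap (K (N a d)) \<Longrightarrow> N a b = N d b"
    using c[THEN conjunct2, THEN conjunct2, THEN conjunct2, THEN conjunct2, THEN conjunct2, THEN conjunct2] by blast
qed

lemma cut_tree_init:
  assumes "\<And>z. z < n \<Longrightarrow> leaf z = 0" "leaf 0 = 0"
  shows "cut_tree \<D> cap n 1 leaf N K"
  using assms by (auto simp: cut_tree_def)

text \<open>Seed \<open>x\<close> is split off from the leaf of \<open>y\<close>. Values increase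
  along the path from the root to that leaf, and \<open>D\<close> is inserted at its place by value:
  nodes of value at most \<open>cap D\<close> stay above it, the dearer ones end up below it on the
  side of \<open>y\<close>. The new leaf collects the vertices below the new node that lie on the
  side of \<open>x\<close>. So \<open>x\<close> meets an old seed either at the new node or where
  \<open>y\<close> meets it.\<close>

lemma cut_tree_step:
  assumes tree: "cut_tree \<D> cap n x leaf N K" and x: "0 < x" "x < n" and y: "y = leaf x"
    and D: "D \<in> \<D>" "separates D x y" and min: "\<And>D'. D' \<in> \<D> \<Longrightarrow> separates D' x y \<Longrightarrow> cap D \<le> cap D'"
    and leaf': "\<And>z. z < n \<Longrightarrow> leaf' z =
      (if \<not> separates D z x \<and> (leaf z = y \<or> cap D < cap (K (N y (leaf z)))) then x else leaf z)"
    and N': "\<And>b. b < x \<Longrightarrow> N' x b = (if b = y \<or> cap D < cap (K (N y b)) then x else N y b)"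
      "\<And>b. b < x \<Longrightarrow> N' b x = N' x b" "\<And>a b. a < x \<Longrightarrow> b < x \<Longrightarrow> N' a b = N a b"
    and K': "\<And>j. j < x \<Longrightarrow> K' j = K j" "K' x = D"
  shows "cut_tree \<D> cap n (Suc x) leaf' N' K'"
proof -
  note T = cut_treeD[OF tree]
  have yx: "y < x" using T(1) x y by blast
  \<comment> \<open>If \<open>D\<close> separated \<open>y\<close> from \<open>b\<close>, it would
    be cheaper than a minimum cut for this pair. Hence no seed below the new node changes
    sides.\<close>
  have eq_side: "\<not> separates D y b" if "b < x" "b \<noteq> y" "cap D < cap (K (N y b))" for b
    using T(7)[OF yx that(1), of D] that D by force
  have idx: "N' a b = N' b a \<and> 0 < N' a b \<and> N' a b \<le> x" if ab: "a \<le> x" "b \<le> x" "a \<noteq> b" for a b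
  proof -
    have new: "0 < N' x b \<and> N' x b \<le> x" if "b < x" for b
      using N'(1)[OF that] T(5)[OF yx that] T(6)[OF yx that] x(1) by (cases "b = y") simp_all
    consider "a < x" "b < x" | "a = x" "b < x" | "b = x" "a < x" using ab by linarith
    then show ?thesis
    proof cases
      case 1
      then show ?thesis using N'(3)[OF 1] N'(3)[OF 1(2,1)] T(4,5,6)[OF 1 ab(3)] by simp
    qed (use new N'(2) in simp_all)
  qed
  have KN: "K' (N' a b) = K (N a b)" if "a < x" "b < x" "a \<noteq> b" for a b
    using N'(3)[OF that(1,2)] K'(1) T(6)[OF that] by simp
  have KNx: "K' (N' x b) = (if b = y \<or> cap D < cap (K (N y b)) then D else K (N y b))" if "b < x" for b
    using N'(1)[OF that] K' T(6)[OF yx that] by auto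
  have moved: "\<not> separates D z x" "leaf z = y \<or> cap D < cap (K (N y (leaf z)))"
    if "z < n" "leaf' z = x" for z
    using leaf'[OF that(1)] that T(1)[OF that(1)] by (auto split: if_splits)
  have unmoved: "leaf' z = leaf z" if "z < n" "leaf' z \<noteq> x" for z
    using leaf'[OF that(1)] that by (auto split: if_splits)
  \<comment> \<open>If \<open>l\<close> lies below the new node, \<open>z'\<close> was not moved
    although it is there, so it lies across \<open>D\<close> from \<open>x\<close>. Otherwise the
    meeting node is old, and the old leaf of \<open>z\<close> must be shown to meet \<open>l\<close>
    at the same node as \<open>y\<close> does.\<close>
  have sep_new: "separates (K' (N' x l)) z z'"
    if z: "z < n" "leaf' z = x" and z': "z' < n" "leaf' z' = l" "l \<noteq> x" for z z' l
  proof -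
    have l: "leaf z' = l" "l < x" using unmoved[OF z'(1)] z' T(1)[OF z'(1)] by auto
    note mv = moved[OF z]
    show ?thesis
    proof (cases "l = y \<or> cap D < cap (K (N y l))")
      case True
      then have "separates D z' x" using leaf'[OF z'(1)] z' l by (auto split: if_splits)
      then show ?thesis using KNx[OF l(2)] True mv(1) by (auto simp: separates_def)
    next
      case False
      have K: "K' (N' x l) = K (N y l)" using KNx[OF l(2)] False by simp
      show ?thesis
      proof (cases "leaf z = y")
        case True
        then show ?thesis unfolding K using T(8)[OF z(1) z'(1)] l False by auto
      next
        case neq: False
        then have lt: "cap (K (N y l)) < cap (K (N y (leaf z)))" using mv False by auto
        then have ne: "leaf z \<noteq> l" by auto
        \<comment> \<open>The old leaf of \<open>z\<close> meets \<open>y\<close> below the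
          insertion point and \<open>l\<close> meets \<open>y\<close> above it, so monotonicity
          along the path identifies the two meeting nodes.\<close>
        have "N y l = N (leaf z) l"
          using T(9)[OF yx l(2) T(1)[OF z(1)]] lt ne neq False by auto
        then show ?thesis unfolding K using T(8)[OF z(1) z'(1)] l ne by auto
      qed
    qed
  qed
  have sym: "separates E u v \<longleftrightarrow> separates E v u" for E and u v :: nat by (auto simp: separates_def)
  have tri: "separates E u w \<Longrightarrow> separates E u v \<or> separates E v w" for E and u v w :: nat
    by (auto simp: separates_def)
  \<comment> \<open>A cut separating \<open>x\<close> from \<open>b\<close> separates
    \<open>x\<close> from \<open>y\<close> or \<open>y\<close> from \<open>b\<close>. The first kind
    costs at least \<open>cap D\<close>, the second at least the old node, and for
    \<open>b \<noteq> y\<close> the node assigned to \<open>x\<close> and \<open>b\<close> is the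
    cheaper of the two.\<close>
  have lower_new: "cap (K' (N' x b)) \<le> cap E" if b: "b < x" "E \<in> \<D>" "separates E x b" for b E
  proof (cases "b = y")
    case True
    then show ?thesis using KNx[OF b(1)] min b by simp
  next
    case False
    consider "separates E x y" | "separates E y b" using tri[OF b(3)] by blast
    then show ?thesis
    proof cases
      case 1
      then show ?thesis using min[OF b(2)] KNx[OF b(1)] by (auto split: if_splits)
    next
      case 2
      then show ?thesis using T(7)[OF yx b(1) _ b(2)] KNx[OF b(1)] False by (auto split: if_splits)
    qed
  qed
  show ?thesis unfolding cut_tree_def
  proof (intro conjI allI impI ballI)
    show "leaf' z < Suc x" if "z < n" for z
      using leaf'[OF that] T(1)[OF that] by auto
    show "leaf' a = a" if "a < Suc x" for a
    proof (cases "a = x")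
      case True
      then show ?thesis using leaf'[OF x(2)] y by (simp add: separates_def)
    next
      case False
      then have a: "a < x" "a < n" "leaf a = a" using that x T(2) by auto
      \<comment> \<open>An old seed keeps its leaf: below the new node it lies with
        \<open>y\<close>, hence across \<open>D\<close> from \<open>x\<close>.\<close>
      have "separates D a x" if "a = y \<or> cap D < cap (K (N y a))"
      proof (cases "a = y")
        case True
        then show ?thesis using D by (simp add: sym)
      next
        case False
        then show ?thesis using eq_side[OF a(1) False] that D(2) by (auto simp: separates_def)
      qed
      then show ?thesis using leaf'[OF a(2)] a(3) by auto
    qed
    show "K' j \<in> \<D>" if "0 < j" "j < Suc x" for j
      using that K' D(1) T(3) by (cases "j = x") auto
    show "N' a b = N' b a" "0 < N' a b" "N' a b < Suc x" if "a < Suc x" "b < Suc x" "a \<noteq> b" for a b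
      using idx[of a b] that by auto
    show "cap (K' (N' a b)) \<le> cap E"
      if ab: "a < Suc x" "b < Suc x" "a \<noteq> b" "E \<in> \<D>" "separates E a b" for a b E
    proof -
      consider "a < x" "b < x" | "a = x" "b < x" | "b = x" "a < x" using ab(1-3) by linarith
      then show ?thesis
      proof cases
        case 1
        then show ?thesis using KN[OF 1 ab(3)] T(7)[OF 1 ab(3-5)] by simp
      next
        case 2
        then show ?thesis using lower_new ab by simp
      next
        case 3
        then show ?thesis using lower_new[of a E] ab N'(2)[of a] by (simp add: sym)
      qed
    qed
    show "separates (K' (N' (leaf' z) (leaf' z'))) z z'"
      if z: "z < n" "z' < n" "leaf' z \<noteq> leaf' z'" for z z'
    proof -
      consider "leaf' z = x" "leaf' z' \<noteq> x" | "leaf' z' = x" "leaf' z \<noteq> x" | "leaf' z \<noteq> x" "leaf' z' \<noteq> x"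
        using z(3) by auto
      then show ?thesis
      proof cases
        case 1
        then show ?thesis using sep_new z by simp
      next
        case 2
        have "leaf' z < x" using unmoved[OF z(1) 2(2)] T(1)[OF z(1)] by simp
        then show ?thesis using sep_new[OF z(2) 2(1) z(1) refl 2(2)] 2 N'(2) by (simp add: sym)
      next
        case 3
        have eq: "leaf' z = leaf z" "leaf' z' = leaf z'" using unmoved z 3 by auto
        then have ne: "leaf z \<noteq> leaf z'" using z(3) by simp
        show ?thesis
          unfolding eq KN[OF T(1)[OF z(1)] T(1)[OF z(2)] ne] by (rule T(8)[OF z(1,2) ne])
      qed
    qed
    show "N' a b = N' d b"
      if le: "a < Suc x" "b < Suc x" "d < Suc x" and ne: "a \<noteq> b" "a \<noteq> d" "b \<noteq> d"
        and lt: "cap (K' (N' a b)) < cap (K' (N' a d))" for a b d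
    proof -
      \<comment> \<open>Above the new node seed \<open>x\<close> behaves like \<open>y\<close>. Each
        position of \<open>x\<close> in the triple therefore reduces to the old clause with
        \<open>y\<close> in its place, after comparing the values involved with
        \<open>cap D\<close>.\<close>
      consider "a < x" "b < x" "d < x" | "a = x" "b < x" "d < x" | "d = x" "a < x" "b < x"
        | "b = x" "a < x" "d < x" using le ne by linarith
      then show ?thesis
      proof cases
        case 1
        then show ?thesis using T(9)[OF 1 ne] lt N'(3) KN ne by simp
      next
        case 2
        have b: "b \<noteq> y" "cap (K (N y b)) < cap (K' (N' x d))" "\<not> cap D < cap (K (N y b))"
          using lt 2 KNx[OF 2(2)] KNx[OF 2(3)] by (auto split: if_splits)
        have "N y b = N d b"
        proof (cases "d = y")
          case False
          then have "cap (K (N y b)) < cap (K (N y d))" using b(2) KNx[OF 2(3)] by (auto split: if_splits)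
          then show ?thesis using T(9)[OF yx 2(2,3)] b(1) False ne(3) by auto
        qed simp
        then show ?thesis using N'(1)[OF 2(2)] N'(3)[OF 2(3,2)] b 2 by simp
      next
        case 3
        have lt': "cap (K (N a b)) < cap (K' (N' x a))"
          using lt 3 KN[OF 3(2,3) ne(1)] N'(2)[OF 3(2)] by simp
        show ?thesis
        proof (cases "a = y")
          case True
          then have "cap (K (N y b)) < cap D" using lt' KNx[OF 3(2)] by simp
          then show ?thesis using N'(1)[OF 3(3)] N'(3)[OF 3(2,3)] True ne 3 by simp
        next
          case False
          have *: "cap (K (N a b)) < cap (K (N a y))" "cap (K (N a b)) < cap D"
            using lt' KNx[OF 3(2)] False T(4)[OF yx 3(2)] by (auto split: if_splits)
          then have "b \<noteq> y" by auto
          then have "N a b = N y b" using T(9)[OF 3(2,3) yx ne(1) False] *(1) by auto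
          then show ?thesis using N'(1)[OF 3(3)] N'(3)[OF 3(2,3)] \<open>b \<noteq> y\<close> *(2) 3 by simp
        qed
      next
        case 4
        have lt': "cap (K' (N' x a)) < cap (K (N a d))"
          using lt 4 KN[OF 4(2,3) ne(2)] N'(2)[OF 4(2)] by simp
        have "N' x a = N' x d"
        proof (cases "a = y \<or> cap D < cap (K (N y a))")
          case True
          then have "cap D < cap (K (N a d))" using lt' KNx[OF 4(2)] by simp
          moreover have "cap D < cap (K (N y d))" if "a \<noteq> y" "d \<noteq> y"
          proof (rule ccontr)
            assume *: "\<not> cap D < cap (K (N y d))"
            then have "N y d = N a d" using T(9)[OF yx 4(3,2)] True that ne by auto
            then show False using * \<open>cap D < cap (K (N a d))\<close> by simp
          qed
          ultimately have "d = y \<or> cap D < cap (K (N y d))" using True by auto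
          then show ?thesis using N'(1)[OF 4(2)] N'(1)[OF 4(3)] True by simp
        next
          case False
          then have *: "cap (K (N a y)) < cap (K (N a d))"
            using lt' KNx[OF 4(2)] T(4)[OF yx 4(2)] by auto
          then have "d \<noteq> y" by auto
          then have "N a y = N d y" using T(9)[OF 4(2) yx 4(3)] False ne * by auto
          then have "N y a = N y d" using T(4)[OF yx 4(2)] T(4)[OF yx 4(3)] False \<open>d \<noteq> y\<close> by auto
          then show ?thesis using N'(1)[OF 4(2)] N'(1)[OF 4(3)] False \<open>d \<noteq> y\<close> by simp
        qed
        then show ?thesis using 4 N'(2) by simp
      qed
    qed
  qed
qed

text \<open>When all vertices are seeds, each is its own leaf, so the clauses on seeds speak about
  all pairs of vertices.\<close>

lemma cut_tree_done:
  assumes "cut_tree \<D> cap n n leaf N K" "u < n" "v < n" "u \<noteq> v"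
  shows "\<exists>j. 0 < j \<and> j < n \<and> separates (K j) u v \<and> (\<forall>D\<in>\<D>. separates D u v \<longrightarrow> cap (K j) \<le> cap D)"
proof -
  note T = cut_treeD[OF assms(1)]
  show ?thesis
    by (rule exI[of _ "N u v"]) (use T(2,5,6,7)[of u] T(8)[of u v] T(2)[of v] assms(2-4) in auto)
qed

section \<open>The construction of the ancestor tree as a program\<close>

definition store_vertex_side :: com where
  "store_vertex_side =
     Cond (NLess (NConst 0) (N1 ''vis'' (N0 ''j'')))
     (NAssign ''side'' (N0 ''x'') (N0 ''j'') (NConst 1))
     (NAssign ''side'' (N0 ''x'') (N0 ''j'') (NConst 0))"

definition store_side :: com where
  "store_side = For ''j'' ''n'' store_vertex_side"

definition try_cut :: com where
  "try_cut = If_then (BAnd (BNot (NEq (N0 ''a'') (N0 ''t''))) (BNot (NEq (N0 ''b'') (N0 ''s''))))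
     (find_cut ;;
      If_then (RLess (R0 ''cw'') (R1 ''fv'' (N0 ''x'')))
        (RSet1 ''fv'' (N0 ''x'') (R0 ''cw'') ;; store_side))"

text \<open>A flow computation handles one orientation of the pair only, so both are tried, starting
  from \<open>big\<close> as an infinite value. This is where two flows per seed are spent.\<close>

definition separate_pair :: com where
  "separate_pair =
     (RSet1 ''fv'' (N0 ''x'') (R0 ''big'') ;; NSet ''a'' (N0 ''x'') ;; NSet ''b'' (N0 ''y'')) ;;
     try_cut ;;
     (NSet ''a'' (N0 ''y'') ;; NSet ''b'' (N0 ''x'')) ;;
     try_cut"

definition update_lca_entry :: com where
  "update_lca_entry =
     NSet ''u'' (NCell ''N'' (N0 ''y'') (N0 ''z'')) ;;
     If_then (BOr (NEq (N0 ''z'') (N0 ''y'')) (RLess (R1 ''fv'' (N0 ''x'')) (R1 ''fv'' (N0 ''u''))))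
       (NSet ''u'' (N0 ''x'')) ;;
     NAssign ''N'' (N0 ''x'') (N0 ''z'') (N0 ''u'') ;;
     NAssign ''N'' (N0 ''z'') (N0 ''x'') (N0 ''u'')"

definition update_lca :: com where
  "update_lca = For ''z'' ''x'' update_lca_entry"

definition update_leaf_entry :: com where
  "update_leaf_entry =
     NSet ''u'' (N1 ''leaf'' (N0 ''z'')) ;;
     If_then (BAnd
         (NEq (NCell ''side'' (N0 ''x'') (N0 ''z'')) (NCell ''side'' (N0 ''x'') (N0 ''x'')))
         (BOr (NEq (N0 ''u'') (N0 ''y''))
            (RLess (R1 ''fv'' (N0 ''x'')) (R1 ''fv'' (NCell ''N'' (N0 ''y'') (N0 ''u''))))))
       (NSet1 ''leaf'' (N0 ''z'') (N0 ''x''))"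

definition update_leaf :: com where
  "update_leaf = For ''z'' ''n'' update_leaf_entry"

text \<open>The guard skips the first round, because vertex 0 is the seed of the initial one-leaf
  tree.\<close>

definition tree_step :: com where
  "tree_step = If_then (NLess (NConst 0) (N0 ''x''))
     (NSet ''y'' (N1 ''leaf'' (N0 ''x'')) ;; separate_pair ;; update_lca ;; update_leaf)"

definition build_tree :: com where
  "build_tree = For ''x'' ''n'' tree_step"

lemma writes_try_cut [simp]:
  "nat_writes try_cut = {''j'', ''side''} \<union> nat_writes find_cut"
  "real_writes try_cut = {''fv''} \<union> real_writes find_cut"
  by (auto simp: try_cut_def store_side_def store_vertex_side_def simp del: writes_find_cut)

lemma writes_tree_step [simp]:
  "nat_writes tree_step = {''y'', ''z'', ''u'', ''a'', ''b'', ''j'', ''side'', ''N'', ''leaf''} \<union> nat_writes find_cut"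
  "real_writes tree_step = {''fv''} \<union> real_writes find_cut"
  by (auto simp: tree_step_def separate_pair_def update_lca_def update_lca_entry_def update_leaf_def update_leaf_entry_def simp del: writes_find_cut)

lemma writes_build_tree [simp]:
  "nat_writes build_tree = insert ''x'' (nat_writes tree_step)" "real_writes build_tree = real_writes tree_step"
  by (simp_all only: build_tree_def writes_For)

section \<open>Correctness of the tree construction\<close>

context vitality_program
begin

definition recorded :: "memory \<Rightarrow> nat set \<Rightarrow> bool" where
  "recorded \<sigma> K \<longleftrightarrow> (\<forall>e\<in>leaving G K.
     mincut_capacity G c s t + c e - cut_capacity G c K \<le> real1 \<sigma> ''vt'' e)"

definition sound :: "memory \<Rightarrow> bool" where
  "sound \<sigma> \<longleftrightarrow> (\<forall>e<m. 0 \<le> real1 \<sigma> ''vt'' e \<and> real1 \<sigma> ''vt'' e \<le> vitality G c s t e)"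

text \<open>Facts of the form "this cut has been taken into account" are lower bounds on
  \<open>vt\<close>, so they survive every later phase by monotonicity.\<close>

definition grows :: "memory \<Rightarrow> memory \<Rightarrow> bool" where
  "grows \<sigma> \<sigma>' \<longleftrightarrow> (\<forall>e<m. real1 \<sigma> ''vt'' e \<le> real1 \<sigma>' ''vt'' e)"

definition stored :: "memory \<Rightarrow> nat \<Rightarrow> nat set \<Rightarrow> bool" where
  "stored \<sigma> x K \<longleftrightarrow> st_cut G s t K \<and> real1 \<sigma> ''fv'' x = cut_capacity G c K \<and>
     (\<forall>v<n. nats \<sigma> ''side'' x v = (if v \<in> K then 1 else 0)) \<and> recorded \<sigma> K"

lemma grows_trans: "grows \<sigma> \<sigma>' \<Longrightarrow> grows \<sigma>' \<sigma>'' \<Longrightarrow> grows \<sigma> \<sigma>''"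
  unfolding grows_def by (meson order_trans)

lemma grows_same: "reals \<sigma>' ''vt'' = reals \<sigma> ''vt'' \<Longrightarrow> grows \<sigma> \<sigma>'"
  by (simp add: grows_def)

lemma recorded_grows: "recorded \<sigma> K \<Longrightarrow> grows \<sigma> \<sigma>' \<Longrightarrow> recorded \<sigma>' K"
  unfolding recorded_def grows_def leaving_def arcs_eq by fastforce

lemma sound_same: "sound \<sigma> \<Longrightarrow> reals \<sigma>' ''vt'' = reals \<sigma> ''vt'' \<Longrightarrow> sound \<sigma>'"
  by (simp add: sound_def)

lemma stored_grows:
  "stored \<sigma> x K \<Longrightarrow> grows \<sigma> \<sigma>' \<Longrightarrow> real1 \<sigma>' ''fv'' x = real1 \<sigma> ''fv'' x \<Longrightarrow>
     nats \<sigma>' ''side'' x = nats \<sigma> ''side'' x \<Longrightarrow> stored \<sigma>' x K"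
  unfolding stored_def using recorded_grows[of \<sigma> K \<sigma>'] by simp

text \<open>By \<open>vitality_ge\<close> the update is admissible whichever terminals the cut was
  computed for.\<close>

lemma runs_find_cut_sound:
  assumes "ready \<sigma>" "sound \<sigma>" and ab: "nat0 \<sigma> ''a'' = a" "nat0 \<sigma> ''b'' = b"
    "a < n" "b < n" "a \<noteq> b" "a \<noteq> t" "b \<noteq> s"
  shows "\<exists>\<sigma>' K. runs find_cut \<sigma> (1000 * (n + m)) 1 \<sigma>' \<and> st_cut G s t K \<and> a \<in> K \<and> b \<notin> K \<and>
    (\<forall>D. st_cut G s t D \<longrightarrow> a \<in> D \<longrightarrow> b \<notin> D \<longrightarrow> cut_capacity G c K \<le> cut_capacity G c D) \<and>
    K = {v. v < n \<and> nat1 \<sigma>' ''vis'' v \<noteq> 0} \<and> real0 \<sigma>' ''cw'' = cut_capacity G c K \<and>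
    sound \<sigma>' \<and> grows \<sigma> \<sigma>' \<and> recorded \<sigma>' K"
proof -
  obtain \<sigma>' K where *: "runs find_cut \<sigma> (1000 * (n + m)) 1 \<sigma>'" "st_cut G s t K" "a \<in> K" "b \<notin> K"
    "\<forall>D. st_cut G s t D \<longrightarrow> a \<in> D \<longrightarrow> b \<notin> D \<longrightarrow> cut_capacity G c K \<le> cut_capacity G c D"
    "K = {v. v < n \<and> nat1 \<sigma>' ''vis'' v \<noteq> 0}" "real0 \<sigma>' ''cw'' = cut_capacity G c K"
    and vt: "\<forall>e<m. real1 \<sigma>' ''vt'' e = (if e \<in> leaving G K
       then max (real1 \<sigma> ''vt'' e) (mincut_capacity G c s t + c e - cut_capacity G c K)
       else real1 \<sigma> ''vt'' e)"
    using runs_find_cut[OF assms(1) ab] by (elim exE conjE)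
  have "sound \<sigma>'"
    unfolding sound_def
  proof (intro allI impI)
    fix e assume e: "e < m"
    have "0 \<le> real1 \<sigma> ''vt'' e" "real1 \<sigma> ''vt'' e \<le> vitality G c s t e"
      using assms(2) e by (simp_all add: sound_def)
    then show "0 \<le> real1 \<sigma>' ''vt'' e \<and> real1 \<sigma>' ''vt'' e \<le> vitality G c s t e"
      using vt[rule_format, OF e] vitality_ge[OF *(2), of e] by (auto simp: max_def)
  qed
  moreover have "grows \<sigma> \<sigma>'" using vt by (simp add: grows_def)
  moreover have "recorded \<sigma>' K"
    unfolding recorded_def
  proof
    fix e assume e: "e \<in> leaving G K"
    then have "e < m" by (simp add: leaving_def arcs_eq)
    then show "mincut_capacity G c s t + c e - cut_capacity G c K \<le> real1 \<sigma>' ''vt'' e"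
      using vt e by simp
  qed
  ultimately show ?thesis using * by (intro exI[of _ \<sigma>'] exI[of _ K] conjI)
qed

lemma runs_store_side:
  assumes "nat0 \<sigma> ''n'' = n" "nat0 \<sigma> ''x'' = x"
  shows "\<exists>\<sigma>'. runs store_side \<sigma> (4 * n + 2) 0 \<sigma>' \<and>
    (\<forall>j v. nats \<sigma>' ''side'' j v = (if j = x \<and> v < n then if nat1 \<sigma> ''vis'' v \<noteq> 0 then 1 else 0 else nats \<sigma> ''side'' j v))"
proof -
  have "\<exists>\<sigma>'. runs (For ''j'' ''n'' store_vertex_side) \<sigma> (n * (cost store_vertex_side + 2) + 2) 0 \<sigma>' \<and>
    (\<forall>j v. nats \<sigma>' ''side'' j v = (if j = x \<and> v < n then if nat1 \<sigma> ''vis'' v \<noteq> 0 then 1 else 0 else nats \<sigma> ''side'' j v))"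
  proof (rule runs_For_straight, goal_cases)
    case (7 k \<rho>)
    have "nats \<rho> ''vis'' = nats \<sigma> ''vis''" "nat0 \<rho> ''x'' = x"
      using 7(4) assms by (simp_all add: frame_def store_vertex_side_def)
    then show ?case using 7 by (auto simp: store_vertex_side_def less_Suc_eq)
  qed (use assms in \<open>auto simp: store_vertex_side_def\<close>)
  moreover have "n * (cost store_vertex_side + 2) + 2 = 4 * n + 2" by (simp add: store_vertex_side_def)
  ultimately show ?thesis unfolding store_side_def by metis
qed

text \<open>Either row \<open>x\<close> now describes a separating cut or it is unchanged. This lets
  the caller conclude that a cut is stored as soon as the value has dropped below
  \<open>big\<close>. An orientation excluded by the guard admits no cut at all.\<close>

lemma runs_try_cut:
  assumes r: "ready \<sigma>" "sound \<sigma>" and ab: "nat0 \<sigma> ''a'' = a" "nat0 \<sigma> ''b'' = b"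
    "a < n" "b < n" "a \<noteq> b" and x: "nat0 \<sigma> ''x'' = x"
  shows "\<exists>\<sigma>'. runs try_cut \<sigma> (1000 * (n + m) + 4 * n + 10) 1 \<sigma>' \<and> sound \<sigma>' \<and> grows \<sigma> \<sigma>' \<and>
    real1 \<sigma>' ''fv'' x \<le> real1 \<sigma> ''fv'' x \<and>
    (\<forall>D. st_cut G s t D \<longrightarrow> a \<in> D \<longrightarrow> b \<notin> D \<longrightarrow> real1 \<sigma>' ''fv'' x \<le> cut_capacity G c D) \<and>
    ((\<exists>K. stored \<sigma>' x K \<and> separates K a b) \<or>
       real1 \<sigma>' ''fv'' x = real1 \<sigma> ''fv'' x \<and> nats \<sigma>' ''side'' x = nats \<sigma> ''side'' x) \<and>
    (\<forall>j. j \<noteq> x \<longrightarrow> real1 \<sigma>' ''fv'' j = real1 \<sigma> ''fv'' j \<and> nats \<sigma>' ''side'' j = nats \<sigma> ''side'' j)"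
proof -
  let ?b = "BAnd (BNot (NEq (N0 ''a'') (N0 ''t''))) (BNot (NEq (N0 ''b'') (N0 ''s'')))"
  let ?P = "find_cut ;; If_then (RLess (R0 ''cw'') (R1 ''fv'' (N0 ''x'')))
        (RSet1 ''fv'' (N0 ''x'') (R0 ''cw'') ;; store_side)"
  have st: "nat0 \<sigma> ''s'' = s" "nat0 \<sigma> ''t'' = t" using r by (auto simp: ready_def input_stored_def)
  have b: "bval ?b \<sigma> \<longleftrightarrow> a \<noteq> t \<and> b \<noteq> s" using ab st by auto
  show ?thesis
  proof (cases "a \<noteq> t \<and> b \<noteq> s")
    case False
    have "runs try_cut \<sigma> (1 + 1) 0 \<sigma>"
      unfolding try_cut_def using b False runs_Skip by (intro runs_Cond) auto
    then have "runs try_cut \<sigma> (1000 * (n + m) + 4 * n + 10) 1 \<sigma>" by (rule runs_mono) auto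
    moreover have "\<not> (st_cut G s t D \<and> a \<in> D \<and> b \<notin> D)" for D using False by (auto simp: st_cut_def)
    ultimately show ?thesis using r(2) grows_same[of \<sigma> \<sigma>] by (intro exI[of _ \<sigma>]) blast
  next
    case True
    obtain \<sigma>1 K where \<sigma>1: "runs find_cut \<sigma> (1000 * (n + m)) 1 \<sigma>1" and K: "st_cut G s t K" "a \<in> K" "b \<notin> K"
      "\<forall>D. st_cut G s t D \<longrightarrow> a \<in> D \<longrightarrow> b \<notin> D \<longrightarrow> cut_capacity G c K \<le> cut_capacity G c D"
      "K = {v. v < n \<and> nat1 \<sigma>1 ''vis'' v \<noteq> 0}" "real0 \<sigma>1 ''cw'' = cut_capacity G c K"
      and s1: "sound \<sigma>1" "grows \<sigma> \<sigma>1" "recorded \<sigma>1 K"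
      using runs_find_cut_sound[OF r ab True[THEN conjunct1] True[THEN conjunct2]] by (elim exE conjE)
    have f1: "real1 \<sigma>1 ''fv'' = real1 \<sigma> ''fv''" "nats \<sigma>1 ''side'' = nats \<sigma> ''side''" "nat0 \<sigma>1 ''x'' = x"
      "nat0 \<sigma>1 ''n'' = n"
      using runs_frame[OF \<sigma>1(1)] x r by (simp_all add: frame_def ready_def input_stored_def)
    let ?\<sigma>2 = "rwrite ''fv'' x 0 (cut_capacity G c K) \<sigma>1"
    have r2: "runs (RSet1 ''fv'' (N0 ''x'') (R0 ''cw'')) \<sigma>1 1 0 ?\<sigma>2"
      using runs_effect[of "RSet1 ''fv'' (N0 ''x'') (R0 ''cw'')" \<sigma>1] f1 K(6) by simp
    obtain \<sigma>3 where \<sigma>3: "runs store_side ?\<sigma>2 (4 * n + 2) 0 \<sigma>3"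
      "\<forall>j v. nats \<sigma>3 ''side'' j v = (if j = x \<and> v < n then if nat1 \<sigma>1 ''vis'' v \<noteq> 0 then 1 else 0 else nats \<sigma>1 ''side'' j v)"
      using runs_store_side[of ?\<sigma>2 x] f1 by auto
    have f3: "reals \<sigma>3 = reals ?\<sigma>2" using runs_frame[OF \<sigma>3(1)] by (auto simp: frame_def store_side_def store_vertex_side_def)
    have s3: "sound \<sigma>3" "grows \<sigma>1 \<sigma>3" "recorded \<sigma>3 K"
      using s1 f3 recorded_grows[of \<sigma>1 K \<sigma>3] by (auto simp: sound_same grows_same)
    have st3: "stored \<sigma>3 x K"
      unfolding stored_def using K(1,5) s3(3) \<sigma>3(2) f3 by auto
    define \<sigma>' where "\<sigma>' = (if cut_capacity G c K < real1 \<sigma> ''fv'' x then \<sigma>3 else \<sigma>1)"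
    have "runs (RSet1 ''fv'' (N0 ''x'') (R0 ''cw'') ;; store_side) \<sigma>1 (4 * n + 4) 0 \<sigma>3"
      using runs_Seq[OF r2 \<sigma>3(1)] by (rule runs_mono) auto
    moreover have "runs Skip \<sigma>1 (4 * n + 4) 0 \<sigma>1"
      by (rule runs_mono[OF runs_Skip]) auto
    ultimately have "runs (If_then (RLess (R0 ''cw'') (R1 ''fv'' (N0 ''x'')))
        (RSet1 ''fv'' (N0 ''x'') (R0 ''cw'') ;; store_side)) \<sigma>1 (4 * n + 4 + 1) 0 \<sigma>'"
      using f1(3) K(6) fun_cong[OF f1(1), of x] by (intro runs_Cond) (auto simp: \<sigma>'_def)
    then have P: "runs ?P \<sigma> (1000 * (n + m) + (4 * n + 4 + 1)) (1 + 0) \<sigma>'"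
      using runs_Seq[OF \<sigma>1] by blast
    have "runs try_cut \<sigma> (1000 * (n + m) + (4 * n + 4 + 1) + 1) (1 + 0) \<sigma>'"
      unfolding try_cut_def using b True P by (intro runs_Cond) auto
    then have run: "runs try_cut \<sigma> (1000 * (n + m) + 4 * n + 10) 1 \<sigma>'" by (rule runs_mono) auto
    have fv3: "real1 \<sigma>3 ''fv'' j = (if j = x then cut_capacity G c K else real1 \<sigma> ''fv'' j)" for j
      using f3 fun_cong[OF f1(1), of j] by simp
    have fv': "real1 \<sigma>' ''fv'' x = min (cut_capacity G c K) (real1 \<sigma> ''fv'' x)"
      using fv3[of x] fun_cong[OF f1(1), of x] by (auto simp: \<sigma>'_def)
    show ?thesis
    proof (intro exI[of _ \<sigma>'] conjI)
      show "sound \<sigma>'" "grows \<sigma> \<sigma>'"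
        using s1 s3 grows_trans[of \<sigma> \<sigma>1 \<sigma>3] by (auto simp: \<sigma>'_def)
      show "real1 \<sigma>' ''fv'' x \<le> real1 \<sigma> ''fv'' x" unfolding fv' by simp
      show "\<forall>D. st_cut G s t D \<longrightarrow> a \<in> D \<longrightarrow> b \<notin> D \<longrightarrow> real1 \<sigma>' ''fv'' x \<le> cut_capacity G c D"
        unfolding fv' using K(4) by (simp add: min_le_iff_disj)
      show "(\<exists>K. stored \<sigma>' x K \<and> separates K a b) \<or>
          real1 \<sigma>' ''fv'' x = real1 \<sigma> ''fv'' x \<and> nats \<sigma>' ''side'' x = nats \<sigma> ''side'' x"
      proof (cases "cut_capacity G c K < real1 \<sigma> ''fv'' x")
        case True
        then show ?thesis using st3 K(2,3) by (auto simp: \<sigma>'_def separates_def)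
      next
        case False
        then show ?thesis using f1(2) fun_cong[OF f1(1), of x] by (simp add: \<sigma>'_def)
      qed
      show "\<forall>j. j \<noteq> x \<longrightarrow> real1 \<sigma>' ''fv'' j = real1 \<sigma> ''fv'' j \<and> nats \<sigma>' ''side'' j = nats \<sigma> ''side'' j"
      proof (intro allI impI)
        fix j assume j: "j \<noteq> x"
        have "nats \<sigma>3 ''side'' j = nats \<sigma> ''side'' j" using \<sigma>3(2) j f1(2) by (simp add: fun_eq_iff)
        then show "real1 \<sigma>' ''fv'' j = real1 \<sigma> ''fv'' j \<and> nats \<sigma>' ''side'' j = nats \<sigma> ''side'' j"
          using fv3[of j] j f1(2) fun_cong[OF f1(1), of j] by (simp add: \<sigma>'_def)
      qed
    qed (rule run)
  qed
qed

text \<open>One of \<open>{s, u}\<close> and \<open>{s, v}\<close> always qualifies. Its capacity is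
  below \<open>big\<close>, so the initial value in \<open>separate_pair\<close> cannot survive both
  calls.\<close>

lemma separating_cut_exists:
  assumes "u < n" "v < n" "u \<noteq> v"
  obtains D where "st_cut G s t D" "separates D u v" "cut_capacity G c D \<le> sum c (arcs G)"
proof -
  have le: "cut_capacity G c D \<le> sum c (arcs G)" for D
    unfolding cut_capacity_leaving using cap_pos
    by (intro sum_mono2) (auto simp: leaving_def intro: less_imp_le)
  consider "u \<noteq> t" "v \<noteq> s" | "v \<noteq> t" "u \<noteq> s" using st_verts(3) assms(3) by metis
  then show ?thesis
  proof cases
    case 1
    then show ?thesis using that[of "{s, u}"] le assms st_less st_verts(3)
      by (auto simp: st_cut_def separates_def verts_eq)
  next
    case 2
    then show ?thesis using that[of "{s, v}"] le assms st_less st_verts(3)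
      by (auto simp: st_cut_def separates_def verts_eq)
  qed
qed

lemma runs_separate_pair:
  assumes r: "ready \<sigma>" "sound \<sigma>" and xy: "nat0 \<sigma> ''x'' = x" "nat0 \<sigma> ''y'' = y" "x < n" "y < n" "x \<noteq> y"
  shows "\<exists>\<sigma>' K. runs separate_pair \<sigma> (2000 * (n + m) + 8 * n + 30) 2 \<sigma>' \<and> sound \<sigma>' \<and> grows \<sigma> \<sigma>' \<and>
    stored \<sigma>' x K \<and> separates K x y \<and>
    (\<forall>D. st_cut G s t D \<longrightarrow> separates D x y \<longrightarrow> cut_capacity G c K \<le> cut_capacity G c D) \<and>
    (\<forall>j. j \<noteq> x \<longrightarrow> real1 \<sigma>' ''fv'' j = real1 \<sigma> ''fv'' j \<and> nats \<sigma>' ''side'' j = nats \<sigma> ''side'' j)"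
proof -
  let ?P1 = "RSet1 ''fv'' (N0 ''x'') (R0 ''big'') ;; NSet ''a'' (N0 ''x'') ;; NSet ''b'' (N0 ''y'')"
  let ?P2 = "NSet ''a'' (N0 ''y'') ;; NSet ''b'' (N0 ''x'')"
  have big: "sum c (arcs G) < real0 \<sigma> ''big''" using r by (simp add: ready_def)
  define \<sigma>1 where "\<sigma>1 = effect ?P1 \<sigma>"
  have r1: "runs ?P1 \<sigma> 3 0 \<sigma>1" unfolding \<sigma>1_def by (rule runs_mono[OF runs_effect]) simp_all
  have f1: "ready \<sigma>1" "sound \<sigma>1" "grows \<sigma> \<sigma>1"
    using ready_frame[OF runs_frame[OF r1] r(1)] r(2) by (simp_all add: \<sigma>1_def sound_def grows_def)
  have v1: "nat0 \<sigma>1 ''a'' = x" "nat0 \<sigma>1 ''b'' = y" "nat0 \<sigma>1 ''x'' = x" "nat0 \<sigma>1 ''y'' = y"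
    "real1 \<sigma>1 ''fv'' x = real0 \<sigma> ''big''"
    "\<And>j. j \<noteq> x \<Longrightarrow> real1 \<sigma>1 ''fv'' j = real1 \<sigma> ''fv'' j" "nats \<sigma>1 ''side'' = nats \<sigma> ''side''"
    using xy by (simp_all add: \<sigma>1_def)
  obtain \<sigma>2 where \<sigma>2: "runs try_cut \<sigma>1 (1000 * (n + m) + 4 * n + 10) 1 \<sigma>2" "sound \<sigma>2" "grows \<sigma>1 \<sigma>2"
    "real1 \<sigma>2 ''fv'' x \<le> real1 \<sigma>1 ''fv'' x"
    "\<forall>D. st_cut G s t D \<longrightarrow> x \<in> D \<longrightarrow> y \<notin> D \<longrightarrow> real1 \<sigma>2 ''fv'' x \<le> cut_capacity G c D"
    "(\<exists>K. stored \<sigma>2 x K \<and> separates K x y) \<or>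
       real1 \<sigma>2 ''fv'' x = real1 \<sigma>1 ''fv'' x \<and> nats \<sigma>2 ''side'' x = nats \<sigma>1 ''side'' x"
    "\<forall>j. j \<noteq> x \<longrightarrow> real1 \<sigma>2 ''fv'' j = real1 \<sigma>1 ''fv'' j \<and> nats \<sigma>2 ''side'' j = nats \<sigma>1 ''side'' j"
    using runs_try_cut[OF f1(1,2) v1(1,2) xy(3-5) v1(3)] by (elim exE conjE)
  have v2: "nat0 \<sigma>2 ''x'' = x" "nat0 \<sigma>2 ''y'' = y"
    using runs_frame[OF \<sigma>2(1)] v1 by (simp_all add: frame_def)
  define \<sigma>3 where "\<sigma>3 = effect ?P2 \<sigma>2"
  have r3: "runs ?P2 \<sigma>2 2 0 \<sigma>3" unfolding \<sigma>3_def by (rule runs_mono[OF runs_effect]) simp_all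
  have rdy2: "ready \<sigma>2" using ready_frame[OF runs_frame[OF \<sigma>2(1)] f1(1)] by simp
  have f3: "ready \<sigma>3" "sound \<sigma>3" "grows \<sigma>2 \<sigma>3" "nat0 \<sigma>3 ''a'' = y" "nat0 \<sigma>3 ''b'' = x" "nat0 \<sigma>3 ''x'' = x"
    "reals \<sigma>3 = reals \<sigma>2" "nats \<sigma>3 ''side'' = nats \<sigma>2 ''side''"
    using ready_frame[OF runs_frame[OF r3] rdy2] \<sigma>2(2) v2 by (simp_all add: \<sigma>3_def sound_def grows_def)
  obtain \<sigma>4 where \<sigma>4: "runs try_cut \<sigma>3 (1000 * (n + m) + 4 * n + 10) 1 \<sigma>4" "sound \<sigma>4" "grows \<sigma>3 \<sigma>4"
    "real1 \<sigma>4 ''fv'' x \<le> real1 \<sigma>3 ''fv'' x"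
    "\<forall>D. st_cut G s t D \<longrightarrow> y \<in> D \<longrightarrow> x \<notin> D \<longrightarrow> real1 \<sigma>4 ''fv'' x \<le> cut_capacity G c D"
    "(\<exists>K. stored \<sigma>4 x K \<and> separates K y x) \<or>
       real1 \<sigma>4 ''fv'' x = real1 \<sigma>3 ''fv'' x \<and> nats \<sigma>4 ''side'' x = nats \<sigma>3 ''side'' x"
    "\<forall>j. j \<noteq> x \<longrightarrow> real1 \<sigma>4 ''fv'' j = real1 \<sigma>3 ''fv'' j \<and> nats \<sigma>4 ''side'' j = nats \<sigma>3 ''side'' j"
    using runs_try_cut[OF f3(1,2,4,5) xy(4,3) xy(5)[symmetric] f3(6)] by (elim exE conjE)
  have le42: "real1 \<sigma>4 ''fv'' x \<le> real1 \<sigma>2 ''fv'' x" using \<sigma>4(4) f3(7) by simp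
  have min: "real1 \<sigma>4 ''fv'' x \<le> cut_capacity G c D" if "st_cut G s t D" "separates D x y" for D
    using \<sigma>4(5) \<sigma>2(5) le42 that by (force simp: separates_def)
  obtain K where K: "stored \<sigma>4 x K" "separates K x y"
  proof -
    consider K where "stored \<sigma>4 x K" "separates K y x"
      | "real1 \<sigma>4 ''fv'' x = real1 \<sigma>2 ''fv'' x" "nats \<sigma>4 ''side'' x = nats \<sigma>2 ''side'' x"
      using \<sigma>4(6) f3(7,8) by auto
    then show ?thesis
    proof cases
      case 1
      then show ?thesis using that by (auto simp: separates_def)
    next
      case 2
      obtain D where "st_cut G s t D" "separates D x y" "cut_capacity G c D \<le> sum c (arcs G)"
        using separating_cut_exists[OF xy(3-5)] .
      \<comment> \<open>The second call changed nothing. Had the first one changed nothing either,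
        the value would still be \<open>big\<close>, above the capacity of \<open>D\<close>.\<close>
      then have "real1 \<sigma>2 ''fv'' x \<noteq> real1 \<sigma>1 ''fv'' x" using min[of D] 2(1) big v1(5) by auto
      then obtain K where "stored \<sigma>2 x K" "separates K x y" using \<sigma>2(6) by blast
      moreover have "grows \<sigma>2 \<sigma>4" using grows_trans f3(3) \<sigma>4(3) by blast
      ultimately show ?thesis using that[of K] stored_grows[of \<sigma>2 x K \<sigma>4] 2 by simp
    qed
  qed
  have "runs separate_pair \<sigma> (2000 * (n + m) + 8 * n + 30) 2 \<sigma>4"
    unfolding separate_pair_def
    by (rule runs_mono[OF runs_Seq[OF r1 runs_Seq[OF \<sigma>2(1) runs_Seq[OF r3 \<sigma>4(1)]]]]) simp_all
  moreover have "grows \<sigma> \<sigma>4" using grows_trans f1(3) \<sigma>2(3) f3(3) \<sigma>4(3) by blast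
  moreover have "\<forall>D. st_cut G s t D \<longrightarrow> separates D x y \<longrightarrow> cut_capacity G c K \<le> cut_capacity G c D"
    using min K(1) by (simp add: stored_def)
  moreover have "\<forall>j. j \<noteq> x \<longrightarrow> real1 \<sigma>4 ''fv'' j = real1 \<sigma> ''fv'' j \<and> nats \<sigma>4 ''side'' j = nats \<sigma> ''side'' j"
    using \<sigma>4(7) f3(7,8) \<sigma>2(7) v1(6,7) by simp
  ultimately show ?thesis using K \<sigma>4(2) by (intro exI[of _ \<sigma>4] exI[of _ K] conjI)
qed

lemma runs_update_lca:
  assumes "nat0 \<sigma> ''x'' = x" "nat0 \<sigma> ''y'' = y" "y < x"
  defines "h \<equiv> \<lambda>b. if b = y \<or> real1 \<sigma> ''fv'' x < real1 \<sigma> ''fv'' (nats \<sigma> ''N'' y b) then x else nats \<sigma> ''N'' y b"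
  shows "\<exists>\<sigma>'. runs update_lca \<sigma> (7 * x + 2) 0 \<sigma>' \<and> (\<forall>a b. nats \<sigma>' ''N'' a b =
    (if a = x \<and> b < x then h b else if b = x \<and> a < x then h a else nats \<sigma> ''N'' a b))"
proof -
  define Inv where "Inv k \<rho> \<longleftrightarrow> (\<forall>a b. nats \<rho> ''N'' a b =
      (if a = x \<and> b < k then h b else if b = x \<and> a < k then h a else nats \<sigma> ''N'' a b))" for k and \<rho> :: memory
  have "\<exists>\<sigma>'. runs (For ''z'' ''x'' update_lca_entry) \<sigma> (x * (cost update_lca_entry + 2) + 2) 0 \<sigma>' \<and> Inv x \<sigma>'"
  proof (rule runs_For_straight, goal_cases)
    case (7 k \<rho>)
    have f: "nat0 \<rho> ''x'' = x" "nat0 \<rho> ''y'' = y" "reals \<rho> ''fv'' = reals \<sigma> ''fv''"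
      using 7(4) assms by (simp_all add: frame_def update_lca_entry_def)
    \<comment> \<open>Only row and column \<open>x\<close> are written, while \<open>y\<close> and
      \<open>k\<close> are below \<open>x\<close>, so the entry read is still the old one.\<close>
    have k: "k < x" "nat0 \<rho> ''z'' = k" and N: "nats \<rho> ''N'' y k = nats \<sigma> ''N'' y k"
      using 7(1-3) assms(3) by (auto simp: Inv_def)
    define \<rho>' where "\<rho>' = effect (If_then (BOr (NEq (N0 ''z'') (N0 ''y''))
        (RLess (R1 ''fv'' (N0 ''x'')) (R1 ''fv'' (N0 ''u'')))) (NSet ''u'' (N0 ''x'')))
      (effect (NSet ''u'' (NCell ''N'' (N0 ''y'') (N0 ''z''))) \<rho>)"
    have \<rho>': "nat0 \<rho>' ''u'' = h k" "nat0 \<rho>' ''x'' = x" "nat0 \<rho>' ''z'' = k" "nats \<rho>' ''N'' = nats \<rho> ''N''"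
      using f k N by (simp_all add: \<rho>'_def h_def)
    have "effect update_lca_entry \<rho> = effect (NAssign ''N'' (N0 ''x'') (N0 ''z'') (N0 ''u'') ;;
        NAssign ''N'' (N0 ''z'') (N0 ''x'') (N0 ''u'')) \<rho>'"
      by (simp only: update_lca_entry_def \<rho>'_def effect.simps)
    then have "effect update_lca_entry \<rho> = nwrite ''N'' k x (h k) (nwrite ''N'' x k (h k) \<rho>')" by (simp add: \<rho>'(1-3))
    then have eff: "nats (effect update_lca_entry \<rho>) ''N'' a b =
        (if a = k \<and> b = x then h k else if a = x \<and> b = k then h k else nats \<rho> ''N'' a b)" for a b
      by (simp only: nats_nwrite \<rho>'(4))
    have "k \<noteq> x" using k by simp
    have "nats (effect update_lca_entry \<rho>) ''N'' a b =
      (if a = x \<and> b < Suc k then h b else if b = x \<and> a < Suc k then h a else nats \<sigma> ''N'' a b)" for a b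
      unfolding eff 7(2)[unfolded Inv_def, rule_format, of a b]
      using \<open>k \<noteq> x\<close> k(1) by (cases "a = k"; cases "b = k") (simp_all add: less_Suc_eq)
    then show ?case unfolding Inv_def by simp
  qed (use assms in \<open>auto simp: update_lca_entry_def Inv_def\<close>)
  moreover have "x * (cost update_lca_entry + 2) + 2 = 7 * x + 2" by (simp add: update_lca_entry_def)
  ultimately show ?thesis unfolding update_lca_def Inv_def by metis
qed

lemma runs_update_leaf:
  assumes "nat0 \<sigma> ''n'' = n" "nat0 \<sigma> ''x'' = x" "nat0 \<sigma> ''y'' = y"
  shows "\<exists>\<sigma>'. runs update_leaf \<sigma> (5 * n + 2) 0 \<sigma>' \<and> (\<forall>z. nat1 \<sigma>' ''leaf'' z =
    (if z < n then if nats \<sigma> ''side'' x z = nats \<sigma> ''side'' x x \<and>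
         (nat1 \<sigma> ''leaf'' z = y \<or> real1 \<sigma> ''fv'' x < real1 \<sigma> ''fv'' (nats \<sigma> ''N'' y (nat1 \<sigma> ''leaf'' z)))
       then x else nat1 \<sigma> ''leaf'' z else nat1 \<sigma> ''leaf'' z))"
proof -
  define lf where "lf z = (if nats \<sigma> ''side'' x z = nats \<sigma> ''side'' x x \<and>
         (nat1 \<sigma> ''leaf'' z = y \<or> real1 \<sigma> ''fv'' x < real1 \<sigma> ''fv'' (nats \<sigma> ''N'' y (nat1 \<sigma> ''leaf'' z)))
       then x else nat1 \<sigma> ''leaf'' z)" for z
  have "\<exists>\<sigma>'. runs (For ''z'' ''n'' update_leaf_entry) \<sigma> (n * (cost update_leaf_entry + 2) + 2) 0 \<sigma>' \<and>
    (\<forall>z. nat1 \<sigma>' ''leaf'' z = (if z < n then lf z else nat1 \<sigma> ''leaf'' z))"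
  proof (rule runs_For_straight, goal_cases)
    case (7 k \<rho>)
    have f: "nat0 \<rho> ''x'' = x" "nat0 \<rho> ''y'' = y" "reals \<rho> ''fv'' = reals \<sigma> ''fv''"
      "nats \<rho> ''side'' = nats \<sigma> ''side''" "nats \<rho> ''N'' = nats \<sigma> ''N''"
      using 7(4) assms by (simp_all add: frame_def update_leaf_entry_def)
    have k: "k < n" "nat0 \<rho> ''z'' = k" and l: "nat1 \<rho> ''leaf'' k = nat1 \<sigma> ''leaf'' k"
      using 7(1-3) by auto
    have "nat1 (effect update_leaf_entry \<rho>) ''leaf'' z = (if z = k then lf k else nat1 \<rho> ''leaf'' z)" for z
      using f k l by (simp add: update_leaf_entry_def lf_def) linarith
    then show ?case using 7(2) by (auto simp: less_Suc_eq)
  qed (use assms in \<open>auto simp: update_leaf_entry_def\<close>)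
  moreover have "n * (cost update_leaf_entry + 2) + 2 = 5 * n + 2" by (simp add: update_leaf_entry_def)
  ultimately show ?thesis unfolding update_leaf_def lf_def by metis
qed

text \<open>Seed \<open>x\<close> creates node \<open>x\<close>, so the nodes are numbered from 1
  and the cut of node \<open>j\<close> occupies row \<open>j\<close> of \<open>side\<close>.\<close>

definition tree_stored :: "nat \<Rightarrow> memory \<Rightarrow> bool" where
  "tree_stored x \<sigma> \<longleftrightarrow> (\<exists>K. cut_tree {C. st_cut G s t C} (cut_capacity G c) n x (nat1 \<sigma> ''leaf'') (nats \<sigma> ''N'') K \<and>
     (\<forall>j. 0 < j \<longrightarrow> j < x \<longrightarrow> stored \<sigma> j (K j)))"

text \<open>The index \<open>max x 1\<close> reflects that the tree with the single seed 0 is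
  present before the first, idle round.\<close>

lemma runs_tree_step:
  assumes r: "ready \<sigma>" "sound \<sigma>" and x: "nat0 \<sigma> ''x'' = x" "x < n" and tree: "tree_stored (max x 1) \<sigma>"
  shows "\<exists>\<sigma>'. runs tree_step \<sigma> (2500 * (n + m)) 2 \<sigma>' \<and> sound \<sigma>' \<and> grows \<sigma> \<sigma>' \<and> tree_stored (Suc x) \<sigma>'"
proof (cases "x = 0")
  case True
  have "runs tree_step \<sigma> (1 + 1) 0 \<sigma>"
    unfolding tree_step_def using x True runs_Skip by (intro runs_Cond) auto
  then have "runs tree_step \<sigma> (2500 * (n + m)) 2 \<sigma>" by (rule runs_mono) (use n_ge_2 in auto)
  then show ?thesis using True tree r(2) grows_same[of \<sigma> \<sigma>] by auto
next
  case False
  then have x0: "0 < x" "max x 1 = x" by auto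
  obtain K where tr: "cut_tree {C. st_cut G s t C} (cut_capacity G c) n x (nat1 \<sigma> ''leaf'') (nats \<sigma> ''N'') K"
    and K: "\<And>j. 0 < j \<Longrightarrow> j < x \<Longrightarrow> stored \<sigma> j (K j)"
    using tree unfolding x0 tree_stored_def by blast
  note T = cut_treeD[OF tr]
  define y where "y = nat1 \<sigma> ''leaf'' x"
  have y: "y < x" "y < n" "x \<noteq> y" using T(1)[OF x(2)] x(2) by (auto simp: y_def)
  let ?\<sigma>1 = "nwrite ''y'' 0 0 y \<sigma>"
  have r1: "runs (NSet ''y'' (N1 ''leaf'' (N0 ''x''))) \<sigma> 1 0 ?\<sigma>1"
    using runs_effect[of "NSet ''y'' (N1 ''leaf'' (N0 ''x''))" \<sigma>] x by (simp add: y_def)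
  have f1: "ready ?\<sigma>1" "sound ?\<sigma>1" "grows \<sigma> ?\<sigma>1" "nat0 ?\<sigma>1 ''x'' = x" "nat0 ?\<sigma>1 ''y'' = y"
    using ready_frame[OF runs_frame[OF r1] r(1)] r(2) x by (simp_all add: sound_def grows_def)
  obtain \<sigma>2 D where \<sigma>2: "runs separate_pair ?\<sigma>1 (2000 * (n + m) + 8 * n + 30) 2 \<sigma>2" "sound \<sigma>2"
    "grows ?\<sigma>1 \<sigma>2" and D: "stored \<sigma>2 x D" "separates D x y"
    "\<forall>D'. st_cut G s t D' \<longrightarrow> separates D' x y \<longrightarrow> cut_capacity G c D \<le> cut_capacity G c D'"
    and old: "\<forall>j. j \<noteq> x \<longrightarrow> real1 \<sigma>2 ''fv'' j = real1 ?\<sigma>1 ''fv'' j \<and> nats \<sigma>2 ''side'' j = nats ?\<sigma>1 ''side'' j"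
    using runs_separate_pair[OF f1(1,2,4,5) x(2) y(2,3)] by (elim exE conjE)
  have f2: "nat0 \<sigma>2 ''x'' = x" "nat0 \<sigma>2 ''y'' = y" "nats \<sigma>2 ''leaf'' = nats \<sigma> ''leaf''" "nats \<sigma>2 ''N'' = nats \<sigma> ''N''"
    "nat0 \<sigma>2 ''n'' = n"
    using runs_frame[OF \<sigma>2(1)] f1 by (simp_all add: frame_def separate_pair_def ready_def input_stored_def)
  obtain \<sigma>3 where \<sigma>3: "runs update_lca \<sigma>2 (7 * x + 2) 0 \<sigma>3" and N3: "\<forall>a b. nats \<sigma>3 ''N'' a b =
    (if a = x \<and> b < x then if b = y \<or> real1 \<sigma>2 ''fv'' x < real1 \<sigma>2 ''fv'' (nats \<sigma> ''N'' y b) then x else nats \<sigma> ''N'' y b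
     else if b = x \<and> a < x then if a = y \<or> real1 \<sigma>2 ''fv'' x < real1 \<sigma>2 ''fv'' (nats \<sigma> ''N'' y a) then x else nats \<sigma> ''N'' y a
     else nats \<sigma> ''N'' a b)"
    using runs_update_lca[OF f2(1,2) y(1)] unfolding f2 by blast
  have f3: "nat0 \<sigma>3 ''x'' = x" "nat0 \<sigma>3 ''y'' = y" "nats \<sigma>3 ''leaf'' = nats \<sigma> ''leaf''" "reals \<sigma>3 = reals \<sigma>2"
    "nat0 \<sigma>3 ''n'' = n" "nats \<sigma>3 ''side'' = nats \<sigma>2 ''side''"
    using runs_frame[OF \<sigma>3] f2 by (auto simp: frame_def update_lca_def update_lca_entry_def)
  obtain \<sigma>4 where \<sigma>4: "runs update_leaf \<sigma>3 (5 * n + 2) 0 \<sigma>4" and leaf4: "\<forall>z. nat1 \<sigma>4 ''leaf'' z =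
    (if z < n then if nats \<sigma>2 ''side'' x z = nats \<sigma>2 ''side'' x x \<and>
         (nat1 \<sigma> ''leaf'' z = y \<or> real1 \<sigma>2 ''fv'' x < real1 \<sigma>2 ''fv'' (nats \<sigma>3 ''N'' y (nat1 \<sigma> ''leaf'' z)))
       then x else nat1 \<sigma> ''leaf'' z else nat1 \<sigma> ''leaf'' z)"
    using runs_update_leaf[OF f3(5,1,2)] unfolding f3 by blast
  have f4: "reals \<sigma>4 = reals \<sigma>2" "nats \<sigma>4 ''N'' = nats \<sigma>3 ''N''" "nats \<sigma>4 ''side'' = nats \<sigma>2 ''side''"
    using runs_frame[OF \<sigma>4] f3 by (auto simp: frame_def update_leaf_def update_leaf_entry_def)
  have g24: "grows \<sigma>2 \<sigma>4" "grows \<sigma> \<sigma>4" "sound \<sigma>4"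
    using grows_same[of \<sigma>4 \<sigma>2] f4(1) grows_trans[OF grows_trans[OF f1(3) \<sigma>2(3)], of \<sigma>4] \<sigma>2(2) sound_same[of \<sigma>2 \<sigma>4] by simp_all
  have D4: "stored \<sigma>4 x D" using stored_grows[OF D(1) g24(1)] f4 by simp
  have K4: "stored \<sigma>4 j (K j)" if "0 < j" "j < x" for j
    using stored_grows[OF K[OF that] g24(2)] f4 old that(2) by simp
  have fvK: "real1 \<sigma>2 ''fv'' (nats \<sigma> ''N'' y b) = cut_capacity G c (K (nats \<sigma> ''N'' y b))"
    if "b < x" "b \<noteq> y" for b
    using K4[of "nats \<sigma> ''N'' y b"] T(5,6)[OF y(1) that(1)] that(2) f4(1) by (simp add: stored_def)
  have fvD: "real1 \<sigma>2 ''fv'' x = cut_capacity G c D" and stD: "st_cut G s t D"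
    and sideD: "\<And>v. v < n \<Longrightarrow> nats \<sigma>2 ''side'' x v = (if v \<in> D then 1 else 0)"
    using D(1) by (auto simp: stored_def)
  have "cut_tree {C. st_cut G s t C} (cut_capacity G c) n (Suc x) (nat1 \<sigma>4 ''leaf'') (nats \<sigma>4 ''N'') (K(x := D))"
  proof (rule cut_tree_step[OF tr x0(1) x(2) y_def _ D(2)])
    show "D \<in> {C. st_cut G s t C}" using stD by simp
    show "cut_capacity G c D \<le> cut_capacity G c D'" if "D' \<in> {C. st_cut G s t C}" "separates D' x y" for D'
      using D(3) that by simp
    show "nat1 \<sigma>4 ''leaf'' z = (if \<not> separates D z x \<and> (nat1 \<sigma> ''leaf'' z = y \<or>
        cut_capacity G c D < cut_capacity G c (K (nats \<sigma> ''N'' y (nat1 \<sigma> ''leaf'' z)))) then x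
       else nat1 \<sigma> ''leaf'' z)" if "z < n" for z
    proof -
      have "nats \<sigma>2 ''side'' x z = nats \<sigma>2 ''side'' x x \<longleftrightarrow> \<not> separates D z x"
        using sideD[OF that] sideD[OF x(2)] by (auto simp: separates_def)
      \<comment> \<open>The table of common ancestors has already been updated here, but entries
        between old seeds are not affected.\<close>
      moreover have "nats \<sigma>3 ''N'' y (nat1 \<sigma> ''leaf'' z) = nats \<sigma> ''N'' y (nat1 \<sigma> ''leaf'' z)"
        using N3 y(1) T(1)[OF that] by simp
      ultimately show ?thesis using leaf4 that fvK[OF T(1)[OF that]] fvD by auto
    qed
    show "nats \<sigma>4 ''N'' x b = (if b = y \<or> cut_capacity G c D < cut_capacity G c (K (nats \<sigma> ''N'' y b))
        then x else nats \<sigma> ''N'' y b)" if "b < x" for b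
      using N3 f4(2) that fvK[OF that] fvD by auto
    show "nats \<sigma>4 ''N'' b x = nats \<sigma>4 ''N'' x b" "nats \<sigma>4 ''N'' a b = nats \<sigma> ''N'' a b" if "b < x" "a < x" for a b
      using N3 f4(2) that by simp_all
  qed simp_all
  moreover have "\<forall>j. 0 < j \<longrightarrow> j < Suc x \<longrightarrow> stored \<sigma>4 j ((K(x := D)) j)"
    using D4 K4 by (simp add: less_Suc_eq)
  ultimately have "tree_stored (Suc x) \<sigma>4" unfolding tree_stored_def by blast
  moreover have "runs (NSet ''y'' (N1 ''leaf'' (N0 ''x'')) ;; separate_pair ;; update_lca ;; update_leaf) \<sigma>
      (2400 * (n + m)) 2 \<sigma>4"
    by (rule runs_mono[OF runs_Seq[OF r1 runs_Seq[OF \<sigma>2(1) runs_Seq[OF \<sigma>3 \<sigma>4]]]])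
      (use n_ge_2 x in auto)
  then have "runs tree_step \<sigma> (2400 * (n + m) + 1) 2 \<sigma>4"
    unfolding tree_step_def using x x0 by (intro runs_Cond) auto
  then have "runs tree_step \<sigma> (2500 * (n + m)) 2 \<sigma>4" by (rule runs_mono) (use n_ge_2 in auto)
  ultimately show ?thesis using g24 by blast
qed

text \<open>All that later phases need from the tree: for each pair of vertices a minimum separating
  cut, of whichever orientation, has been evaluated.\<close>

definition pairs_recorded :: "memory \<Rightarrow> bool" where
  "pairs_recorded \<sigma> \<longleftrightarrow> (\<forall>u<n. \<forall>v<n. u \<noteq> v \<longrightarrow> (\<exists>K. st_cut G s t K \<and> separates K u v \<and> recorded \<sigma> K \<and>
      (\<forall>D. st_cut G s t D \<longrightarrow> separates D u v \<longrightarrow> cut_capacity G c K \<le> cut_capacity G c D)))"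

lemma runs_build_tree:
  assumes r: "ready \<sigma>" "sound \<sigma>" and leaf: "\<forall>z. nat1 \<sigma> ''leaf'' z = 0"
  shows "\<exists>\<sigma>'. runs build_tree \<sigma> (3000 * (n * (n + m))) (2 * n) \<sigma>' \<and> sound \<sigma>' \<and>
    pairs_recorded \<sigma>'"
proof -
  have tree_x: "tree_stored k (nwrite ''x'' 0 0 j \<rho>) = tree_stored k \<rho>" for k j \<rho>
    by (simp add: tree_stored_def stored_def recorded_def)
  have sound_x: "sound (nwrite ''x'' 0 0 j \<rho>) = sound \<rho>" for j \<rho>
    by (simp add: sound_def)
  define Inv where "Inv k \<rho> \<longleftrightarrow> sound \<rho> \<and> tree_stored (max k 1) \<rho>" for k and \<rho> :: memory
  have "\<exists>\<sigma>'. runs (For ''x'' ''n'' tree_step) \<sigma> (n * (2500 * (n + m) + 2) + 2) (n * 2) \<sigma>' \<and> Inv n \<sigma>'"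
  proof (rule runs_For, goal_cases)
    case 1
    show ?case using r by (simp add: ready_def input_stored_def)
  next
    case 5
    have "tree_stored 1 \<sigma>"
      unfolding tree_stored_def using cut_tree_init[of n "nat1 \<sigma> ''leaf''"] leaf by auto
    then show ?case using r(2) by (simp add: Inv_def tree_x sound_x)
  next
    case (6 k \<rho>)
    have "ready \<rho>"
      using ready_frame[OF 6(4) r(1)] by simp
    then obtain \<sigma>' where "runs tree_step \<rho> (2500 * (n + m)) 2 \<sigma>'" "sound \<sigma>'" "tree_stored (Suc k) \<sigma>'"
      using runs_tree_step[of \<rho> k] 6 unfolding Inv_def by blast
    then show ?case by (intro exI[of _ \<sigma>']) (simp add: Inv_def tree_x sound_x)
  qed simp_all
  then obtain \<sigma>' where \<sigma>': "runs build_tree \<sigma> (n * (2500 * (n + m) + 2) + 2) (n * 2) \<sigma>'" "sound \<sigma>'" "tree_stored n \<sigma>'"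
    using n_ge_2 unfolding build_tree_def[symmetric] Inv_def by (auto simp: max_def)
  obtain K where tr: "cut_tree {C. st_cut G s t C} (cut_capacity G c) n n (nat1 \<sigma>' ''leaf'') (nats \<sigma>' ''N'') K"
    and K: "\<And>j. 0 < j \<Longrightarrow> j < n \<Longrightarrow> stored \<sigma>' j (K j)"
    using \<sigma>'(3) unfolding tree_stored_def by blast
  have "\<exists>K. st_cut G s t K \<and> separates K u v \<and> recorded \<sigma>' K \<and>
      (\<forall>D. st_cut G s t D \<longrightarrow> separates D u v \<longrightarrow> cut_capacity G c K \<le> cut_capacity G c D)"
    if "u < n" "v < n" "u \<noteq> v" for u v
  proof -
    obtain j where j: "0 < j" "j < n" "separates (K j) u v"
      "\<forall>D\<in>{C. st_cut G s t C}. separates D u v \<longrightarrow> cut_capacity G c (K j) \<le> cut_capacity G c D"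
      using cut_tree_done[OF tr \<open>u < n\<close> \<open>v < n\<close> \<open>u \<noteq> v\<close>] by blast
    then show ?thesis using K[OF j(1,2)] by (intro exI[of _ "K j"]) (simp add: stored_def)
  qed
  moreover have "runs build_tree \<sigma> (3000 * (n * (n + m))) (2 * n) \<sigma>'"
  proof (rule runs_mono[OF \<sigma>'(1)])
    have "n * 2 \<le> n * (n + m)" using n_ge_2 by (intro mult_left_mono) auto
    moreover have "n * (2500 * (n + m) + 2) + 2 = 2500 * (n * (n + m)) + n * 2 + 2" by (simp add: algebra_simps)
    moreover have "2 \<le> n * 2" using n_ge_2 by simp
    ultimately show "n * (2500 * (n + m) + 2) + 2 \<le> 3000 * (n * (n + m))" by linarith
  qed simp
  ultimately show ?thesis unfolding pairs_recorded_def using \<sigma>'(2) by blast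
qed

end

section \<open>Bottleneck arcs and spanning forests\<close>

definition joins :: "(nat, nat) pre_digraph \<Rightarrow> nat \<Rightarrow> nat \<Rightarrow> nat \<Rightarrow> bool" where
  "joins G g x y \<longleftrightarrow> x = tail G g \<and> y = head G g \<or> x = head G g \<and> y = tail G g"

definition crosses :: "(nat, nat) pre_digraph \<Rightarrow> nat \<Rightarrow> nat set \<Rightarrow> bool" where
  "crosses G g X \<longleftrightarrow> (tail G g \<in> X) \<noteq> (head G g \<in> X)"

definition bottleneck :: "(nat, nat) pre_digraph \<Rightarrow> (nat \<Rightarrow> real) \<Rightarrow> nat \<Rightarrow> nat set \<Rightarrow> bool" where
  "bottleneck G w e X \<longleftrightarrow> crosses G e X \<and> (\<forall>g\<in>arcs G. g \<noteq> e \<longrightarrow> crosses G g X \<longrightarrow> w g < w e)"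

text \<open>Undirected adjacency by the other arcs that are at least as heavy as \<open>e\<close>.
  The components of the ends of \<open>e\<close> depend on \<open>e\<close> alone, whereas the set
  \<open>X\<close> of a bottleneck is unknown to the program.\<close>

definition heavy :: "(nat, nat) pre_digraph \<Rightarrow> (nat \<Rightarrow> real) \<Rightarrow> nat \<Rightarrow> (nat \<times> nat) set" where
  "heavy G w e = {(x, y). \<exists>g\<in>arcs G. g \<noteq> e \<and> w e \<le> w g \<and> joins G g x y}"

text \<open>The invariant of Prim's algorithm that has visited \<open>S\<close> and chosen the arcs \<open>F\<close>: it reaches the
  second of the two components that a bottleneck arc joins only through this arc.\<close>

definition forest_inv :: "(nat, nat) pre_digraph \<Rightarrow> (nat \<Rightarrow> real) \<Rightarrow> nat set \<Rightarrow> nat set \<Rightarrow> bool" where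
  "forest_inv G w S F \<longleftrightarrow> (\<forall>e\<in>arcs G. \<forall>X. bottleneck G w e X \<longrightarrow>
     S \<inter> (heavy G w e)\<^sup>* `` {tail G e} \<noteq> {} \<longrightarrow> S \<inter> (heavy G w e)\<^sup>* `` {head G e} \<noteq> {} \<longrightarrow> e \<in> F)"

lemma joins_sym: "joins G g x y \<Longrightarrow> joins G g y x"
  by (auto simp: joins_def)

lemma heavy_rtrancl_sym: "(x, y) \<in> (heavy G w e)\<^sup>* \<Longrightarrow> (y, x) \<in> (heavy G w e)\<^sup>*"
  by (rule symD[OF sym_rtrancl]) (auto simp: sym_def heavy_def joins_def)

lemma crosses_joins: "joins G g x y \<Longrightarrow> crosses G g X \<longleftrightarrow> (x \<in> X) \<noteq> (y \<in> X)"
  by (auto simp: crosses_def joins_def)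

lemma closed_rtrancl: "(x, y) \<in> R\<^sup>* \<Longrightarrow> x \<in> S \<Longrightarrow> (\<And>u v. (u, v) \<in> R \<Longrightarrow> u \<in> S \<Longrightarrow> v \<in> S) \<Longrightarrow> y \<in> S"
  by (induction rule: rtrancl_induct) auto

text \<open>All other arcs across \<open>X\<close> are lighter than \<open>e\<close>, so a path of
  heavy arcs never crosses \<open>X\<close>.\<close>

lemma bottleneck_components_disjoint:
  assumes "bottleneck G w e X"
  shows "(heavy G w e)\<^sup>* `` {tail G e} \<inter> (heavy G w e)\<^sup>* `` {head G e} = {}"
proof -
  have step: "u \<in> X \<longleftrightarrow> v \<in> X" if "(u, v) \<in> heavy G w e" for u v
    using that assms crosses_joins[of G _ u v X] unfolding heavy_def bottleneck_def by fastforce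
  have "u \<in> X \<longleftrightarrow> v \<in> X" if "(u, v) \<in> (heavy G w e)\<^sup>*" for u v
    using that by induction (auto simp: step)
  then show ?thesis using assms unfolding bottleneck_def crosses_def by blast
qed

text \<open>Suppose the untouched component of \<open>b\<close> is entered by some \<open>g\<close>
  other than \<open>e\<close>. Then \<open>g\<close> is lighter than \<open>e\<close>, since
  otherwise \<open>p\<close> would belong to that component as well. As \<open>g\<close> is a
  heaviest arc across \<open>S\<close>, no heavy arc crosses \<open>S\<close>, so \<open>S\<close>
  contains \<open>a\<close> but not \<open>b\<close>. Then \<open>e\<close> itself crosses
  \<open>S\<close> and beats \<open>g\<close>.\<close>

lemma forest_step_aux:
  assumes e: "e \<in> arcs G" and ab: "joins G e a b"
    and g: "g \<in> arcs G" "joins G g p q" "p \<in> S" "q \<notin> S" "g \<noteq> e"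
    and max: "\<And>h. h \<in> arcs G \<Longrightarrow> crosses G h S \<Longrightarrow> w h \<le> w g"
    and q: "q \<in> (heavy G w e)\<^sup>* `` {b}" and B: "S \<inter> (heavy G w e)\<^sup>* `` {b} = {}"
    and A: "S \<inter> (heavy G w e)\<^sup>* `` {a} \<noteq> {}"
  shows False
proof -
  have "w g < w e"
  proof (rule ccontr)
    assume "\<not> w g < w e"
    then have "(q, p) \<in> heavy G w e" using g joins_sym unfolding heavy_def by fastforce
    then have "p \<in> (heavy G w e)\<^sup>* `` {b}" using q by (auto intro: rtrancl_into_rtrancl)
    then show False using B g(3) by blast
  qed
  obtain z where z: "z \<in> S" "(a, z) \<in> (heavy G w e)\<^sup>*" using A by blast
  have closed: "v \<in> S" if uv: "(u, v) \<in> heavy G w e" "u \<in> S" for u v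
  proof (rule ccontr)
    assume "v \<notin> S"
    obtain h where h: "h \<in> arcs G" "w e \<le> w h" "joins G h u v" using uv(1) by (auto simp: heavy_def)
    then have "crosses G h S" using crosses_joins[OF h(3), of S] uv(2) \<open>v \<notin> S\<close> by simp
    then show False using max[OF h(1)] h(2) \<open>w g < w e\<close> by simp
  qed
  have "a \<in> S" using closed_rtrancl[OF heavy_rtrancl_sym[OF z(2)] z(1)] closed by blast
  moreover have "b \<notin> S" using B by blast
  ultimately have "crosses G e S" using crosses_joins[OF ab, of S] by simp
  then show False using max[OF e] \<open>w g < w e\<close> by simp
qed

text \<open>Only one vertex \<open>q\<close> is new, and the two components around a bottleneck arc
  are disjoint. So the invariant for \<open>e\<close> is at risk only if \<open>q\<close> is the
  first visited vertex of one component after the other has been reached.\<close>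

lemma forest_inv_arc:
  assumes inv: "forest_inv G w S F" and g: "g \<in> arcs G" "crosses G g S"
    and max: "\<And>h. h \<in> arcs G \<Longrightarrow> crosses G h S \<Longrightarrow> w h \<le> w g"
  shows "forest_inv G w (S \<union> {tail G g, head G g}) (insert g F)"
  unfolding forest_inv_def
proof (intro ballI allI impI)
  fix e X
  assume e: "e \<in> arcs G" "bottleneck G w e X"
  let ?A = "(heavy G w e)\<^sup>* `` {tail G e}" and ?B = "(heavy G w e)\<^sup>* `` {head G e}"
  assume A: "(S \<union> {tail G g, head G g}) \<inter> ?A \<noteq> {}" and B: "(S \<union> {tail G g, head G g}) \<inter> ?B \<noteq> {}"
  obtain p q where pq: "joins G g p q" "p \<in> S" "q \<notin> S" "S \<union> {tail G g, head G g} = insert q S"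
    using g(2) unfolding crosses_def joins_def by blast
  note disj = bottleneck_components_disjoint[OF e(2)]
  show "e \<in> insert g F"
  proof (rule ccontr)
    assume "e \<notin> insert g F"
    then have ne: "g \<noteq> e" and "e \<notin> F" by auto
    then have "S \<inter> ?A = {} \<or> S \<inter> ?B = {}" using inv e unfolding forest_inv_def by blast
    then consider "S \<inter> ?A = {}" "q \<in> ?A" "S \<inter> ?B \<noteq> {}" | "S \<inter> ?B = {}" "q \<in> ?B" "S \<inter> ?A \<noteq> {}"
      using A B disj unfolding pq(4) by blast
    then show False
    proof cases
      case 1
      then show False
        using forest_step_aux[of e G "head G e" "tail G e" g p q S w] e(1) g pq ne max by (auto simp: joins_def)
    next
      case 2
      then show False
        using forest_step_aux[of e G "tail G e" "head G e" g p q S w] e(1) g pq ne max by (auto simp: joins_def)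
    qed
  qed
qed

text \<open>No arc crosses \<open>S\<close>, so \<open>S\<close> is closed under heavy paths and
  contains both ends of \<open>e\<close> or neither. In the latter case the single new vertex cannot
  meet both components.\<close>

lemma forest_inv_root:
  assumes inv: "forest_inv G w S F" and none: "\<And>g. g \<in> arcs G \<Longrightarrow> \<not> crosses G g S"
  shows "forest_inv G w (insert v S) F"
  unfolding forest_inv_def
proof (intro ballI allI impI)
  fix e X
  assume e: "e \<in> arcs G" "bottleneck G w e X"
  let ?A = "(heavy G w e)\<^sup>* `` {tail G e}" and ?B = "(heavy G w e)\<^sup>* `` {head G e}"
  assume A: "insert v S \<inter> ?A \<noteq> {}" and B: "insert v S \<inter> ?B \<noteq> {}"
  have closed: "y \<in> S" if "(x, y) \<in> heavy G w e" "x \<in> S" for x y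
    using that none crosses_joins[of G _ x y S] unfolding heavy_def by fastforce
  have "a \<in> S" if "S \<inter> (heavy G w e)\<^sup>* `` {a} \<noteq> {}" for a
    using that closed_rtrancl[OF heavy_rtrancl_sym] closed by blast
  moreover have "tail G e \<in> S \<longleftrightarrow> head G e \<in> S" using none[OF e(1)] by (simp add: crosses_def)
  moreover have "v \<notin> ?A \<or> v \<notin> ?B" using bottleneck_components_disjoint[OF e(2)] by blast
  ultimately have "tail G e \<in> S \<and> head G e \<in> S" using A B by blast
  then have "S \<inter> ?A \<noteq> {}" "S \<inter> ?B \<noteq> {}" by blast+
  then show "e \<in> F" using inv e unfolding forest_inv_def by blast
qed

lemma forest_inv_all:
  assumes "forest_inv G w S F" "e \<in> arcs G" "bottleneck G w e X" "tail G e \<in> S" "head G e \<in> S"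
  shows "e \<in> F"
  using assms unfolding forest_inv_def by blast

section \<open>Prim's algorithm as a program\<close>

definition compare_arc :: com where
  "compare_arc =
     If_then (BAnd (BNot (NEq (N1 ''in'' (N1 ''tail'' (N0 ''i''))) (N1 ''in'' (N1 ''head'' (N0 ''i'')))))
       (RLess (R0 ''bw'') (R1 ''wt'' (N0 ''i''))))
     (NSet ''bi'' (NInc (N0 ''i'')) ;; RSet ''bw'' (R1 ''wt'' (N0 ''i'')))"

text \<open>The pointer \<open>bi\<close> is shifted by one, with 0 for "no crossing arc". Weights
  are nonnegative, so the start value -1 lets any crossing arc win.\<close>

definition find_heaviest :: com where
  "find_heaviest =
     (NSet ''bi'' (NConst 0) ;; RSet ''bw'' (RConst (- 1))) ;;
     For ''i'' ''m'' compare_arc"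

definition visit_arc :: com where
  "visit_arc =
     NSet ''a'' (N1 ''tail'' (NDec (N0 ''bi''))) ;;
     NSet ''b'' (N1 ''head'' (NDec (N0 ''bi''))) ;;
     NSet1 ''in'' (N0 ''a'') (NConst 1) ;;
     NSet1 ''in'' (N0 ''b'') (NConst 1)"

definition cut_arc :: com where
  "cut_arc = If_then (BAnd (BNot (NEq (N0 ''a'') (N0 ''t''))) (BNot (NEq (N0 ''b'') (N0 ''s'')))) find_cut"

definition compare_vertex :: com where
  "compare_vertex =
     If_then (NEq (N1 ''in'' (N0 ''v'')) (NConst 0)) (NSet ''u'' (N0 ''v''))"

definition visit_root :: com where
  "visit_root =
     For ''v'' ''n'' compare_vertex ;;
     NSet1 ''in'' (N0 ''u'') (NConst 1)"

definition forest_step :: com where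
  "forest_step = find_heaviest ;; Cond (NLess (NConst 0) (N0 ''bi'')) (visit_arc ;; cut_arc) visit_root"

text \<open>Each of the \<open>n\<close> rounds visits exactly one new vertex, through an arc or as
  the root of a new tree, and computes at most one flow.\<close>

definition build_forest :: com where
  "build_forest = For ''z'' ''n'' forest_step"

lemma writes_forest_step [simp]:
  "nat_writes forest_step = {''bi'', ''a'', ''b'', ''in'', ''u''} \<union> nat_writes find_cut"
  "real_writes forest_step = {''bw''} \<union> real_writes find_cut"
  by (auto simp: forest_step_def find_heaviest_def compare_arc_def visit_arc_def visit_root_def compare_vertex_def cut_arc_def)

lemma writes_build_forest [simp]:
  "nat_writes build_forest = insert ''z'' (nat_writes forest_step)"
  "real_writes build_forest = real_writes forest_step"
  by (simp_all only: build_forest_def writes_For)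

section \<open>Correctness of the forest construction\<close>

context vitality_program
begin

definition visited :: "memory \<Rightarrow> nat set" where
  "visited \<sigma> = {v. v < n \<and> nat1 \<sigma> ''in'' v \<noteq> 0}"

lemma runs_find_heaviest:
  assumes "input_stored \<sigma>" and w: "\<forall>i<m. real1 \<sigma> ''wt'' i = w i \<and> 0 \<le> w i" and bin: "\<forall>v<n. nat1 \<sigma> ''in'' v \<le> 1"
  shows "\<exists>\<sigma>'. runs find_heaviest \<sigma> (6 * m + 10) 0 \<sigma>' \<and>
    (nat0 \<sigma>' ''bi'' = 0 \<and> (\<forall>g<m. \<not> crosses G g (visited \<sigma>)) \<or>
     (\<exists>g<m. nat0 \<sigma>' ''bi'' = Suc g \<and> crosses G g (visited \<sigma>) \<and>
        (\<forall>h<m. crosses G h (visited \<sigma>) \<longrightarrow> w h \<le> w g)))"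
proof -
  let ?P = "NSet ''bi'' (NConst 0) ;; RSet ''bw'' (RConst (- 1))"
  define \<sigma>1 where "\<sigma>1 = effect ?P \<sigma>"
  have r1: "runs ?P \<sigma> 2 0 \<sigma>1" unfolding \<sigma>1_def by (rule runs_mono[OF runs_effect]) simp_all
  define Inv where "Inv k \<rho> \<longleftrightarrow>
    nat0 \<rho> ''bi'' = 0 \<and> real0 \<rho> ''bw'' = - 1 \<and> (\<forall>g<k. \<not> crosses G g (visited \<sigma>)) \<or>
    (\<exists>g<k. nat0 \<rho> ''bi'' = Suc g \<and> real0 \<rho> ''bw'' = w g \<and> crosses G g (visited \<sigma>) \<and>
        (\<forall>h<k. crosses G h (visited \<sigma>) \<longrightarrow> w h \<le> w g))" for k and \<rho> :: memory
  have "\<exists>\<sigma>'. runs (For ''i'' ''m'' compare_arc) \<sigma>1 (m * (cost compare_arc + 2) + 2) 0 \<sigma>' \<and> Inv m \<sigma>'"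
  proof (rule runs_For_straight, goal_cases)
    case 1
    show ?case using assms(1) by (simp add: \<sigma>1_def input_stored_def)
  next
    case 6
    show ?case by (simp add: Inv_def \<sigma>1_def)
  next
    case (7 k \<rho>)
    have f: "nats \<rho> ''tail'' = nats \<sigma> ''tail''" "nats \<rho> ''head'' = nats \<sigma> ''head''" "nats \<rho> ''in'' = nats \<sigma> ''in''"
      "reals \<rho> ''wt'' = reals \<sigma> ''wt''"
      using 7(4) by (simp_all add: frame_def compare_arc_def \<sigma>1_def)
    have th: "nat1 \<sigma> ''tail'' k = tail G k" "nat1 \<sigma> ''head'' k = head G k" "real1 \<sigma> ''wt'' k = w k" "0 \<le> w k"
      using assms(1) w 7(1) by (simp_all add: input_stored_def)
    have "nat1 \<sigma> ''in'' (tail G k) \<le> 1" "nat1 \<sigma> ''in'' (head G k) \<le> 1" using bin ends_less[OF 7(1)] by simp_all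
    \<comment> \<open>Unequal marks detect a crossing arc because the marks are 0 or 1.\<close>
    then have cr: "nat1 \<sigma> ''in'' (tail G k) \<noteq> nat1 \<sigma> ''in'' (head G k) \<longleftrightarrow> crosses G k (visited \<sigma>)"
      using ends_less[OF 7(1)] by (auto simp: crosses_def visited_def)
    have eff: "nat0 (effect compare_arc \<rho>) ''bi'' = (if crosses G k (visited \<sigma>) \<and> real0 \<rho> ''bw'' < w k then Suc k else nat0 \<rho> ''bi'')"
      "real0 (effect compare_arc \<rho>) ''bw'' = (if crosses G k (visited \<sigma>) \<and> real0 \<rho> ''bw'' < w k then w k else real0 \<rho> ''bw'')"
      using f th cr 7(3) by (simp_all add: compare_arc_def)
    have "Inv (Suc k) (effect compare_arc \<rho>)"
    proof (cases "crosses G k (visited \<sigma>) \<and> real0 \<rho> ''bw'' < w k")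
      case True
      then show ?thesis using 7(2) eff unfolding Inv_def by (auto simp: less_Suc_eq)
    next
      case False
      then have "\<not> crosses G k (visited \<sigma>) \<or> w k \<le> real0 \<rho> ''bw''" by auto
      then show ?thesis using 7(2) eff False th(4) unfolding Inv_def by (auto simp: less_Suc_eq)
    qed
    then show ?case by (simp add: Inv_def)
  qed (simp_all add: compare_arc_def)
  then obtain \<sigma>2 where \<sigma>2: "runs (For ''i'' ''m'' compare_arc) \<sigma>1 (m * (cost compare_arc + 2) + 2) 0 \<sigma>2" "Inv m \<sigma>2" by blast
  have "runs find_heaviest \<sigma> (6 * m + 10) 0 \<sigma>2"
    unfolding find_heaviest_def
    by (rule runs_mono[OF runs_Seq[OF r1 \<sigma>2(1)]]) (simp_all add: compare_arc_def)
  then show ?thesis using \<sigma>2(2) unfolding Inv_def by blast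
qed

lemma runs_visit_root:
  assumes "nat0 \<sigma> ''n'' = n" and v: "v < n" "nat1 \<sigma> ''in'' v = 0"
  shows "\<exists>\<sigma>' u. runs visit_root \<sigma> (4 * n + 10) 0 \<sigma>' \<and> u < n \<and> nat1 \<sigma> ''in'' u = 0 \<and>
    nat1 \<sigma>' ''in'' = (nat1 \<sigma> ''in'')(u := 1)"
proof -
  define Inv where "Inv k \<rho> \<longleftrightarrow> (\<forall>v<k. nat1 \<sigma> ''in'' v = 0 \<longrightarrow> nat0 \<rho> ''u'' < n \<and> nat1 \<sigma> ''in'' (nat0 \<rho> ''u'') = 0)"
    for k and \<rho> :: memory
  have "\<exists>\<sigma>'. runs (For ''v'' ''n'' compare_vertex) \<sigma> (n * (cost compare_vertex + 2) + 2) 0 \<sigma>' \<and> Inv n \<sigma>'"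
  proof (rule runs_For_straight, goal_cases)
    case (7 k \<rho>)
    have "nats \<rho> ''in'' = nats \<sigma> ''in''" using 7(4) by (simp add: frame_def compare_vertex_def)
    then have "nat0 (effect compare_vertex \<rho>) ''u'' = (if nat1 \<sigma> ''in'' k = 0 then k else nat0 \<rho> ''u'')"
      using 7(3) by (simp add: compare_vertex_def)
    then show ?case using 7(1,2) by (auto simp: Inv_def less_Suc_eq)
  qed (use assms in \<open>simp_all add: compare_vertex_def Inv_def\<close>)
  then obtain \<sigma>1 where \<sigma>1: "runs (For ''v'' ''n'' compare_vertex) \<sigma> (n * (cost compare_vertex + 2) + 2) 0 \<sigma>1" "Inv n \<sigma>1" by blast
  let ?u = "nat0 \<sigma>1 ''u''"
  have u: "?u < n" "nat1 \<sigma> ''in'' ?u = 0" using \<sigma>1(2) v by (auto simp: Inv_def)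
  have f: "nats \<sigma>1 ''in'' = nats \<sigma> ''in''" using runs_frame[OF \<sigma>1(1)] by (simp add: frame_def compare_vertex_def)
  let ?P = "NSet1 ''in'' (N0 ''u'') (NConst 1)"
  have "runs ?P \<sigma>1 1 0 (effect ?P \<sigma>1)" by (rule runs_mono[OF runs_effect]) simp_all
  then have "runs visit_root \<sigma> (n * (cost compare_vertex + 2) + 2 + 1) (0 + 0) (effect ?P \<sigma>1)"
    unfolding visit_root_def by (rule runs_Seq[OF \<sigma>1(1)])
  then have "runs visit_root \<sigma> (4 * n + 10) 0 (effect ?P \<sigma>1)" by (rule runs_mono) (simp_all add: compare_vertex_def)
  moreover have "nat1 (effect ?P \<sigma>1) ''in'' = (nat1 \<sigma> ''in'')(?u := 1)" using f by (auto simp: fun_eq_iff)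
  ultimately show ?thesis using u by blast
qed

text \<open>Together with \<open>sound\<close> and \<open>vital_cut\<close> this determines the
  entry of a vital arc exactly.\<close>

definition arc_cut_recorded :: "memory \<Rightarrow> nat \<Rightarrow> bool" where
  "arc_cut_recorded \<sigma> e \<longleftrightarrow> (\<forall>D. st_cut G s t D \<longrightarrow> e \<in> leaving G D \<longrightarrow>
     mincut_capacity G c s t + c e - cut_capacity G c D \<le> real1 \<sigma> ''vt'' e)"

lemma arc_cut_recorded_grows:
  assumes "arc_cut_recorded \<sigma> e" "grows \<sigma> \<sigma>'" "e < m"
  shows "arc_cut_recorded \<sigma>' e"
  using assms unfolding arc_cut_recorded_def grows_def by (meson order_trans)

text \<open>With the tail and head of \<open>e\<close> as terminals, the minimum cut found is a
  cheapest one among those left by \<open>e\<close>. If the tail is \<open>t\<close> or the head is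
  \<open>s\<close>, no cut is left by \<open>e\<close> and there is nothing to record.\<close>

lemma runs_cut_arc:
  assumes r: "ready \<sigma>" "sound \<sigma>" and e: "e < m" "tail G e \<noteq> head G e"
    and ab: "nat0 \<sigma> ''a'' = tail G e" "nat0 \<sigma> ''b'' = head G e"
  shows "\<exists>\<sigma>'. runs cut_arc \<sigma> (1000 * (n + m) + 1) 1 \<sigma>' \<and> sound \<sigma>' \<and> grows \<sigma> \<sigma>' \<and> arc_cut_recorded \<sigma>' e"
proof -
  let ?b = "BAnd (BNot (NEq (N0 ''a'') (N0 ''t''))) (BNot (NEq (N0 ''b'') (N0 ''s'')))"
  have st: "nat0 \<sigma> ''s'' = s" "nat0 \<sigma> ''t'' = t" using r by (auto simp: ready_def input_stored_def)
  have b: "bval ?b \<sigma> \<longleftrightarrow> tail G e \<noteq> t \<and> head G e \<noteq> s" using ab st by simp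
  show ?thesis
  proof (cases "tail G e \<noteq> t \<and> head G e \<noteq> s")
    case False
    have "runs cut_arc \<sigma> (1 + 1) 0 \<sigma>"
      unfolding cut_arc_def using b False runs_Skip by (intro runs_Cond) auto
    then have "runs cut_arc \<sigma> (1000 * (n + m) + 1) 1 \<sigma>" by (rule runs_mono) (use n_ge_2 in auto)
    moreover have "\<not> (st_cut G s t D \<and> e \<in> leaving G D)" for D
      using False by (auto simp: st_cut_def leaving_def)
    ultimately show ?thesis using r(2) grows_same[of \<sigma> \<sigma>]
      by (intro exI[of _ \<sigma>]) (auto simp: arc_cut_recorded_def)
  next
    case True
    obtain \<sigma>' K where run: "runs find_cut \<sigma> (1000 * (n + m)) 1 \<sigma>'" and K: "tail G e \<in> K" "head G e \<notin> K"
      "\<forall>D. st_cut G s t D \<longrightarrow> tail G e \<in> D \<longrightarrow> head G e \<notin> D \<longrightarrow> cut_capacity G c K \<le> cut_capacity G c D"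
      and s: "sound \<sigma>'" "grows \<sigma> \<sigma>'" "recorded \<sigma>' K"
      using runs_find_cut_sound[OF r ab ends_less[OF e(1)] e(2) True[THEN conjunct1] True[THEN conjunct2]]
      by (elim exE conjE)
    have "runs cut_arc \<sigma> (1000 * (n + m) + 1) 1 \<sigma>'"
      unfolding cut_arc_def using b True run by (intro runs_Cond) auto
    moreover have "arc_cut_recorded \<sigma>' e"
      unfolding arc_cut_recorded_def
    proof (intro allI impI)
      fix D assume D: "st_cut G s t D" "e \<in> leaving G D"
      then have "cut_capacity G c K \<le> cut_capacity G c D" using K(3) by (simp add: leaving_def)
      moreover have "e \<in> leaving G K" using K e by (simp add: leaving_def arcs_eq)
      ultimately show "mincut_capacity G c s t + c e - cut_capacity G c D \<le> real1 \<sigma>' ''vt'' e"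
        using s(3) unfolding recorded_def by force
    qed
    ultimately show ?thesis using s by blast
  qed
qed

text \<open>The number of visited vertices serves as round counter: after \<open>n\<close> rounds it
  forces all vertices to be visited, and then \<open>forest_inv_all\<close> applies to every
  bottleneck arc.\<close>

definition forest_stored :: "(nat \<Rightarrow> real) \<Rightarrow> nat \<Rightarrow> memory \<Rightarrow> bool" where
  "forest_stored w k \<sigma> \<longleftrightarrow> sound \<sigma> \<and> (\<forall>v<n. nat1 \<sigma> ''in'' v \<le> 1) \<and> card (visited \<sigma>) = k \<and>
     (\<exists>F\<subseteq>{..<m}. forest_inv G w (visited \<sigma>) F \<and> (\<forall>e\<in>F. arc_cut_recorded \<sigma> e))"

lemma runs_forest_step:
  assumes r: "ready \<sigma>" and w: "\<forall>i<m. real1 \<sigma> ''wt'' i = w i \<and> 0 \<le> w i"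
    and inv: "forest_stored w k \<sigma>" and k: "k < n"
  shows "\<exists>\<sigma>'. runs forest_step \<sigma> (2000 * (n + m)) 1 \<sigma>' \<and> grows \<sigma> \<sigma>' \<and> forest_stored w (Suc k) \<sigma>'"
proof -
  have inv': "sound \<sigma>" "\<forall>v<n. nat1 \<sigma> ''in'' v \<le> 1" "card (visited \<sigma>) = k"
    using inv by (auto simp: forest_stored_def)
  obtain F where F: "F \<subseteq> {..<m}" "forest_inv G w (visited \<sigma>) F" "\<forall>e\<in>F. arc_cut_recorded \<sigma> e"
    using inv by (auto simp: forest_stored_def)
  have fin: "finite (visited \<sigma>)" by (simp add: visited_def)
  have inp: "input_stored \<sigma>" using r by (simp add: ready_def)
  obtain \<sigma>1 where r1: "runs find_heaviest \<sigma> (6 * m + 10) 0 \<sigma>1" and bi: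
    "nat0 \<sigma>1 ''bi'' = 0 \<and> (\<forall>g<m. \<not> crosses G g (visited \<sigma>)) \<or>
     (\<exists>g<m. nat0 \<sigma>1 ''bi'' = Suc g \<and> crosses G g (visited \<sigma>) \<and>
        (\<forall>h<m. crosses G h (visited \<sigma>) \<longrightarrow> w h \<le> w g))"
    using runs_find_heaviest[OF inp w inv'(2)] by blast
  have f1: "nats \<sigma>1 ''in'' = nats \<sigma> ''in''" "reals \<sigma>1 ''vt'' = reals \<sigma> ''vt''" "nats \<sigma>1 ''n'' = nats \<sigma> ''n''"
    using runs_frame[OF r1] by (simp_all add: frame_def find_heaviest_def compare_arc_def)
  have rdy1: "ready \<sigma>1"
    by (rule ready_frame[OF runs_frame[OF r1] r]) (simp_all add: find_heaviest_def compare_arc_def)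
  have g1: "grows \<sigma> \<sigma>1" "sound \<sigma>1" using f1 inv'(1) by (simp_all add: grows_same sound_same)
  show ?thesis
  proof (cases "nat0 \<sigma>1 ''bi'' = 0")
    case True
    then have none: "\<forall>g<m. \<not> crosses G g (visited \<sigma>)" using bi by auto
    have "\<not> {..<n} \<subseteq> visited \<sigma>" using card_mono[OF fin, of "{..<n}"] inv'(3) k by force
    then obtain v where v: "v < n" "v \<notin> visited \<sigma>" by blast
    then have "nat1 \<sigma> ''in'' v = 0" by (simp add: visited_def)
    with v(1) obtain \<sigma>2 u where r2: "runs visit_root \<sigma>1 (4 * n + 10) 0 \<sigma>2" and u: "u < n" "nat1 \<sigma> ''in'' u = 0"
      and in2: "nat1 \<sigma>2 ''in'' = (nat1 \<sigma> ''in'')(u := 1)"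
      using runs_visit_root[of \<sigma>1 v] inp unfolding f1 by (auto simp: input_stored_def)
    have g2: "grows \<sigma> \<sigma>2" "sound \<sigma>2" "reals \<sigma>2 ''vt'' = reals \<sigma> ''vt''"
      using runs_frame[OF r2] f1 inv'(1) by (simp_all add: grows_def sound_def frame_def visit_root_def compare_vertex_def)
    have in2': "nat1 \<sigma>2 ''in'' v = (if v = u then 1 else nat1 \<sigma> ''in'' v)" for v using fun_cong[OF in2, of v] by simp
    have vis: "visited \<sigma>2 = insert u (visited \<sigma>)" using u(1) in2' by (auto simp: visited_def split: if_splits)
    have "card (visited \<sigma>2) = Suc k" unfolding vis using u(2) inv'(3) fin by (simp add: visited_def)
    moreover have "forest_inv G w (visited \<sigma>2) F"
      unfolding vis by (rule forest_inv_root[OF F(2)]) (use none arcs_eq in auto)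
    moreover have "\<forall>e\<in>F. arc_cut_recorded \<sigma>2 e" using F(1,3) arc_cut_recorded_grows[OF _ g2(1)] by auto
    ultimately have st: "forest_stored w (Suc k) \<sigma>2"
      unfolding forest_stored_def using g2(2) inv'(2) in2' F(1) by auto
    have "runs (Cond (NLess (NConst 0) (N0 ''bi'')) (visit_arc ;; cut_arc) visit_root) \<sigma>1 (4 * n + 10 + 1) 0 \<sigma>2"
      by (rule runs_Cond) (use True r2 in simp_all)
    then have "runs forest_step \<sigma> (6 * m + 10 + (4 * n + 10 + 1)) (0 + 0) \<sigma>2"
      unfolding forest_step_def by (rule runs_Seq[OF r1])
    then have "runs forest_step \<sigma> (2000 * (n + m)) 1 \<sigma>2" by (rule runs_mono) (use n_ge_2 in auto)
    then show ?thesis using g2(1) st by blast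
  next
    case False
    then obtain g where g: "g < m" "nat0 \<sigma>1 ''bi'' = Suc g" "crosses G g (visited \<sigma>)"
      "\<forall>h<m. crosses G h (visited \<sigma>) \<longrightarrow> w h \<le> w g" using bi by auto
    define \<sigma>2 where "\<sigma>2 = effect visit_arc \<sigma>1"
    have r2: "runs visit_arc \<sigma>1 4 0 \<sigma>2"
      unfolding \<sigma>2_def by (rule runs_mono[OF runs_effect]) (simp_all add: visit_arc_def)
    have th: "nat1 \<sigma>1 ''tail'' g = tail G g" "nat1 \<sigma>1 ''head'' g = head G g"
      using rdy1 g(1) by (simp_all add: ready_def input_stored_def)
    have v2: "nat0 \<sigma>2 ''a'' = tail G g" "nat0 \<sigma>2 ''b'' = head G g"
      and in2: "\<And>v. nat1 \<sigma>2 ''in'' v = (if v = tail G g \<or> v = head G g then 1 else nat1 \<sigma> ''in'' v)"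
      using g(2) th f1(1) by (simp_all add: \<sigma>2_def visit_arc_def)
    have rdy2: "ready \<sigma>2"
      by (rule ready_frame[OF runs_frame[OF r2] rdy1]) (simp_all add: visit_arc_def)
    have "reals \<sigma>2 = reals \<sigma>1" by (simp add: \<sigma>2_def visit_arc_def)
    then have g2: "grows \<sigma> \<sigma>2" "sound \<sigma>2" using f1 inv'(1) by (simp_all add: grows_same sound_same)
    have ne: "tail G g \<noteq> head G g" using g(3) by (auto simp: crosses_def)
    obtain \<sigma>3 where r3: "runs cut_arc \<sigma>2 (1000 * (n + m) + 1) 1 \<sigma>3" and s3: "sound \<sigma>3" "grows \<sigma>2 \<sigma>3"
      "arc_cut_recorded \<sigma>3 g"
      using runs_cut_arc[OF rdy2 g2(2) g(1) ne v2] by blast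
    have in3: "nats \<sigma>3 ''in'' = nats \<sigma>2 ''in''" using runs_frame[OF r3] by (simp add: frame_def cut_arc_def)
    have g3: "grows \<sigma> \<sigma>3" by (rule grows_trans[OF g2(1) s3(2)])
    have vis: "visited \<sigma>3 = visited \<sigma> \<union> {tail G g, head G g}"
      using ends_less[OF g(1)] by (auto simp: visited_def in3 in2)
    \<comment> \<open>The arc \<open>g\<close> crosses the visited set, so exactly one of its ends
      is new.\<close>
    have "\<exists>q. q \<notin> visited \<sigma> \<and> visited \<sigma>3 = insert q (visited \<sigma>)"
      unfolding vis using g(3) unfolding crosses_def by blast
    then have "card (visited \<sigma>3) = Suc k" using inv'(3) fin by auto
    moreover have "forest_inv G w (visited \<sigma>3) (insert g F)"
      unfolding vis by (rule forest_inv_arc[OF F(2) _ g(3)]) (use g arcs_eq in auto)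
    moreover have "\<forall>e\<in>insert g F. arc_cut_recorded \<sigma>3 e"
      using F(1,3) arc_cut_recorded_grows[OF _ g3] s3(3) by auto
    moreover have "insert g F \<subseteq> {..<m}" using F(1) g(1) by simp
    moreover have "\<forall>v<n. nat1 \<sigma>3 ''in'' v \<le> 1" using inv'(2) by (simp add: in3 in2)
    ultimately have st: "forest_stored w (Suc k) \<sigma>3" unfolding forest_stored_def using s3(1) by blast
    have "runs (visit_arc ;; cut_arc) \<sigma>1 (4 + (1000 * (n + m) + 1)) (0 + 1) \<sigma>3" by (rule runs_Seq[OF r2 r3])
    then have "runs (Cond (NLess (NConst 0) (N0 ''bi'')) (visit_arc ;; cut_arc) visit_root) \<sigma>1
        (4 + (1000 * (n + m) + 1) + 1) (0 + 1) \<sigma>3"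
      by (intro runs_Cond) (use g(2) in simp_all)
    then have "runs forest_step \<sigma> (6 * m + 10 + (4 + (1000 * (n + m) + 1) + 1)) (0 + (0 + 1)) \<sigma>3"
      unfolding forest_step_def by (rule runs_Seq[OF r1])
    then have "runs forest_step \<sigma> (2000 * (n + m)) 1 \<sigma>3" by (rule runs_mono) (use n_ge_2 in auto)
    then show ?thesis using g3 st by blast
  qed
qed

lemma runs_build_forest:
  assumes r: "ready \<sigma>" "sound \<sigma>" and w: "\<forall>i<m. real1 \<sigma> ''wt'' i = w i \<and> 0 \<le> w i"
    and new: "\<forall>v. nat1 \<sigma> ''in'' v = 0"
  shows "\<exists>\<sigma>'. runs build_forest \<sigma> (3000 * (n * (n + m))) n \<sigma>' \<and> sound \<sigma>' \<and> grows \<sigma> \<sigma>' \<and>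
    (\<forall>e<m. \<forall>X. bottleneck G w e X \<longrightarrow> arc_cut_recorded \<sigma>' e)"
proof -
  have z: "forest_stored w k (nwrite ''z'' 0 0 j \<rho>) = forest_stored w k \<rho>"
    "grows \<sigma> (nwrite ''z'' 0 0 j \<rho>) = grows \<sigma> \<rho>" for k j \<rho>
    by (simp_all add: forest_stored_def sound_def visited_def arc_cut_recorded_def grows_def)
  define Inv where "Inv k \<rho> \<longleftrightarrow> grows \<sigma> \<rho> \<and> forest_stored w k \<rho>" for k and \<rho> :: memory
  have "\<exists>\<sigma>'. runs (For ''z'' ''n'' forest_step) \<sigma> (n * (2000 * (n + m) + 2) + 2) (n * 1) \<sigma>' \<and> Inv n \<sigma>'"
  proof (rule runs_For, goal_cases)
    case 1
    show ?case using r by (simp add: ready_def input_stored_def)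
  next
    case 5
    have "visited \<sigma> = {}" using new by (simp add: visited_def)
    then have "forest_stored w 0 \<sigma>" using r(2) new by (auto simp: forest_stored_def forest_inv_def)
    then show ?case by (simp add: Inv_def z grows_same)
  next
    case (6 k \<rho>)
    have "ready \<rho>" using ready_frame[OF 6(4) r(1)] by simp
    moreover have "reals \<rho> ''wt'' = reals \<sigma> ''wt''" using 6(4) by (simp add: frame_def)
    ultimately obtain \<sigma>' where "runs forest_step \<rho> (2000 * (n + m)) 1 \<sigma>'" "grows \<rho> \<sigma>'" "forest_stored w (Suc k) \<sigma>'"
      using runs_forest_step[of \<rho> w k] 6(1,2) w unfolding Inv_def by auto
    then show ?case using grows_trans 6(2) by (intro exI[of _ \<sigma>']) (auto simp: Inv_def z)
  qed simp_all
  then obtain \<sigma>' where \<sigma>': "runs build_forest \<sigma> (n * (2000 * (n + m) + 2) + 2) (n * 1) \<sigma>'" "Inv n \<sigma>'"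
    unfolding build_forest_def by blast
  have g: "grows \<sigma> \<sigma>'" "sound \<sigma>'" and card: "card (visited \<sigma>') = n"
    using \<sigma>'(2) by (auto simp: Inv_def forest_stored_def)
  obtain F where F: "forest_inv G w (visited \<sigma>') F" "\<forall>e\<in>F. arc_cut_recorded \<sigma>' e"
    using \<sigma>'(2) by (auto simp: Inv_def forest_stored_def)
  have "visited \<sigma>' \<subseteq> {..<n}" by (auto simp: visited_def)
  then have "visited \<sigma>' = {..<n}" using card card_subset_eq[of "{..<n}"] by simp
  then have "arc_cut_recorded \<sigma>' e" if "e < m" "bottleneck G w e X" for e X
    using forest_inv_all[OF F(1) _ that(2)] that(1) ends_less[OF that(1)] F(2) arcs_eq by simp
  moreover have "runs build_forest \<sigma> (3000 * (n * (n + m))) n \<sigma>'"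
  proof (rule runs_mono[OF \<sigma>'(1)])
    have "n * 2 \<le> n * (n + m)" using n_ge_2 by (intro mult_left_mono) auto
    moreover have "n * (2000 * (n + m) + 2) + 2 = 2000 * (n * (n + m)) + n * 2 + 2" by (simp add: algebra_simps)
    moreover have "2 \<le> n * 2" using n_ge_2 by simp
    ultimately show "n * (2000 * (n + m) + 2) + 2 \<le> 3000 * (n * (n + m))" by linarith
  qed simp
  ultimately show ?thesis using g by blast
qed

text \<open>Soundness gives one inequality. For the other, the forest covers a vital arc that enters
  some cheap cut, and the tree covers it otherwise.\<close>

lemma vitality_computed:
  assumes f: "max_st_flow G c s t f" and sound: "sound \<sigma>"
    and tree: "pairs_recorded \<sigma>"
    and forest: "\<forall>e<m. \<forall>X. bottleneck G (\<lambda>e. min (f e) (c e - f e)) e X \<longrightarrow> arc_cut_recorded \<sigma> e"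
    and e: "e < m"
  shows "real1 \<sigma> ''vt'' e = vitality G c s t e"
proof (rule antisym)
  have earc: "e \<in> arcs G" using e arcs_eq by simp
  show "real1 \<sigma> ''vt'' e \<le> vitality G c s t e" using sound e by (simp add: sound_def)
  show "vitality G c s t e \<le> real1 \<sigma> ''vt'' e"
  proof (cases "0 < vitality G c s t e")
    case False
    then show ?thesis using sound e by (force simp: sound_def)
  next
    case True
    obtain C where C: "st_cut G s t C" "e \<in> leaving G C"
      "vitality G c s t e = mincut_capacity G c s t + c e - cut_capacity G c C"
      using vital_cut[OF earc True] .
    show ?thesis
    proof (cases "\<exists>D. st_cut G s t D \<and> e \<in> entering G D \<and> cut_capacity G c D < mincut_capacity G c s t + c e")
      case True
      then obtain X where "(tail G e \<in> X) \<noteq> (head G e \<in> X)"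
        "\<And>g. g \<in> arcs G \<Longrightarrow> (tail G g \<in> X) \<noteq> (head G g \<in> X) \<Longrightarrow> g \<noteq> e \<Longrightarrow>
           min (f g) (c g - f g) < min (f e) (c e - f e)"
        using loose_vital_arc_bottleneck[OF f earc \<open>0 < vitality G c s t e\<close>] by blast
      then have "bottleneck G (\<lambda>e. min (f e) (c e - f e)) e X"
        unfolding bottleneck_def crosses_def by blast
      then have "arc_cut_recorded \<sigma> e" using forest e by blast
      then show ?thesis using C by (simp add: arc_cut_recorded_def)
    next
      case False
      have sep: "separates C (tail G e) (head G e)" and ne: "tail G e \<noteq> head G e"
        using C(2) by (auto simp: leaving_def separates_def)
      obtain K where K: "st_cut G s t K" "separates K (tail G e) (head G e)" "recorded \<sigma> K"
        "\<forall>D. st_cut G s t D \<longrightarrow> separates D (tail G e) (head G e) \<longrightarrow> cut_capacity G c K \<le> cut_capacity G c D"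
        using tree ends_less[OF e] ne unfolding pairs_recorded_def by blast
      \<comment> \<open>\<open>K\<close> is at most as expensive as \<open>C\<close>, which is
        cheaper than \<open>mincut_capacity G c s t + c e\<close>. It is therefore not entered by
        \<open>e\<close>, and since it separates the ends of \<open>e\<close>, it is left by
        \<open>e\<close>.\<close>
      have le: "cut_capacity G c K \<le> cut_capacity G c C" using K(4) C(1) sep by blast
      then have "e \<notin> entering G K" using False K(1) C(3) True by force
      then have "e \<in> leaving G K" using K(2) earc by (auto simp: leaving_def entering_def separates_def)
      then show ?thesis using K(3) le C(3) unfolding recorded_def by force
    qed
  qed
qed

end

section \<open>Selection\<close>

definition improve_row :: com where
  "improve_row =
     NSet ''j'' (NCell ''A'' (N0 ''u'') (N0 ''h'')) ;;
     If_then (NLess (NConst 0) (N0 ''j''))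
       (If_then (BOr (NEq (N1 ''gm'' (N0 ''u'')) (NConst 0))
           (RLess (R1 ''vt'' (NDec (N1 ''gm'' (N0 ''u'')))) (R1 ''vt'' (NDec (N0 ''j'')))))
         (NSet1 ''gm'' (N0 ''u'') (N0 ''j'')))"

definition row_maximum :: com where
  "row_maximum = NSet1 ''gm'' (N0 ''u'') (NConst 0) ;; For ''h'' ''n'' improve_row"

definition fill_entry :: com where
  "fill_entry =
     NAssign ''A'' (N1 ''tail'' (N0 ''i'')) (N1 ''head'' (N0 ''i'')) (NInc (N0 ''i''))"

definition fill_matrix :: com where
  "fill_matrix = For ''i'' ''m'' fill_entry"

definition compare_row :: com where
  "compare_row =
     NSet ''j'' (N1 ''gm'' (N0 ''z'')) ;;
     If_then (NLess (NConst 0) (N0 ''j''))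
      (If_then (BOr (NEq (N0 ''ob'') (NConst 0))
          (RLess (R1 ''vt'' (NDec (N0 ''ob''))) (R1 ''vt'' (NDec (N0 ''j'')))))
        (NSet ''ob'' (N0 ''j'')))"

definition best_row :: com where
  "best_row = NSet ''ob'' (NConst 0) ;;
     For ''z'' ''n'' compare_row"

definition extract_best :: com where
  "extract_best =
     (NSet ''out'' (NDec (N0 ''ob'')) ;;
      NSet ''u'' (N1 ''tail'' (N0 ''out'')) ;;
      NAssign ''A'' (N0 ''u'') (N1 ''head'' (N0 ''out'')) (NConst 0))"

text \<open>In the absence of parallel arcs, an arc is addressed by its ends in an \<open>n\<close>
  by \<open>n\<close> matrix. Filling the row maxima costs O(n^2) steps; each extraction repairs a
  single row and costs O(n), so \<open>k \<le> m\<close> extractions stay within the budget.\<close>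

definition select_kth :: com where
  "select_kth = fill_matrix ;; For ''u'' ''n'' row_maximum ;;
     For ''r'' ''k'' (best_row ;; extract_best ;; row_maximum)"

section \<open>Selection by row maxima\<close>

context vitality_program
begin

text \<open>The arcs in \<open>R\<close> are still to be selected; pointers to arcs are shifted by one.\<close>

definition matrix_of :: "nat set \<Rightarrow> memory \<Rightarrow> bool" where
  "matrix_of R \<sigma> \<longleftrightarrow> R \<subseteq> {..<m} \<and> (\<forall>u<n. \<forall>h<n.
     (nats \<sigma> ''A'' u h = 0 \<longrightarrow> (\<forall>i\<in>R. \<not> (tail G i = u \<and> head G i = h))) \<and>
     (\<forall>i. nats \<sigma> ''A'' u h = Suc i \<longrightarrow> i \<in> R \<and> tail G i = u \<and> head G i = h))"

definition max_pointer :: "(nat \<Rightarrow> real) \<Rightarrow> nat set \<Rightarrow> nat \<Rightarrow> bool" where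
  "max_pointer v X j \<longleftrightarrow> (j = 0 \<and> X = {} \<or> (\<exists>i\<in>X. j = Suc i \<and> (\<forall>x\<in>X. v x \<le> v i)))"

lemma max_pointer_insert:
  assumes "max_pointer v X j"
  shows "max_pointer v (insert i X) (if j = 0 \<or> v (j - 1) < v i then Suc i else j)"
  using assms unfolding max_pointer_def by (auto intro: order_trans less_imp_le)

lemma runs_fill_matrix:
  assumes "input_stored \<sigma>" and "\<forall>u h. nats \<sigma> ''A'' u h = 0"
  shows "\<exists>\<sigma>'. runs fill_matrix \<sigma> (3 * m + 2) 0 \<sigma>' \<and> matrix_of {..<m} \<sigma>'"
proof -
  define Inv where "Inv k \<rho> \<longleftrightarrow> k \<le> m \<and> matrix_of {..<k} \<rho>" for k and \<rho> :: memory
  have "\<exists>\<sigma>'. runs (For ''i'' ''m'' fill_entry) \<sigma> (m * (cost fill_entry + 2) + 2) 0 \<sigma>' \<and> Inv m \<sigma>'"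
  proof (rule runs_For_straight, goal_cases)
    case (7 k \<rho>)
    have f: "nats \<rho> ''tail'' = nats \<sigma> ''tail''" "nats \<rho> ''head'' = nats \<sigma> ''head''"
      using 7(4) by (simp_all add: frame_def fill_entry_def)
    have th: "nat1 \<sigma> ''tail'' k = tail G k" "nat1 \<sigma> ''head'' k = head G k"
      using assms(1) 7(1) by (simp_all add: input_stored_def)
    have A: "nats (effect fill_entry \<rho>) ''A'' u h = (if u = tail G k \<and> h = head G k then Suc k else nats \<rho> ''A'' u h)" for u h
      using f th 7(3) by (simp add: fill_entry_def)
    have M: "matrix_of {..<k} \<rho>" using 7(2) by (simp add: Inv_def)
    have "matrix_of {..<Suc k} (effect fill_entry \<rho>)"
      unfolding matrix_of_def
    proof (intro conjI allI impI)
      show "{..<Suc k} \<subseteq> {..<m}" using 7(1) by auto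
      fix u h assume uh: "u < n" "h < n"
      note M' = M[unfolded matrix_of_def, THEN conjunct2, rule_format, OF uh]
      show "\<forall>i\<in>{..<Suc k}. \<not> (tail G i = u \<and> head G i = h)" if "nats (effect fill_entry \<rho>) ''A'' u h = 0"
      proof -
        have ne: "\<not> (u = tail G k \<and> h = head G k)" using that unfolding A by auto
        then have "nats \<rho> ''A'' u h = 0" using that unfolding A by metis
        then have "\<forall>i\<in>{..<k}. \<not> (tail G i = u \<and> head G i = h)" using M'[THEN conjunct1] by blast
        then show ?thesis using ne unfolding lessThan_Suc by blast
      qed
      fix i assume i: "nats (effect fill_entry \<rho>) ''A'' u h = Suc i"
      have "i \<in> {..<Suc k} \<and> tail G i = u \<and> head G i = h"
      proof (cases "u = tail G k \<and> h = head G k")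
        case True
        then show ?thesis using i unfolding A by simp
      next
        case False
        then have "nats \<rho> ''A'' u h = Suc i" using i unfolding A by metis
        then show ?thesis using M'[THEN conjunct2, rule_format, of i] by simp
      qed
      then show "i \<in> {..<Suc k}" "tail G i = u" "head G i = h" by simp_all
    qed
    then show ?case using 7(1) by (simp add: Inv_def matrix_of_def)
  qed (use assms in \<open>simp_all add: fill_entry_def Inv_def matrix_of_def input_stored_def\<close>)
  moreover have "m * (cost fill_entry + 2) + 2 = 3 * m + 2" by (simp add: fill_entry_def)
  ultimately show ?thesis unfolding fill_matrix_def Inv_def by metis
qed

definition row_arcs :: "nat set \<Rightarrow> nat \<Rightarrow> nat set" where
  "row_arcs R u = {i \<in> R. tail G i = u}"

lemma runs_row_maximum:
  assumes "nat0 \<sigma> ''n'' = n" "nat0 \<sigma> ''u'' = u" "u < n" and M: "matrix_of R \<sigma>"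
  shows "\<exists>\<sigma>'. runs row_maximum \<sigma> (10 * n) 0 \<sigma>' \<and> max_pointer (real1 \<sigma> ''vt'') (row_arcs R u) (nat1 \<sigma>' ''gm'' u) \<and>
    (\<forall>v. v \<noteq> u \<longrightarrow> nat1 \<sigma>' ''gm'' v = nat1 \<sigma> ''gm'' v)"
proof -
  let ?P = "NSet1 ''gm'' (N0 ''u'') (NConst 0)"
  define \<sigma>1 where "\<sigma>1 = effect ?P \<sigma>"
  have r1: "runs ?P \<sigma> 1 0 \<sigma>1" unfolding \<sigma>1_def by (rule runs_mono[OF runs_effect]) simp_all
  have sub: "R \<subseteq> {..<m}" using M by (simp add: matrix_of_def)
  define Inv where "Inv k \<rho> \<longleftrightarrow>
      max_pointer (real1 \<sigma> ''vt'') {i \<in> R. tail G i = u \<and> head G i < k} (nat1 \<rho> ''gm'' u) \<and>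
      (\<forall>v. v \<noteq> u \<longrightarrow> nat1 \<rho> ''gm'' v = nat1 \<sigma> ''gm'' v)" for k and \<rho> :: memory
  have "\<exists>\<sigma>'. runs (For ''h'' ''n'' improve_row) \<sigma>1 (n * (cost improve_row + 2) + 2) 0 \<sigma>' \<and> Inv n \<sigma>'"
  proof (rule runs_For_straight, goal_cases)
    case (7 k \<rho>)
    have f: "nats \<rho> ''A'' = nats \<sigma> ''A''" "reals \<rho> ''vt'' = reals \<sigma> ''vt''" "nat0 \<rho> ''u'' = u"
      using 7(4) assms(2) by (simp_all add: frame_def improve_row_def \<sigma>1_def)
    note M' = M[unfolded matrix_of_def, THEN conjunct2, rule_format, OF assms(3) 7(1)]
    let ?v = "real1 \<sigma> ''vt''" and ?j = "nat1 \<rho> ''gm'' u" and ?a = "nats \<sigma> ''A'' u k"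
    have gm: "nat1 (effect improve_row \<rho>) ''gm'' w = (if w = u \<and> 0 < ?a \<and> (?j = 0 \<or> ?v (?j - 1) < ?v (?a - 1)) then ?a
        else nat1 \<rho> ''gm'' w)" for w
      using f 7(3) by (simp add: improve_row_def)
    have I: "max_pointer ?v {i \<in> R. tail G i = u \<and> head G i < k} ?j"
      "\<forall>v. v \<noteq> u \<longrightarrow> nat1 \<rho> ''gm'' v = nat1 \<sigma> ''gm'' v" using 7(2) by (auto simp: Inv_def)
    have "max_pointer ?v {i \<in> R. tail G i = u \<and> head G i < Suc k} (nat1 (effect improve_row \<rho>) ''gm'' u)"
    proof (cases ?a)
      case 0
      then have "{i \<in> R. tail G i = u \<and> head G i < Suc k} = {i \<in> R. tail G i = u \<and> head G i < k}"
        using M'[THEN conjunct1] by (auto simp: less_Suc_eq)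
      then show ?thesis using I(1) 0 by (simp add: gm)
    next
      case (Suc i)
      then have i: "i \<in> R" "tail G i = u" "head G i = k" using M'[THEN conjunct2] by auto
      \<comment> \<open>A matrix entry holds the only arc with its ends, so one more column adds at
        most one arc.\<close>
      have uniq: "i' = i" if "i' \<in> R" "tail G i' = u" "head G i' = k" for i'
      proof (rule nomulti)
        show "i' \<in> arcs G" "i \<in> arcs G" using that(1) i(1) sub unfolding arcs_eq by blast+
      qed (simp_all add: that i)
      have "{i \<in> R. tail G i = u \<and> head G i < Suc k} = insert i {i \<in> R. tail G i = u \<and> head G i < k}"
        unfolding less_Suc_eq using i uniq by blast
      then show ?thesis using max_pointer_insert[OF I(1), of i] Suc by (auto simp: gm split: if_splits)
    qed
    then show ?case using I(2) by (simp add: Inv_def gm)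
  qed (use assms in \<open>simp_all add: improve_row_def Inv_def max_pointer_def \<sigma>1_def\<close>)
  then obtain \<sigma>2 where \<sigma>2: "runs (For ''h'' ''n'' improve_row) \<sigma>1 (n * (cost improve_row + 2) + 2) 0 \<sigma>2" "Inv n \<sigma>2"
    by blast
  have "{i \<in> R. tail G i = u \<and> head G i < n} = row_arcs R u" using sub by (auto simp: row_arcs_def ends_less)
  then have "max_pointer (real1 \<sigma> ''vt'') (row_arcs R u) (nat1 \<sigma>2 ''gm'' u)"
    "\<forall>v. v \<noteq> u \<longrightarrow> nat1 \<sigma>2 ''gm'' v = nat1 \<sigma> ''gm'' v"
    using \<sigma>2(2) by (simp_all add: Inv_def)
  moreover have "runs row_maximum \<sigma> (10 * n) 0 \<sigma>2"
    unfolding row_maximum_def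
    by (rule runs_mono[OF runs_Seq[OF r1 \<sigma>2(1)]]) (use n_ge_2 in \<open>simp_all add: improve_row_def\<close>)
  ultimately show ?thesis by blast
qed

definition rows_stored :: "nat set \<Rightarrow> memory \<Rightarrow> bool" where
  "rows_stored R \<sigma> \<longleftrightarrow> matrix_of R \<sigma> \<and>
     (\<forall>u<n. max_pointer (real1 \<sigma> ''vt'') (row_arcs R u) (nat1 \<sigma> ''gm'' u))"

lemma writes_row_maximum [simp]:
  "nat_writes row_maximum = {''gm'', ''h'', ''j''}" "real_writes row_maximum = {}"
  by (auto simp: row_maximum_def improve_row_def)

lemma runs_all_rows:
  assumes "nat0 \<sigma> ''n'' = n" and M: "matrix_of R \<sigma>"
  shows "\<exists>\<sigma>'. runs (For ''u'' ''n'' row_maximum) \<sigma> (n * (10 * n + 2) + 2) 0 \<sigma>' \<and> rows_stored R \<sigma>'"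
proof -
  define Inv where "Inv k \<rho> \<longleftrightarrow>
      (\<forall>u<k. max_pointer (real1 \<sigma> ''vt'') (row_arcs R u) (nat1 \<rho> ''gm'' u))" for k and \<rho> :: memory
  have "\<exists>\<sigma>'. runs (For ''u'' ''n'' row_maximum) \<sigma> (n * (10 * n + 2) + 2) (n * 0) \<sigma>' \<and> Inv n \<sigma>'"
  proof (rule runs_For, goal_cases)
    case (6 k \<rho>)
    have f: "nats \<rho> ''A'' = nats \<sigma> ''A''" "reals \<rho> ''vt'' = reals \<sigma> ''vt''" "nat0 \<rho> ''n'' = n"
      using 6(4) assms(1) by (simp_all add: frame_def)
    have "matrix_of R \<rho>" using M f(1) by (simp add: matrix_of_def)
    then obtain \<sigma>' where "runs row_maximum \<rho> (10 * n) 0 \<sigma>'"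
      "max_pointer (real1 \<sigma> ''vt'') (row_arcs R k) (nat1 \<sigma>' ''gm'' k)"
      "\<forall>v. v \<noteq> k \<longrightarrow> nat1 \<sigma>' ''gm'' v = nat1 \<rho> ''gm'' v"
      using runs_row_maximum[OF f(3) 6(3,1)] unfolding f(2) by blast
    then show ?case using 6(2) by (intro exI[of _ \<sigma>']) (auto simp: Inv_def less_Suc_eq)
  qed (use assms in \<open>simp_all add: Inv_def\<close>)
  then obtain \<sigma>' where \<sigma>': "runs (For ''u'' ''n'' row_maximum) \<sigma> (n * (10 * n + 2) + 2) 0 \<sigma>'" "Inv n \<sigma>'" by auto
  have "nats \<sigma>' ''A'' = nats \<sigma> ''A''" "reals \<sigma>' ''vt'' = reals \<sigma> ''vt''"
    using runs_frame[OF \<sigma>'(1)] by (simp_all add: frame_def)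
  then have "rows_stored R \<sigma>'" using \<sigma>'(2) M by (simp add: rows_stored_def Inv_def matrix_of_def)
  then show ?thesis using \<sigma>'(1) by blast
qed

lemma runs_best_row:
  assumes "nat0 \<sigma> ''n'' = n" and rows: "rows_stored R \<sigma>"
  shows "\<exists>\<sigma>'. runs best_row \<sigma> (10 * n) 0 \<sigma>' \<and> max_pointer (real1 \<sigma> ''vt'') R (nat0 \<sigma>' ''ob'')"
proof -
  let ?P = "NSet ''ob'' (NConst 0)"
  let ?v = "real1 \<sigma> ''vt''"
  define \<sigma>1 where "\<sigma>1 = effect ?P \<sigma>"
  have r1: "runs ?P \<sigma> 1 0 \<sigma>1" unfolding \<sigma>1_def by (rule runs_mono[OF runs_effect]) simp_all
  have sub: "R \<subseteq> {..<m}" using rows by (simp add: rows_stored_def matrix_of_def)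
  define Inv where "Inv k \<rho> \<longleftrightarrow> max_pointer ?v {i \<in> R. tail G i < k} (nat0 \<rho> ''ob'')" for k and \<rho> :: memory
  have "\<exists>\<sigma>'. runs (For ''z'' ''n'' compare_row) \<sigma>1 (n * (cost compare_row + 2) + 2) 0 \<sigma>' \<and> Inv n \<sigma>'"
  proof (rule runs_For_straight, goal_cases)
    case (7 k \<rho>)
    have f: "nats \<rho> ''gm'' = nats \<sigma> ''gm''" "reals \<rho> ''vt'' = reals \<sigma> ''vt''"
      using 7(4) by (simp_all add: frame_def compare_row_def \<sigma>1_def)
    let ?o = "nat0 \<rho> ''ob''" and ?j = "nat1 \<sigma> ''gm'' k"
    have ob: "nat0 (effect compare_row \<rho>) ''ob'' = (if 0 < ?j \<and> (?o = 0 \<or> ?v (?o - 1) < ?v (?j - 1)) then ?j else ?o)"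
      using f 7(3) by (simp add: compare_row_def)
    have row: "max_pointer ?v (row_arcs R k) ?j" using rows 7(1) by (simp add: rows_stored_def)
    have I: "max_pointer ?v {i \<in> R. tail G i < k} ?o" using 7(2) by (simp add: Inv_def)
    have un: "{i \<in> R. tail G i < Suc k} = {i \<in> R. tail G i < k} \<union> row_arcs R k"
      by (auto simp: row_arcs_def less_Suc_eq)
    have "max_pointer ?v {i \<in> R. tail G i < Suc k} (nat0 (effect compare_row \<rho>) ''ob'')"
    proof (cases ?j)
      case 0
      then have "row_arcs R k = {}" using row by (auto simp: max_pointer_def)
      then show ?thesis unfolding un using I 0 by (simp add: ob)
    next
      case (Suc i)
      then have i: "i \<in> row_arcs R k" "\<forall>x\<in>row_arcs R k. ?v x \<le> ?v i" using row by (auto simp: max_pointer_def)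
      have "max_pointer ?v (insert i {i \<in> R. tail G i < k}) (nat0 (effect compare_row \<rho>) ''ob'')"
        using max_pointer_insert[OF I, of i] Suc by (auto simp: ob split: if_splits)
      then show ?thesis unfolding un using i unfolding max_pointer_def by (auto; meson order_trans)
    qed
    then show ?case by (simp add: Inv_def)
  qed (use assms in \<open>simp_all add: compare_row_def Inv_def max_pointer_def \<sigma>1_def\<close>)
  then obtain \<sigma>2 where \<sigma>2: "runs (For ''z'' ''n'' compare_row) \<sigma>1 (n * (cost compare_row + 2) + 2) 0 \<sigma>2" "Inv n \<sigma>2"
    by blast
  have "{i \<in> R. tail G i < n} = R" using sub by (auto simp: ends_less)
  then have "max_pointer ?v R (nat0 \<sigma>2 ''ob'')" using \<sigma>2(2) by (simp add: Inv_def)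
  moreover have "runs best_row \<sigma> (10 * n) 0 \<sigma>2"
    unfolding best_row_def
    by (rule runs_mono[OF runs_Seq[OF r1 \<sigma>2(1)]]) (use n_ge_2 in \<open>simp_all add: compare_row_def\<close>)
  ultimately show ?thesis by blast
qed

text \<open>Removing the selected arc affects only the row of its tail; all other row maxima remain
  valid.\<close>

lemma runs_select_step:
  assumes inp: "input_stored \<sigma>" and rows: "rows_stored R \<sigma>" and "R \<noteq> {}"
  shows "\<exists>\<sigma>' i. runs (best_row ;; extract_best ;; row_maximum) \<sigma> (20 * n + 3) 0 \<sigma>' \<and> i \<in> R \<and>
    (\<forall>x\<in>R. real1 \<sigma> ''vt'' x \<le> real1 \<sigma> ''vt'' i) \<and> nat0 \<sigma>' ''out'' = i \<and> rows_stored (R - {i}) \<sigma>'"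
proof -
  have n: "nat0 \<sigma> ''n'' = n" using inp by (simp add: input_stored_def)
  obtain \<sigma>1 where r1: "runs best_row \<sigma> (10 * n) 0 \<sigma>1" and ob: "max_pointer (real1 \<sigma> ''vt'') R (nat0 \<sigma>1 ''ob'')"
    using runs_best_row[OF n rows] by blast
  then obtain i where i: "nat0 \<sigma>1 ''ob'' = Suc i" "i \<in> R" "\<forall>x\<in>R. real1 \<sigma> ''vt'' x \<le> real1 \<sigma> ''vt'' i"
    using \<open>R \<noteq> {}\<close> by (auto simp: max_pointer_def)
  have f1: "nats \<sigma>1 ''A'' = nats \<sigma> ''A''" "reals \<sigma>1 ''vt'' = reals \<sigma> ''vt''" "nats \<sigma>1 ''gm'' = nats \<sigma> ''gm''"
    "input_stored \<sigma>1"
    using runs_frame[OF r1] input_stored_frame[OF runs_frame[OF r1] inp] by (simp_all add: frame_def best_row_def compare_row_def)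
  have M: "matrix_of R \<sigma>" and sub: "R \<subseteq> {..<m}"
    using rows by (auto simp: rows_stored_def matrix_of_def)
  have im: "i < m" using sub i(2) by auto
  define \<sigma>2 where "\<sigma>2 = effect extract_best \<sigma>1"
  have r2: "runs extract_best \<sigma>1 3 0 \<sigma>2"
    unfolding \<sigma>2_def by (rule runs_mono[OF runs_effect]) (simp_all add: extract_best_def)
  have th: "nat1 \<sigma>1 ''tail'' i = tail G i" "nat1 \<sigma>1 ''head'' i = head G i"
    using f1(4) im by (simp_all add: input_stored_def)
  have f2: "nat0 \<sigma>2 ''out'' = i" "nat0 \<sigma>2 ''u'' = tail G i" "reals \<sigma>2 ''vt'' = reals \<sigma> ''vt''"
    "nats \<sigma>2 ''gm'' = nats \<sigma> ''gm''" "nat0 \<sigma>2 ''n'' = n"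
    and A2: "\<And>u h. nats \<sigma>2 ''A'' u h = (if u = tail G i \<and> h = head G i then 0 else nats \<sigma> ''A'' u h)"
    using i(1) th f1 by (simp_all add: \<sigma>2_def extract_best_def input_stored_def)
  have M2: "matrix_of (R - {i}) \<sigma>2"
    unfolding matrix_of_def
  proof (intro conjI allI impI)
    show "R - {i} \<subseteq> {..<m}" using sub by auto
    fix u h assume uh: "u < n" "h < n"
    note M' = M[unfolded matrix_of_def, THEN conjunct2, rule_format, OF uh]
    show "\<forall>x\<in>R - {i}. \<not> (tail G x = u \<and> head G x = h)" if "nats \<sigma>2 ''A'' u h = 0"
    proof (cases "u = tail G i \<and> h = head G i")
      case True
      show ?thesis
      proof (intro ballI notI)
        fix x assume x: "x \<in> R - {i}" "tail G x = u \<and> head G x = h"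
        then have "x \<in> arcs G" "i \<in> arcs G" using sub im unfolding arcs_eq by auto
        then have "x = i" using nomulti[of x i] x(2) True by simp
        then show False using x(1) by blast
      qed
    next
      case False
      then have "nats \<sigma> ''A'' u h = 0" using that unfolding A2 by metis
      then show ?thesis using M'[THEN conjunct1] by blast
    qed
    fix x assume x: "nats \<sigma>2 ''A'' u h = Suc x"
    then have ne: "\<not> (u = tail G i \<and> h = head G i)" unfolding A2 by auto
    then have "nats \<sigma> ''A'' u h = Suc x" using x unfolding A2 by metis
    then have "x \<in> R" "tail G x = u \<and> head G x = h" using M'[THEN conjunct2, rule_format, of x] by blast+
    then show "x \<in> R - {i}" "tail G x = u" "head G x = h" using ne by blast+
  qed
  obtain \<sigma>3 where r3: "runs row_maximum \<sigma>2 (10 * n) 0 \<sigma>3"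
    and gm: "max_pointer (real1 \<sigma> ''vt'') (row_arcs (R - {i}) (tail G i)) (nat1 \<sigma>3 ''gm'' (tail G i))"
      "\<forall>v. v \<noteq> tail G i \<longrightarrow> nat1 \<sigma>3 ''gm'' v = nat1 \<sigma>2 ''gm'' v"
    using runs_row_maximum[OF f2(5,2) _ M2] ends_less[OF im] unfolding f2(3) by blast
  have f3: "reals \<sigma>3 ''vt'' = reals \<sigma> ''vt''" "nats \<sigma>3 ''A'' = nats \<sigma>2 ''A''" "nat0 \<sigma>3 ''out'' = i"
    using runs_frame[OF r3] f2 by (simp_all add: frame_def)
  have "max_pointer (real1 \<sigma> ''vt'') (row_arcs (R - {i}) u) (nat1 \<sigma>3 ''gm'' u)" if "u < n" for u
  proof (cases "u = tail G i")
    case False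
    then have "row_arcs (R - {i}) u = row_arcs R u" by (auto simp: row_arcs_def)
    then show ?thesis using rows that False gm(2) f2(4) by (simp add: rows_stored_def)
  qed (use gm in simp)
  then have "rows_stored (R - {i}) \<sigma>3" using M2 f3 by (simp add: rows_stored_def matrix_of_def)
  moreover have "runs (best_row ;; extract_best ;; row_maximum) \<sigma> (20 * n + 3) 0 \<sigma>3"
    by (rule runs_mono[OF runs_Seq[OF r1 runs_Seq[OF r2 r3]]]) simp_all
  ultimately show ?thesis using i f3(3) by blast
qed

text \<open>The prefixes of enumerations by non-increasing value: by the last clause nothing left
  out exceeds a listed element, so the list can be continued in order.\<close>

definition selected :: "(nat \<Rightarrow> real) \<Rightarrow> nat list \<Rightarrow> bool" where
  "selected v es \<longleftrightarrow> distinct es \<and> set es \<subseteq> {..<m} \<and> sorted_wrt (\<lambda>a b. v a \<ge> v b) es \<and>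
     (\<forall>x\<in>set es. \<forall>y\<in>{..<m} - set es. v y \<le> v x)"

lemma selected_snoc:
  assumes "selected v es" "i < m" "i \<notin> set es" "\<forall>x\<in>{..<m} - set es. v x \<le> v i"
  shows "selected v (es @ [i])"
  using assms by (auto simp: selected_def sorted_wrt_append)

text \<open>The remaining arcs are sorted and appended. This happens in the proof only; the program
  stops after \<open>k\<close> extractions.\<close>

lemma selected_complete:
  assumes sel: "selected v es"
  obtains es' where "distinct (es @ es')" "set (es @ es') = {..<m}" "sorted_wrt (\<lambda>a b. v a \<ge> v b) (es @ es')"
proof -
  define es' where "es' = sort_key (\<lambda>x. - v x) (sorted_list_of_set ({..<m} - set es))"
  have set: "set es' = {..<m} - set es" by (simp add: es'_def)
  have "sorted (map (\<lambda>x. - v x) es')" unfolding es'_def by (rule sorted_sort_key)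
  then have "sorted_wrt (\<lambda>a b. v a \<ge> v b) es'" by (simp add: sorted_map)
  moreover have "distinct es'" by (simp add: es'_def)
  ultimately show ?thesis using that[of es'] sel set by (auto simp: selected_def sorted_wrt_append)
qed

lemma runs_select_kth:
  assumes inp: "input_stored \<sigma>" and A: "\<forall>u h. nats \<sigma> ''A'' u h = 0"
    and k: "nat0 \<sigma> ''k'' = k" "1 \<le> k" "k \<le> m"
    and vt: "\<forall>e<m. real1 \<sigma> ''vt'' e = vitality G c s t e"
  shows "\<exists>\<sigma>'. runs select_kth \<sigma> (100 * (n * (n + m))) 0 \<sigma>' \<and> kth_most_vital G c s t k (result \<sigma>')"
proof -
  obtain \<sigma>1 where r1: "runs fill_matrix \<sigma> (3 * m + 2) 0 \<sigma>1" and M1: "matrix_of {..<m} \<sigma>1"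
    using runs_fill_matrix[OF inp A] by blast
  have f1: "input_stored \<sigma>1" "nat0 \<sigma>1 ''k'' = k" "reals \<sigma>1 ''vt'' = reals \<sigma> ''vt''"
    using runs_frame[OF r1] input_stored_frame[OF runs_frame[OF r1] inp] k(1)
    by (simp_all add: frame_def fill_matrix_def fill_entry_def)
  obtain \<sigma>2 where r2: "runs (For ''u'' ''n'' row_maximum) \<sigma>1 (n * (10 * n + 2) + 2) 0 \<sigma>2"
    and M2: "rows_stored {..<m} \<sigma>2"
    using runs_all_rows[OF _ M1] f1(1) by (auto simp: input_stored_def)
  have f2: "input_stored \<sigma>2" "nat0 \<sigma>2 ''k'' = k" "reals \<sigma>2 ''vt'' = reals \<sigma> ''vt''"
    using runs_frame[OF r2] input_stored_frame[OF runs_frame[OF r2] f1(1)] f1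
    by (simp_all add: frame_def)
  let ?v = "real1 \<sigma> ''vt''"
  define Inv where "Inv j \<rho> \<longleftrightarrow> (\<exists>es. length es = j \<and> selected ?v es \<and> rows_stored ({..<m} - set es) \<rho> \<and>
     (0 < j \<longrightarrow> nat0 \<rho> ''out'' = last es))" for j and \<rho> :: memory
  have rows_r: "rows_stored R (nwrite ''r'' 0 0 j \<rho>) = rows_stored R \<rho>" for R j \<rho>
    by (simp add: rows_stored_def matrix_of_def)
  have "\<exists>\<sigma>'. runs (For ''r'' ''k'' (best_row ;; extract_best ;; row_maximum)) \<sigma>2
      (k * (20 * n + 3 + 2) + 2) (k * 0) \<sigma>' \<and> Inv k \<sigma>'"
  proof (rule runs_For, goal_cases)
    case 5
    show ?case unfolding Inv_def rows_r using M2 by (intro exI[of _ "[]"]) (simp add: selected_def)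
  next
    case (6 j \<rho>)
    have f: "input_stored \<rho>" "reals \<rho> ''vt'' = reals \<sigma> ''vt''"
      using input_stored_frame[OF 6(4) f2(1)] 6(4) f2(3)
      by (simp_all add: frame_def best_row_def compare_row_def extract_best_def)
    obtain es where es: "length es = j" "selected ?v es" "rows_stored ({..<m} - set es) \<rho>"
      using 6(2) by (auto simp: Inv_def)
    have "card (set es) < m" using es(1) 6(1) k(3) card_length[of es] by linarith
    then have "\<not> {..<m} \<subseteq> set es" using card_mono[of "set es" "{..<m}"] by auto
    then have "{..<m} - set es \<noteq> {}" by blast
    then obtain \<sigma>' i where r: "runs (best_row ;; extract_best ;; row_maximum) \<rho> (20 * n + 3) 0 \<sigma>'"
      and i: "i \<in> {..<m} - set es" "\<forall>x\<in>{..<m} - set es. ?v x \<le> ?v i" "nat0 \<sigma>' ''out'' = i"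
        "rows_stored ({..<m} - set es - {i}) \<sigma>'"
      using runs_select_step[OF f(1) es(3)] unfolding f(2) by blast
    have "{..<m} - set (es @ [i]) = {..<m} - set es - {i}" by auto
    then have "Inv (Suc j) (nwrite ''r'' 0 0 (Suc j) \<sigma>')"
      unfolding Inv_def rows_r using i es(1) selected_snoc[OF es(2)] by (intro exI[of _ "es @ [i]"]) simp
    then show ?case using r by blast
  qed (use f2 in \<open>simp_all add: best_row_def compare_row_def extract_best_def\<close>)
  then obtain \<sigma>3 where r3: "runs (For ''r'' ''k'' (best_row ;; extract_best ;; row_maximum)) \<sigma>2
      (k * (20 * n + 3 + 2) + 2) 0 \<sigma>3" and I3: "Inv k \<sigma>3" by auto
  obtain es where es: "length es = k" "selected ?v es" "nat0 \<sigma>3 ''out'' = last es"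
    using I3 k(2) by (auto simp: Inv_def)
  obtain es' where es': "distinct (es @ es')" "set (es @ es') = {..<m}" "sorted_wrt (\<lambda>a b. ?v a \<ge> ?v b) (es @ es')"
    using selected_complete[OF es(2)] .
  have "sorted_wrt (\<lambda>a b. vitality G c s t a \<ge> vitality G c s t b) (es @ es')"
  proof (rule sorted_wrt_mono_rel[OF _ es'(3)])
    fix a b assume ab: "a \<in> set (es @ es')" "b \<in> set (es @ es')" "?v b \<le> ?v a"
    then have "a < m" "b < m" unfolding es'(2) by simp_all
    then show "vitality G c s t b \<le> vitality G c s t a" using vt ab(3) by simp
  qed
  moreover have "(es @ es') ! (k - 1) = result \<sigma>3"
  proof -
    have "es \<noteq> []" using es(1) k(2) by auto
    then show ?thesis using es(1,3) k(2) by (simp add: result_def nth_append last_conv_nth)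
  qed
  moreover have "set (es @ es') = arcs G" unfolding es'(2) arcs_eq ..
  moreover have "k \<le> length (es @ es')" using es(1) by simp
  ultimately have "kth_most_vital G c s t k (result \<sigma>3)"
    unfolding kth_most_vital_def using es'(1) k(2) by (intro exI[of _ "es @ es'"] conjI)
  moreover have "runs select_kth \<sigma> (100 * (n * (n + m))) 0 \<sigma>3"
    unfolding select_kth_def
  proof (rule runs_mono[OF runs_Seq[OF r1 runs_Seq[OF r2 r3]]])
    have 1: "m \<le> n * m" "n \<le> n * n" "1 \<le> n * m" using n_ge_2 m_pos by simp_all
    \<comment> \<open>Since \<open>n \<ge> 2\<close>, the additive 5 is at most
      \<open>3 * n\<close>.\<close>
    have "k * (20 * n + 3 + 2) \<le> m * (23 * n)" using k(3) n_ge_2 by (intro mult_le_mono) auto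
    also have "m * (23 * n) = 23 * (n * m)" by simp
    finally have 2: "k * (20 * n + 3 + 2) \<le> 23 * (n * m)" .
    have linear: "3 * m + 2 + (10 * x + 2 * n + 2 + (z + 2)) \<le> 100 * (x + y)"
      if "m \<le> y" "n \<le> x" "1 \<le> y" "z \<le> 23 * y" for x y z :: nat
      using that by simp
    have 3: "n * (10 * n + 2) = 10 * (n * n) + 2 * n" "n * (n + m) = n * n + n * m"
      by (simp_all add: algebra_simps)
    show "3 * m + 2 + (n * (10 * n + 2) + 2 + (k * (20 * n + 3 + 2) + 2)) \<le> 100 * (n * (n + m))"
      unfolding 3 by (rule linear[OF 1 2])
  qed simp
  ultimately show ?thesis by blast
qed

end

section \<open>The algorithm\<close>

text \<open>\<open>lam\<close> sums the net flow out of \<open>s\<close>, starting from the value 0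
  in the initial memory; a loop at \<open>s\<close> passes both tests and cancels. \<open>wt\<close>
  becomes the smaller of flow and slack.\<close>

definition prepare_arc :: com where
  "prepare_arc =
     If_then (NEq (N1 ''tail'' (N0 ''i'')) (N0 ''s'')) (RSet ''lam'' (RAdd (R0 ''lam'') (R1 ''f0'' (N0 ''i'')))) ;;
     If_then (NEq (N1 ''head'' (N0 ''i'')) (N0 ''s'')) (RSet ''lam'' (RSub (R0 ''lam'') (R1 ''f0'' (N0 ''i'')))) ;;
     RSet ''big'' (RAdd (R0 ''big'') (R1 ''cap'' (N0 ''i''))) ;;
     RSet1 ''wt'' (N0 ''i'') (R1 ''f0'' (N0 ''i'')) ;;
     If_then (RLess (RSub (R1 ''cap'' (N0 ''i'')) (R1 ''f0'' (N0 ''i''))) (R1 ''f0'' (N0 ''i'')))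
       (RSet1 ''wt'' (N0 ''i'') (RSub (R1 ''cap'' (N0 ''i'')) (R1 ''f0'' (N0 ''i''))))"

text \<open>Starting \<open>big\<close> at 1 makes it strictly larger than the total
  capacity.\<close>

definition prepare :: com where
  "prepare = MaxFlow (N0 ''n'') (N0 ''m'') ''tail'' ''head'' ''cap'' (N0 ''s'') (N0 ''t'') ''f0'' ;;
     RSet ''big'' (RConst 1) ;;
     For ''i'' ''m'' prepare_arc"

definition kth_vital_program :: com where
  "kth_vital_program = prepare ;; build_tree ;; build_forest ;; select_kth"

context vitality_program
begin

text \<open>The stored graph agrees with \<open>G\<close> on the arcs but may have other ends for
  numbers that are not arcs, so the two records need not be equal. Flows and their values depend on
  the arcs only.\<close>

lemma stored_graph_network:
  assumes "input_stored \<sigma>"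
  shows "st_network (stored_graph n m ''tail'' ''head'' \<sigma>) (real1 \<sigma> ''cap'') s t"
    "max_st_flow (stored_graph n m ''tail'' ''head'' \<sigma>) (real1 \<sigma> ''cap'') s t f \<longleftrightarrow> max_st_flow G c s t f"
proof -
  let ?H = "stored_graph n m ''tail'' ''head'' \<sigma>"
  have th: "tail ?H i = tail G i" "head ?H i = head G i" "real1 \<sigma> ''cap'' i = c i" if "i < m" for i
    using assms that by (simp_all add: stored_graph_def input_stored_def)
  have HA: "arcs ?H = {..<m}" "verts ?H = {..<n}" by (simp_all add: stored_graph_def)
  have "fin_digraph ?H" by unfold_locales (simp_all add: HA th ends_less)
  moreover have "nomulti_digraph ?H"
    by unfold_locales (use nomulti th arcs_eq ends_less in \<open>auto simp: HA arc_to_ends_def\<close>)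
  ultimately show "st_network ?H (real1 \<sigma> ''cap'') s t"
    using st_less cap_pos arcs_eq th by (simp add: st_network_def HA)
  have io: "in_arcs ?H v = in_arcs G v" "out_arcs ?H v = out_arcs G v" for v
    using th by (auto simp: in_arcs_def out_arcs_def HA arcs_eq)
  have "st_flow ?H (real1 \<sigma> ''cap'') s t g \<longleftrightarrow> st_flow G c s t g" for g
    unfolding st_flow_def io HA verts_eq arcs_eq using th(3) by auto
  moreover have "flow_value ?H s g = flow_value G s g" for g by (simp add: flow_value_def io)
  ultimately show "max_st_flow ?H (real1 \<sigma> ''cap'') s t f \<longleftrightarrow> max_st_flow G c s t f"
    by (simp add: max_st_flow_def)
qed

lemma runs_prepare:
  assumes inp: "input_stored \<sigma>" and lam: "real0 \<sigma> ''lam'' = 0"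
  shows "\<exists>\<sigma>' f. runs prepare \<sigma> (20 * m + 10) 1 \<sigma>' \<and> max_st_flow G c s t f \<and> ready \<sigma>' \<and>
    (\<forall>i<m. real1 \<sigma>' ''wt'' i = min (f i) (c i - f i))"
proof -
  let ?MF = "MaxFlow (N0 ''n'') (N0 ''m'') ''tail'' ''head'' ''cap'' (N0 ''s'') (N0 ''t'') ''f0''"
  have sc: "n = nval (N0 ''n'') \<sigma>" "m = nval (N0 ''m'') \<sigma>" "nval (N0 ''s'') \<sigma> = s" "nval (N0 ''t'') \<sigma> = t"
    using inp by (simp_all add: input_stored_def)
  have net: "st_network (stored_graph n m ''tail'' ''head'' \<sigma>) (real1 \<sigma> ''cap'') (nval (N0 ''s'') \<sigma>) (nval (N0 ''t'') \<sigma>)"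
    unfolding sc(3,4) by (rule stored_graph_network(1)[OF inp])
  obtain \<sigma>1 f where r1: "runs ?MF \<sigma> 1 1 \<sigma>1" and f: "max_st_flow G c s t f" and f0: "\<forall>i<m. real1 \<sigma>1 ''f0'' i = f i"
    using runs_MaxFlow[OF net sc(1,2), of "''f0''"] unfolding sc(3,4) stored_graph_network(2)[OF inp] by auto
  have f1: "input_stored \<sigma>1" "real0 \<sigma>1 ''lam'' = 0"
    using input_stored_frame[OF runs_frame[OF r1] inp] runs_frame[OF r1] lam by (simp_all add: frame_def)
  let ?\<sigma>2 = "rwrite ''big'' 0 0 1 \<sigma>1"
  have r2: "runs (RSet ''big'' (RConst 1)) \<sigma>1 1 0 ?\<sigma>2"
    using runs_effect[of "RSet ''big'' (RConst 1)" \<sigma>1] by simp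
  have f2: "input_stored ?\<sigma>2" using f1(1) by (simp add: input_stored_def)
  define out where "out i = (if tail G i = s then f i else 0) - (if head G i = s then f i else 0)" for i
  define Inv where "Inv k \<rho> \<longleftrightarrow> real0 \<rho> ''lam'' = (\<Sum>i<k. out i) \<and> real0 \<rho> ''big'' = 1 + (\<Sum>i<k. c i) \<and>
    (\<forall>i<k. real1 \<rho> ''wt'' i = min (f i) (c i - f i))" for k and \<rho> :: memory
  have "\<exists>\<sigma>'. runs (For ''i'' ''m'' prepare_arc) ?\<sigma>2 (m * (cost prepare_arc + 2) + 2) 0 \<sigma>' \<and> Inv m \<sigma>'"
  proof (rule runs_For_straight, goal_cases)
    case (7 k \<rho>)
    have "input_stored \<rho>" by (rule input_stored_frame[OF 7(4) f2]) (simp_all add: prepare_arc_def)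
    then have th: "nat1 \<rho> ''tail'' k = tail G k" "nat1 \<rho> ''head'' k = head G k" "real1 \<rho> ''cap'' k = c k" "nat0 \<rho> ''s'' = s"
      using 7(1) by (simp_all add: input_stored_def)
    have fk: "real1 \<rho> ''f0'' k = f k" using 7(4) f0 7(1) by (simp add: frame_def prepare_arc_def)
    have "real0 (effect prepare_arc \<rho>) ''lam'' = real0 \<rho> ''lam'' + out k"
      "real0 (effect prepare_arc \<rho>) ''big'' = real0 \<rho> ''big'' + c k"
      "\<And>i. real1 (effect prepare_arc \<rho>) ''wt'' i = (if i = k then min (f k) (c k - f k) else real1 \<rho> ''wt'' i)"
      using th fk 7(3) by (simp_all add: prepare_arc_def out_def)
    then show ?case using 7(2) by (auto simp: Inv_def less_Suc_eq)
  qed (use f1 f2 in \<open>simp_all add: prepare_arc_def Inv_def input_stored_def\<close>)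
  then obtain \<sigma>3 where r3: "runs (For ''i'' ''m'' prepare_arc) ?\<sigma>2 (m * (cost prepare_arc + 2) + 2) 0 \<sigma>3"
    and I3: "Inv m \<sigma>3" by blast
  have "(\<Sum>i<m. out i) = flow_value G s f"
  proof -
    have "(\<Sum>i<m. if tail G i = s then f i else 0) = sum f (out_arcs G s)"
      by (rule sum.mono_neutral_cong_right) (auto simp: arcs_eq)
    moreover have "(\<Sum>i<m. if head G i = s then f i else 0) = sum f (in_arcs G s)"
      by (rule sum.mono_neutral_cong_right) (auto simp: arcs_eq)
    ultimately show ?thesis by (simp add: out_def sum_subtractf flow_value_def)
  qed
  then have "real0 \<sigma>3 ''lam'' = mincut_capacity G c s t"
    using I3 max_flow_min_cut[OF f] by (simp add: Inv_def)
  moreover have "sum c (arcs G) < real0 \<sigma>3 ''big''" using I3 by (simp add: Inv_def arcs_eq)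
  moreover have "input_stored \<sigma>3" by (rule input_stored_frame[OF runs_frame[OF r3] f2]) (simp_all add: prepare_arc_def)
  ultimately have "ready \<sigma>3" by (simp add: ready_def)
  moreover have "runs prepare \<sigma> (20 * m + 10) 1 \<sigma>3"
    unfolding prepare_def
    by (rule runs_mono[OF runs_Seq[OF r1 runs_Seq[OF r2 r3]]]) (simp_all add: prepare_arc_def)
  ultimately show ?thesis using f I3 by (intro exI[of _ \<sigma>3] exI[of _ f]) (simp add: Inv_def)
qed

text \<open>The flows number 1 for the preparation, \<open>2 * n\<close> for the tree and
  \<open>n\<close> for the forest; the selection needs none.\<close>

lemma runs_kth_vital_program:
  assumes k: "1 \<le> k" "k \<le> m"
  shows "\<exists>\<sigma>. runs kth_vital_program (input G c s t k) (10000 * (n * (n + m))) (10 * n) \<sigma> \<and>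
    kth_most_vital G c s t k (result \<sigma>)"
proof -
  let ?\<sigma> = "input G c s t k"
  have inp: "input_stored ?\<sigma>" by (simp add: input_stored_def input_def verts_eq arcs_eq)
  obtain \<sigma>1 f where r1: "runs prepare ?\<sigma> (20 * m + 10) 1 \<sigma>1" and f: "max_st_flow G c s t f" and rdy1: "ready \<sigma>1"
    and w1: "\<forall>i<m. real1 \<sigma>1 ''wt'' i = min (f i) (c i - f i)"
    using runs_prepare[OF inp] by (auto simp: input_def)
  have f1: "reals \<sigma>1 ''vt'' = reals ?\<sigma> ''vt''" "nats \<sigma>1 ''leaf'' = nats ?\<sigma> ''leaf''" "nats \<sigma>1 ''in'' = nats ?\<sigma> ''in''"
    "nats \<sigma>1 ''A'' = nats ?\<sigma> ''A''" "nat0 \<sigma>1 ''k'' = k"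
    using runs_frame[OF r1] by (simp_all add: frame_def prepare_def prepare_arc_def input_def)
  \<comment> \<open>The table \<open>vt\<close> is initially zero, which is admissible because
    vitalities are nonnegative.\<close>
  have s1: "sound \<sigma>1" using f1(1) vitality_nonneg arcs_eq by (simp add: sound_def input_def)
  obtain \<sigma>2 where r2: "runs build_tree \<sigma>1 (3000 * (n * (n + m))) (2 * n) \<sigma>2" and s2: "sound \<sigma>2"
    and tree: "pairs_recorded \<sigma>2"
    using runs_build_tree[OF rdy1 s1] f1(2) by (auto simp: input_def)
  have f2: "ready \<sigma>2" "reals \<sigma>2 ''wt'' = reals \<sigma>1 ''wt''" "nats \<sigma>2 ''in'' = nats ?\<sigma> ''in''"
    "nats \<sigma>2 ''A'' = nats ?\<sigma> ''A''" "nat0 \<sigma>2 ''k'' = k"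
    using runs_frame[OF r2] ready_frame[OF runs_frame[OF r2] rdy1] f1 by (simp_all add: frame_def)
  have "st_flow G c s t f" using f by (simp add: max_st_flow_def)
  then have w2: "\<forall>i<m. real1 \<sigma>2 ''wt'' i = min (f i) (c i - f i) \<and> 0 \<le> min (f i) (c i - f i)"
    using w1 f2(2) by (simp add: st_flow_def arcs_eq)
  obtain \<sigma>3 where r3: "runs build_forest \<sigma>2 (3000 * (n * (n + m))) n \<sigma>3" and s3: "sound \<sigma>3" and g3: "grows \<sigma>2 \<sigma>3"
    and forest: "\<forall>e<m. \<forall>X. bottleneck G (\<lambda>i. min (f i) (c i - f i)) e X \<longrightarrow> arc_cut_recorded \<sigma>3 e"
    using runs_build_forest[OF f2(1) s2 w2] f2(3) by (auto simp: input_def)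
  have f3: "input_stored \<sigma>3" "nats \<sigma>3 ''A'' = nats ?\<sigma> ''A''" "nat0 \<sigma>3 ''k'' = k"
    using runs_frame[OF r3] ready_frame[OF runs_frame[OF r3] f2(1)] f2 by (simp_all add: frame_def ready_def)
  \<comment> \<open>The forest phase only raises entries of \<open>vt\<close>, so the cuts recorded
    by the tree stay recorded.\<close>
  have tree3: "pairs_recorded \<sigma>3"
    using tree recorded_grows[OF _ g3] unfolding pairs_recorded_def by meson
  have vt: "\<forall>e<m. real1 \<sigma>3 ''vt'' e = vitality G c s t e"
    using vitality_computed[OF f s3 tree3 forest] by blast
  obtain \<sigma>4 where r4: "runs select_kth \<sigma>3 (100 * (n * (n + m))) 0 \<sigma>4" and res: "kth_most_vital G c s t k (result \<sigma>4)"
    using runs_select_kth[OF f3(1) _ f3(3) k vt] f3(2) by (auto simp: input_def)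
  have "runs kth_vital_program ?\<sigma> (10000 * (n * (n + m))) (10 * n) \<sigma>4"
    unfolding kth_vital_program_def
  proof (rule runs_mono[OF runs_Seq[OF r1 runs_Seq[OF r2 runs_Seq[OF r3 r4]]]])
    have le: "n + m \<le> n * (n + m)"
      by (rule order_trans[OF _ mult_le_mono1[of 1 n "n + m"]]) (use n_ge_2 in simp_all)
    have 1: "m \<le> n * (n + m)" "1 \<le> n * (n + m)"
      by (rule order_trans[OF _ le], use n_ge_2 in simp)+
    have linear: "20 * m + 10 + (3000 * x + (3000 * x + 100 * x)) \<le> 10000 * x" if "m \<le> x" "1 \<le> x" for x :: nat
      using that by simp
    show "20 * m + 10 + (3000 * (n * (n + m)) + (3000 * (n * (n + m)) + 100 * (n * (n + m)))) \<le> 10000 * (n * (n + m))"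
      by (rule linear[OF 1])
  qed (use n_ge_2 in simp)
  then show ?thesis using res by blast
qed

end

theorem theorem27:
  shows "\<exists>P d. \<forall>mf. max_flow_oracle mf \<longrightarrow>
    (\<forall>(G :: (nat, nat) pre_digraph) (c :: nat \<Rightarrow> real) s t n m k.
       st_network G c s t \<longrightarrow> verts G = {..<n} \<longrightarrow> arcs G = {..<m} \<longrightarrow> k \<in> {1..m} \<longrightarrow>
       (\<exists>\<sigma>. runs_with_flows mf P (input G c s t k) n m d \<sigma> \<and>
            kth_most_vital G c s t k (result \<sigma>)))"
proof (intro exI[of _ kth_vital_program] exI[of _ 10000] allI impI)
  fix mf :: flow_oracle and G :: "(nat, nat) pre_digraph" and c :: "nat \<Rightarrow> real" and s t n m k :: nat
  assume "max_flow_oracle mf" "st_network G c s t" "verts G = {..<n}" "arcs G = {..<m}" "k \<in> {1..m}"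
  then interpret vitality_program mf n m G c s t by unfold_locales auto
  obtain \<sigma> where run: "runs kth_vital_program (input G c s t k) (10000 * (n * (n + m))) (10 * n) \<sigma>"
    and res: "kth_most_vital G c s t k (result \<sigma>)"
    using runs_kth_vital_program[of k] \<open>k \<in> {1..m}\<close> by auto
  \<comment> \<open>The step count dictates the constant; the \<open>10 * n\<close> flows and the
    sizes \<open>7 * n\<close> and \<open>7 * m\<close> lie far below it.\<close>
  have "runs_with_flows mf kth_vital_program (input G c s t k) n m 10000 \<sigma>"
    using run unfolding runs_def runs_with_flows_def by fastforce
  then show "\<exists>\<sigma>. runs_with_flows mf kth_vital_program (input G c s t k) n m 10000 \<sigma> \<and>
      kth_most_vital G c s t k (result \<sigma>)"
    using res by blast
qed

end
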